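(* Let $K\in\{1,-1\}$, let $\Sigma\subset\mathbb{R}^3$ be the unit sphere (if $K=1$) or the upper sheet of the hyperboloid $\{x_1^2+x_2^2-x_3^2=-1\}$ with the metric induced by $dx_1^2+dx_2^2-dx_3^2$ (if $K=-1$), and let $\Omega\subset\Sigma$ be a convex domain. Let $\gamma$ be a smooth regular non-geodesic arc of the boundary of $\Omega$. Suppose that the Birkhoff billiard in $\Omega$ admits a polynomial integral $\Phi$ of even degree $n$. Let $\tilde\Gamma\subset\mathbb{C}P^2$ be the dual curve of the irreducible component $\tilde\gamma\subset\mathbb{C}P^2$ of the algebraic curve determined by $\gamma$, let $F\in\mathbb{C}[x_1,x_2,x_3]$ be the irreducible homogeneous defining polynomial of $\tilde\Gamma$, and let $d=\deg F\ge 2$. Then there exist an integer $k\ge 1$, an integer $\alpha\ge 0$, a constant $c$, and homogeneous polynomials $Q,R\in\mathbb{C}[x_1,x_2,x_3]$ such that $Q$ does not vanish identically on $\tilde\Gamma$ and $$Q^3\,\bigl(\mathrm{Hess}(F)\bigr)^k-c\,(x_1^2+x_2^2+Kx_3^2)^{\alpha}=F\cdot R\qquad\text{for all }(x_1,x_2,x_3)\in\mathbb{C}^3,$$ and moreover $\alpha$ is a positive integer when $d>2$.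
   Context: For $K=1$ the unit sphere carries the metric induced from Euclidean $\mathbb{R}^3$. Birkhoff billiard inside $\Omega\subset\Sigma$: a point moves with unit speed along geodesics of $\Sigma$ inside $\Omega$ and, on hitting the boundary, is reflected by the law of geometric optics (the tangential component of the velocity is preserved and the normal component changes sign). A polynomial integral is a non-constant function $\Phi$ on the unit tangent bundle $T_1\Omega$ which is polynomial in the velocity $v$ (with coefficients depending on the position $r$) and keeps constant values along the orbits of the billiard flow; its degree is its degree as a polynomial in $v$. $\hat\gamma$ denotes the image of $\gamma$ under the projection $\mathbb{R}^3\setminus\{0\}\to\mathbb{R}P^2$. It is known (Bolotin, 1992) that, if a non-constant polynomial integral exists and $\gamma$ is non-geodesic, then $\hat\gamma$ is algebraic, i.e. contained in an algebraic curve; $\tilde\gamma\subset\mathbb{C}P^2$ denotes the (complex) irreducible component of this curve, which is not a line since $\gamma$ is not a geodesic. The dual curve $\tilde\Gamma$ is the usual projective dual of $\tilde\gamma$, i.e. the irreducible curve which is the closure of the set of tangent lines at smooth points of $\tilde\gamma$, where the line $\{m_1x_1+m_2x_2+m_3x_3=0\}$ is identified with the point $(m_1:m_2:m_3)\in\mathbb{C}P^2$. Equivalently, $\tilde\Gamma$ is the irreducible complex algebraic curve containing the projection of $\Gamma(s)=\gamma(s)\wedge\dot\gamma(s)$ ($s$ the arc-length parameter, $\wedge$ the standard vector product in $\mathbb{R}^3$). $\mathrm{Hess}(F)(x_1,x_2,x_3)=\det\bigl(F_{x_ix_j}\bigr)_{1\le i,j\le 3}$ is the determinant of the $3\times 3$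 matrix of second partial derivatives of $F$. *)

theory Defs
  imports "HOL-Analysis.Analysis" "HOL-Computational_Algebra.Polynomial"
begin

section \<open>The surface and its geodesics\<close>

text \<open>
  The ambient quadratic form \<open>dx\<^sub>1\<^sup>2 + dx\<^sub>2\<^sup>2 + K dx\<^sub>3\<^sup>2\<close>.  It is Euclidean for \<open>K = 1\<close> and Minkowskian
  for \<open>K = -1\<close>, and in both cases it induces the Riemannian metric of the surface.
\<close>

definition form :: "real \<Rightarrow> real^3 \<Rightarrow> real^3 \<Rightarrow> real" where
  "form K x y = x$1 * y$1 + x$2 * y$2 + K * (x$3 * y$3)"

definition surface :: "real \<Rightarrow> (real^3) set" where
  "surface K = (if K = 1 then sphere 0 1
     else {x. (x$1)^2 + (x$2)^2 - (x$3)^2 = -1 \<and> x$3 > 0})"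

text \<open>
  On both surfaces \<open>form K x x = K\<close>, so the tangent plane is the \<open>form\<close>-orthogonal complement
  of the position vector.
\<close>

definition tangent_plane :: "real \<Rightarrow> real^3 \<Rightarrow> (real^3) set" where
  "tangent_plane K r = {v. form K r v = 0}"

definition unit_tangent_bundle :: "real \<Rightarrow> (real^3) set \<Rightarrow> ((real^3) \<times> (real^3)) set" where
  "unit_tangent_bundle K \<Omega> = {(r, v). r \<in> \<Omega> \<and> v \<in> tangent_plane K r \<and> form K v v = 1}"

text \<open>
  Unit-speed geodesic \<open>c\<close> with velocity \<open>v\<close>: the acceleration has no tangential component, i.e. the
  covariant derivative of the velocity for the induced metric vanishes.
\<close>

definition unit_geodesic ::
    "real \<Rightarrow> real set \<Rightarrow> (real \<Rightarrow> real^3) \<Rightarrow> (real \<Rightarrow> real^3) \<Rightarrow> bool" where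
  "unit_geodesic K I c v \<longleftrightarrow>
     (\<forall>t\<in>I. c t \<in> surface K \<and>
            (c has_vector_derivative v t) (at t within I) \<and>
            form K (v t) (v t) = 1 \<and>
            (\<exists>w. (v has_vector_derivative w) (at t within I) \<and>
                 (\<forall>u \<in> tangent_plane K (c t). form K w u = 0)))"

definition geodesic_segment ::
    "real \<Rightarrow> real^3 \<Rightarrow> real^3 \<Rightarrow> real \<Rightarrow> (real \<Rightarrow> real^3) \<Rightarrow> bool" where
  "geodesic_segment K p q l c \<longleftrightarrow>
     0 < l \<and> (\<exists>v. unit_geodesic K {0..l} c v) \<and> c 0 = p \<and> c l = q"

text \<open>
  Convexity: any two points are joined inside \<open>\<Omega>\<close> by a shortest geodesic segment.  (Without
  ``shortest'' the complement of a small disc in the sphere would be convex.)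
\<close>

definition convex_domain :: "real \<Rightarrow> (real^3) set \<Rightarrow> bool" where
  "convex_domain K \<Omega> \<longleftrightarrow>
     \<Omega> \<noteq> {} \<and> openin (top_of_set (surface K)) \<Omega> \<and> connected \<Omega> \<and>
     (\<forall>p\<in>\<Omega>. \<forall>q\<in>\<Omega>. p \<noteq> q \<longrightarrow>
        (\<exists>l c. geodesic_segment K p q l c \<and> c ` {0..l} \<subseteq> \<Omega> \<and>
               (\<forall>l' c'. geodesic_segment K p q l' c' \<longrightarrow> l \<le> l')))"

section \<open>Boundary arcs\<close>

definition boundary :: "real \<Rightarrow> (real^3) set \<Rightarrow> (real^3) set" where
  "boundary K \<Omega> = (top_of_set (surface K)) frontier_of \<Omega>"

definition smooth_curve_on :: "real set \<Rightarrow> (real \<Rightarrow> real^3) \<Rightarrow> bool" where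
  "smooth_curve_on I c \<longleftrightarrow>
     (\<exists>D :: nat \<Rightarrow> real \<Rightarrow> real^3. D 0 = c \<and>
        (\<forall>m. \<forall>t\<in>I. (D m has_vector_derivative D (Suc m) t) (at t)))"

text \<open>
  A smooth regular open arc of the boundary.  The openness condition says that near each of its
  points the whole boundary of \<open>\<Omega>\<close> is the arc, so that the boundary has a tangent line there.
\<close>

definition smooth_boundary_arc ::
    "real \<Rightarrow> (real^3) set \<Rightarrow> real \<Rightarrow> real \<Rightarrow> (real \<Rightarrow> real^3) \<Rightarrow> bool" where
  "smooth_boundary_arc K \<Omega> a b c \<longleftrightarrow>
     a < b \<and> smooth_curve_on {a<..<b} c \<and>
     (\<forall>t\<in>{a<..<b}. vector_derivative c (at t) \<noteq> 0) \<and> inj_on c {a<..<b} \<and>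
     openin (top_of_set (boundary K \<Omega>)) (c ` {a<..<b})"

definition is_geodesic_arc :: "real \<Rightarrow> real \<Rightarrow> real \<Rightarrow> (real \<Rightarrow> real^3) \<Rightarrow> bool" where
  "is_geodesic_arc K a b c \<longleftrightarrow> (\<exists>g v. unit_geodesic K UNIV g v \<and> c ` {a<..<b} \<subseteq> range g)"

section \<open>The billiard and its polynomial integrals\<close>

text \<open>
  Reflection at the point \<open>q\<close> of a boundary curve with tangent vector \<open>\<tau>\<close>, taking the incoming
  velocity \<open>v\<close> to the outgoing velocity \<open>w\<close>.
\<close>

definition reflects :: "real \<Rightarrow> real^3 \<Rightarrow> real^3 \<Rightarrow> real^3 \<Rightarrow> real^3 \<Rightarrow> bool" where
  "reflects K q \<tau> v w \<longleftrightarrow>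
     w \<in> tangent_plane K q \<and> form K w \<tau> = form K v \<tau> \<and>
     (\<forall>\<nu> \<in> tangent_plane K q. form K \<nu> \<tau> = 0 \<longrightarrow> form K w \<nu> = - form K v \<nu>)"

text \<open>
  \<open>billiard_orbit K \<Omega> s s'\<close>: the billiard flow takes the phase point \<open>s\<close> over the interior to the
  phase point \<open>s'\<close> over the interior in a finite time, with finitely many reflections.  Orbits that
  reach a non-smooth boundary point are not continued.
\<close>

inductive billiard_orbit ::
    "real \<Rightarrow> (real^3) set \<Rightarrow> (real^3) \<times> (real^3) \<Rightarrow> (real^3) \<times> (real^3) \<Rightarrow> bool"
  for K :: real and \<Omega> :: "(real^3) set" where
  flight: "\<lbrakk>0 < T; unit_geodesic K {0..T} c v; c ` {0..T} \<subseteq> \<Omega>\<rbrakk>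
     \<Longrightarrow> billiard_orbit K \<Omega> (c 0, v 0) (c T, v T)"
| bounce: "\<lbrakk>0 < T; unit_geodesic K {0..T} c v; c ` {0..<T} \<subseteq> \<Omega>;
      smooth_boundary_arc K \<Omega> a b \<beta>; s \<in> {a<..<b}; c T = \<beta> s;
      reflects K (\<beta> s) (vector_derivative \<beta> (at s)) (v T) (v' 0);
      0 < T'; unit_geodesic K {0..T'} c' v'; c' 0 = \<beta> s; c' ` {0<..T'} \<subseteq> \<Omega>\<rbrakk>
     \<Longrightarrow> billiard_orbit K \<Omega> (c 0, v 0) (c' T', v' T')"
| compose: "\<lbrakk>billiard_orbit K \<Omega> p q; billiard_orbit K \<Omega> q r\<rbrakk> \<Longrightarrow> billiard_orbit K \<Omega> p r"

text \<open>
  On the unit tangent bundle \<open>\<Phi>\<close> agrees with a polynomial of degree \<open>n\<close> in the components of the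
  velocity whose coefficients are arbitrary functions of the position.  Because of the relations
  satisfied by unit tangent vectors, \<open>\<Phi>\<close> alone does not determine this polynomial.
\<close>

definition velocity_polynomial ::
    "real \<Rightarrow> (real^3) set \<Rightarrow> nat \<Rightarrow> ((real^3) \<times> (real^3) \<Rightarrow> real) \<Rightarrow> bool" where
  "velocity_polynomial K \<Omega> n \<Phi> \<longleftrightarrow>
     (\<exists>A :: nat \<times> nat \<times> nat \<Rightarrow> real^3 \<Rightarrow> real.
        (\<forall>(r, v) \<in> unit_tangent_bundle K \<Omega>.
           \<Phi> (r, v) = (\<Sum>(i, j, k) \<in> {(i, j, k). i + j + k \<le> n}.
                         A (i, j, k) r * (v$1)^i * (v$2)^j * (v$3)^k)) \<and>
        (\<exists>r\<in>\<Omega>. \<exists>i j k. i + j + k = n \<and> A (i, j, k) r \<noteq> 0))"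

definition polynomial_integral ::
    "real \<Rightarrow> (real^3) set \<Rightarrow> nat \<Rightarrow> ((real^3) \<times> (real^3) \<Rightarrow> real) \<Rightarrow> bool" where
  "polynomial_integral K \<Omega> n \<Phi> \<longleftrightarrow>
     velocity_polynomial K \<Omega> n \<Phi> \<and>
     \<not> \<Phi> constant_on unit_tangent_bundle K \<Omega> \<and>
     (\<forall>s s'. billiard_orbit K \<Omega> s s' \<longrightarrow> \<Phi> s = \<Phi> s')"

section \<open>Ternary forms and plane projective curves\<close>

text \<open>
  \<open>\<complex>[x\<^sub>1,x\<^sub>2,x\<^sub>3]\<close> is represented as \<open>\<complex>[x\<^sub>3][x\<^sub>2][x\<^sub>1]\<close>, with \<open>x\<^sub>1\<close> the outermost variable.
\<close>

type_synonym poly3 = "complex poly poly poly"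

definition coeff3 :: "poly3 \<Rightarrow> nat \<Rightarrow> nat \<Rightarrow> nat \<Rightarrow> complex" where
  "coeff3 P i j k = coeff (coeff (coeff P i) j) k"

definition eval3 :: "poly3 \<Rightarrow> complex^3 \<Rightarrow> complex" where
  "eval3 P x = poly (poly (poly P [:[:x$1:]:]) [:x$2:]) (x$3)"

definition homogeneous :: "nat \<Rightarrow> poly3 \<Rightarrow> bool" where
  "homogeneous m P \<longleftrightarrow> (\<forall>i j k. coeff3 P i j k \<noteq> 0 \<longrightarrow> i + j + k = m)"

definition partial :: "3 \<Rightarrow> poly3 \<Rightarrow> poly3" where
  "partial i P =
     (if i = 1 then pderiv P
      else if i = 2 then map_poly pderiv P
      else map_poly (map_poly pderiv) P)"

definition gradient :: "poly3 \<Rightarrow> complex^3 \<Rightarrow> complex^3" where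
  "gradient P x = (\<chi> i. eval3 (partial i P) x)"

definition Hess :: "poly3 \<Rightarrow> poly3" where
  "Hess P = det (\<chi> i j. partial i (partial j P))"

text \<open>
  Subsets of \<open>\<complex>P\<^sup>2\<close> are represented by the set of all (nonzero) homogeneous coordinate vectors of
  their points.
\<close>

definition curve :: "poly3 \<Rightarrow> (complex^3) set" where
  "curve P = {x. x \<noteq> 0 \<and> eval3 P x = 0}"

text \<open>
  The dual of the curve of an irreducible form \<open>P\<close>.  Since \<open>P\<close> is irreducible, a point of the curve
  is smooth iff the gradient does not vanish there, and the gradient is then the coordinate vector
  of the tangent line.  The projection from the nonzero vectors to \<open>\<complex>P\<^sup>2\<close> is continuous and open,
  so the closure in \<open>\<complex>P\<^sup>2\<close> corresponds to the closure among the nonzero vectors.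
\<close>

definition dual_curve :: "poly3 \<Rightarrow> (complex^3) set" where
  "dual_curve P =
     closure {m. \<exists>x \<in> curve P. gradient P x \<noteq> 0 \<and> (\<exists>t. t \<noteq> 0 \<and> m = t *s gradient P x)} - {0}"

definition complexify :: "real^3 \<Rightarrow> complex^3" where
  "complexify x = (\<chi> i. complex_of_real (x$i))"

end

theory Submission
  imports Defs "HOL-Computational_Algebra.Polynomial_Factorial" "HOL-Computational_Algebra.Field_as_Ring"
begin

text \<open>
  The angular momentum \<open>z = r \<times> v\<close> is constant along a flight, so the integral is a function of \<open>z\<close>
  that is polynomial on each plane \<open>r\<^sup>\<bottom>\<close> with \<open>r\<close> in the domain; such a function is polynomial.  Its even
  part, or else the square of its odd part, thus extends to a nontrivial form \<open>\<Psi>\<close> of even degree, made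
  homogeneous by powers of \<open>\<Lambda> = x\<^sub>1\<^sup>2 + x\<^sub>2\<^sup>2 + K x\<^sub>3\<^sup>2\<close>.  Let \<open>y\<close> be \<open>\<gamma> \<times> \<gamma>'\<close> divided by the square root of its
  \<open>\<Lambda>\<close>.  The reflection law says that \<open>\<Psi> (y + \<epsilon> y')\<close> is even in \<open>\<epsilon>\<close>.  Hence \<open>\<Psi>\<close> is constant along \<open>y\<close>, and after
  subtracting a multiple of a power of \<open>\<Lambda>\<close> it vanishes there, so that \<open>\<Psi> = F\<^sup>k Q\<close> with \<open>Q\<close> prime to \<open>F\<close>.  The
  first odd coefficient in \<open>\<epsilon>\<close> of \<open>F\<^sup>k Q\<close> then says that \<open>Q\<^sup>3 Hess(F)\<^sup>k\<close> is constant along \<open>y\<close>, where \<open>\<Lambda> = 1\<close>, and a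
  form that vanishes on this arc is divisible by \<open>F\<close>.
\<close>

section \<open>Ternary forms\<close>

text \<open>The exponents 3 and \<open>k\<close> come from comparing two logarithmic derivatives
  along \<open>y\<close>. With \<open>A\<close> and \<open>B\<close> the second and third derivative
  of \<open>F\<close> at \<open>y\<close> in direction \<open>y'\<close>, the expansion of the
  product gives 3 Q'/Q = - k B/A, and the Hessian H of \<open>F\<close> satisfies H'/H = B/A. That
  \<open>A\<close> is nonzero reflects the nonzero geodesic curvature of \<gamma>. The odd part
  enters through its square, because making it homogeneous itself would take an odd power of the
  square root of \<Lambda>. If neither choice were nontrivial, the odd part would have constant
  square; being odd, it has a zero among the lines through each point, so it would vanish and the
  integral would be constant. Two obstacles shape the rest. The reflection law is needed for every
  \<epsilon>, so every direction transversal to the arc must come from a flight inside the domain;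
  here convexity enters, through the cone over the domain in real 3-space. And all divisibility in
  the complex polynomial ring must be read off a short real arc, so the arc is shrunk to where
  everything is nondegenerate, and elimination of a variable replaces intersection theory.\<close>

lemma eval3_simps [simp]:
  "eval3 0 x = 0" "eval3 1 x = 1" "eval3 (P + Q) x = eval3 P x + eval3 Q x"
  "eval3 (- P) x = - eval3 P x"
  "eval3 (P - Q) x = eval3 P x - eval3 Q x" "eval3 (P * Q) x = eval3 P x * eval3 Q x"
  "eval3 (P ^ n) x = eval3 P x ^ n"
  by (simp_all add: eval3_def poly_power)

definition eval2 :: "complex poly poly \<Rightarrow> complex \<Rightarrow> complex \<Rightarrow> complex" where
  "eval2 p y z = poly (poly p [:y:]) z"

lemma eval3_pCons [simp]: "eval3 (pCons p P) x = eval2 p (x$2) (x$3) + x$1 * eval3 P x"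
  by (simp add: eval3_def eval2_def)

lemma eval2_simps [simp]: "eval2 0 y z = 0" "eval2 (pCons q p) y z = poly q z + y * eval2 p y z"
  by (simp_all add: eval2_def)

lemma poly_eq_0_on_infinite:
  fixes p :: "'a::idom poly"
  assumes "infinite S" "\<And>x. x \<in> S \<Longrightarrow> poly p x = 0"
  shows "p = 0"
proof (rule ccontr)
  assume "p \<noteq> 0"
  then have "finite {x. poly p x = 0}" by (rule poly_roots_finite)
  moreover have "S \<subseteq> {x. poly p x = 0}" using assms(2) by auto
  ultimately show False using assms(1) finite_subset by blast
qed

lemma complexify_simps [simp]:
  "complexify x $ i = complex_of_real (x $ i)"
  "complexify (x + y) = complexify x + complexify y"
  "complexify (c *\<^sub>R x) = complex_of_real c *s complexify x"
  "complexify 0 = 0" "complexify x = 0 \<longleftrightarrow> x = 0"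
  by (auto simp: complexify_def vec_eq_iff)

lemma infinite_of_real: "infinite (range complex_of_real)"
  by (metis infinite_UNIV_char_0 finite_imageD inj_of_real)

text \<open>Real points are Zariski dense: the variables are removed from the innermost outwards,
  since a nonzero polynomial over a domain has finitely many roots.\<close>

lemma eval3_real_eq_0_imp_0:
  assumes "\<And>x. eval3 P (complexify x) = 0"
  shows "P = 0"
proof -
  define S where "S = range complex_of_real"
  have inf: "infinite S" by (simp add: S_def infinite_of_real)
  have z: "poly (poly (poly P [:[:a:]:]) [:b:]) c = 0" if "a \<in> S" "b \<in> S" "c \<in> S" for a b c
  proof -
    from that obtain x y z where "a = of_real x" "b = of_real y" "c = of_real z" by (auto simp: S_def)
    then show ?thesis using assms[of "vector [x,y,z]"] by (simp add: eval3_def)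
  qed
  have 1: "poly (poly P [:[:a:]:]) [:b:] = 0" if "a \<in> S" "b \<in> S" for a b
    using poly_eq_0_on_infinite[OF inf] z that by blast
  have 2: "poly P [:[:a:]:] = 0" if "a \<in> S" for a
  proof (rule poly_eq_0_on_infinite[of "(\<lambda>b. [:b:]) ` S"])
    show "infinite ((\<lambda>b. [:b:]) ` S)" using inf by (subst finite_image_iff) (auto simp: inj_on_def)
  qed (use 1 that in auto)
  show ?thesis
  proof (rule poly_eq_0_on_infinite[of "(\<lambda>b. [:[:b:]:]) ` S"])
    show "infinite ((\<lambda>b. [:[:b:]:]) ` S)" using inf by (subst finite_image_iff) (auto simp: inj_on_def)
  qed (use 2 in auto)
qed

lemma eval3_ext: "(\<And>x. eval3 P x = eval3 Q x) \<Longrightarrow> P = Q"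
  using eval3_real_eq_0_imp_0[of "P - Q"] by simp

lemma coeff3_simps [simp]:
  "coeff3 0 i j k = 0" "coeff3 (P + Q) i j k = coeff3 P i j k + coeff3 Q i j k"
  "coeff3 (P - Q) i j k = coeff3 P i j k - coeff3 Q i j k"
  "coeff3 (- Q) i j k = - coeff3 Q i j k"
  by (simp_all add: coeff3_def)

lemma coeff3_ext: "(\<And>i j k. coeff3 P i j k = coeff3 Q i j k) \<Longrightarrow> P = Q"
  by (simp add: coeff3_def poly_eq_iff)

lemma coeff3_mult:
  "coeff3 (P * Q) i j k =
    (\<Sum>a\<le>i. \<Sum>b\<le>j. \<Sum>c\<le>k. coeff3 P a b c * coeff3 Q (i - a) (j - b) (k - c))"
  by (simp add: coeff3_def coeff_mult coeff_sum)

lemma homogeneous_0 [simp]: "homogeneous m 0"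
  and homogeneous_add: "homogeneous m P \<Longrightarrow> homogeneous m Q \<Longrightarrow> homogeneous m (P + Q)"
  and homogeneous_diff: "homogeneous m P \<Longrightarrow> homogeneous m Q \<Longrightarrow> homogeneous m (P - Q)"
  by (simp_all add: homogeneous_def) (metis add_0 diff_zero)+

lemma homogeneous_mult:
  assumes "homogeneous m P" "homogeneous n Q"
  shows "homogeneous (m + n) (P * Q)"
  unfolding homogeneous_def
proof (intro allI impI)
  fix i j k assume "coeff3 (P * Q) i j k \<noteq> 0"
  then obtain a where "a \<le> i" "(\<Sum>b\<le>j. \<Sum>c\<le>k. coeff3 P a b c * coeff3 Q (i - a) (j - b) (k - c)) \<noteq> 0"
    unfolding coeff3_mult by (metis (no_types, lifting) atMost_iff sum.neutral)
  then obtain b where "a \<le> i" "b \<le> j" "(\<Sum>c\<le>k. coeff3 P a b c * coeff3 Q (i - a) (j - b) (k - c)) \<noteq> 0"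
    by (metis (no_types, lifting) atMost_iff sum.neutral)
  then obtain c where le: "a \<le> i" "b \<le> j" "c \<le> k" "coeff3 P a b c * coeff3 Q (i - a) (j - b) (k - c) \<noteq> 0"
    by (metis (no_types, lifting) atMost_iff sum.neutral)
  then have "coeff3 P a b c \<noteq> 0" "coeff3 Q (i - a) (j - b) (k - c) \<noteq> 0" by auto
  then have "a + b + c = m" "(i - a) + (j - b) + (k - c) = n"
    using assms unfolding homogeneous_def by blast+
  with le show "i + j + k = m + n" by linarith
qed

lemma homogeneous_1: "homogeneous 0 1"
  by (simp add: homogeneous_def coeff3_def split: if_splits)

lemma homogeneous_power: "homogeneous m P \<Longrightarrow> homogeneous (n * m) (P ^ n)"
  by (induction n) (simp_all add: homogeneous_1 homogeneous_mult)

definition const3 :: "complex \<Rightarrow> poly3" where "const3 c = [:[:[:c:]:]:]"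

lemma eval3_const3 [simp]: "eval3 (const3 c) x = c"
  by (simp add: const3_def)

lemma coeff3_const3: "coeff3 (const3 c) i j k = (if i = 0 \<and> j = 0 \<and> k = 0 then c else 0)"
  by (auto simp: const3_def coeff3_def coeff_pCons split: nat.splits)

lemma homogeneous_const3: "homogeneous 0 (const3 c)"
  by (simp add: homogeneous_def coeff3_const3)

lemma coeff3_const3_mult: "coeff3 (const3 c * P) i j k = c * coeff3 P i j k"
  by (simp add: const3_def coeff3_def)

definition lin3 :: "complex^3 \<Rightarrow> poly3" where
  "lin3 m = [: [: [:0, m$3:], [:m$2:] :], [:[:m$1:]:] :]"

lemma eval3_lin3 [simp]: "eval3 (lin3 m) x = m$1 * x$1 + m$2 * x$2 + m$3 * x$3"
  by (simp add: lin3_def algebra_simps)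

lemma homogeneous_lin3: "homogeneous 1 (lin3 m)"
  by (auto simp: homogeneous_def lin3_def coeff3_def coeff_pCons split: nat.splits)

text \<open>Scaling all variables by 2 detects homogeneity, and it is multiplicative.\<close>

lemma scale2_exists: "\<exists>P'. \<forall>i j k. coeff3 P' i j k = 2 ^ (i + j + k) * coeff3 P i j k"
proof -
  define s1 :: "complex poly \<Rightarrow> complex poly" where "s1 q = pcompose q [:0, 2:]" for q
  define s2 :: "complex poly poly \<Rightarrow> complex poly poly" where "s2 p = pcompose (map_poly s1 p) [:0, [:2:]:]" for p
  have pow: "coeff ([:c:] ^ n * p) k = c ^ n * coeff p k" for c :: "'a::comm_semiring_1" and n p k
    by (induction n arbitrary: p) (simp_all add: mult.assoc)
  have "coeff3 (pcompose (map_poly s2 P) [:0, [:[:2:]:]:]) i j k = 2 ^ (i + j + k) * coeff3 P i j k" for i j k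
  proof -
    have [simp]: "s1 0 = 0" "s2 0 = 0" by (simp_all add: s1_def s2_def)
    have "coeff ([:[:2:]:] ^ i * s2 p) j = [:2:] ^ i * coeff (s2 p) j" for p
      by (rule pow)
    then show ?thesis
      by (simp add: coeff3_def coeff_pcompose_linear coeff_map_poly s2_def s1_def pow power_add)
  qed
  then show ?thesis by blast
qed

definition scale2 :: "poly3 \<Rightarrow> poly3" where
  "scale2 P = (SOME P'. \<forall>i j k. coeff3 P' i j k = 2 ^ (i + j + k) * coeff3 P i j k)"

lemma coeff3_scale2: "coeff3 (scale2 P) i j k = 2 ^ (i + j + k) * coeff3 P i j k"
  using someI_ex[OF scale2_exists[of P]] by (simp add: scale2_def)

lemma scale2_mult: "scale2 (P * Q) = scale2 P * scale2 Q"
proof (rule coeff3_ext)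
  fix i j k
  have *: "2 ^ (i + j + k) * (coeff3 P a b c * coeff3 Q (i - a) (j - b) (k - c)) =
      (2 ^ (a + b + c) * coeff3 P a b c) * (2 ^ ((i - a) + (j - b) + (k - c)) * coeff3 Q (i - a) (j - b) (k - c))"
    if "a \<le> i" "b \<le> j" "c \<le> k" for a b c
  proof -
    have "i + j + k = (a + b + c) + ((i - a) + (j - b) + (k - c))" using that by simp
    then have "(2::complex) ^ (i + j + k) = 2 ^ (a + b + c) * 2 ^ ((i - a) + (j - b) + (k - c))"
      by (metis power_add)
    then show ?thesis by simp
  qed
  show "coeff3 (scale2 (P * Q)) i j k = coeff3 (scale2 P * scale2 Q) i j k"
    unfolding coeff3_scale2 coeff3_mult sum_distrib_left
    by ((rule sum.cong[OF refl])+, rule *) auto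
qed

text \<open>Homogeneity becomes an eigenvector equation for a multiplicative map, so it can be
  passed to cofactors by cancellation. Different degrees have different eigenvalues because powers
  of 2 are distinct.\<close>

lemma homogeneous_iff_scale2: "homogeneous m P \<longleftrightarrow> scale2 P = const3 (2 ^ m) * P"
proof
  assume "homogeneous m P"
  then show "scale2 P = const3 (2 ^ m) * P"
    by (intro coeff3_ext) (metis coeff3_const3_mult coeff3_scale2 homogeneous_def mult_eq_0_iff)
next
  assume *: "scale2 P = const3 (2 ^ m) * P"
  show "homogeneous m P"
    unfolding homogeneous_def
  proof (intro allI impI)
    fix i j k assume nz: "coeff3 P i j k \<noteq> 0"
    have "2 ^ (i + j + k) * coeff3 P i j k = 2 ^ m * coeff3 P i j k"
      using * by (metis coeff3_const3_mult coeff3_scale2)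
    with nz have "(2::complex) ^ (i + j + k) = 2 ^ m" by simp
    then have "norm ((2::complex) ^ (i + j + k)) = norm ((2::complex) ^ m)" by simp
    then have "(2::real) ^ (i + j + k) = 2 ^ m" by (simp only: norm_power norm_numeral)
    then show "i + j + k = m" by simp
  qed
qed

lemma const3_mult: "const3 (a * b) = const3 a * const3 b"
  by (rule eval3_ext) simp

lemma const3_eq_0_iff [simp]: "const3 c = 0 \<longleftrightarrow> c = 0"
  by (simp add: const3_def)

text \<open>Cancelling \<open>F\<close> in the eigenvector equation of \<open>F * G\<close> leaves
  an eigenvector equation for \<open>G\<close>. The polynomials \<open>Q\<close> and
  \<open>R\<close> of the final identity get their homogeneity from here.\<close>

lemma homogeneous_cofactor:
  assumes F: "homogeneous d F" and FG: "homogeneous n (F * G)" "F * G \<noteq> 0"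
  shows "d \<le> n" "homogeneous (n - d) G"
proof -
  have "const3 (2 ^ d) * F * scale2 G = const3 (2 ^ n) * (F * G)"
    using F FG(1) by (simp add: homogeneous_iff_scale2 scale2_mult)
  then have "F * (const3 (2 ^ d) * scale2 G) = F * (const3 (2 ^ n) * G)"
    by (simp add: mult.assoc mult.left_commute)
  with FG(2) have eq: "const3 (2 ^ d) * scale2 G = const3 (2 ^ n) * G" by auto
  \<comment> \<open>The difference \<open>n - d\<close> is truncated; were \<open>d > n\<close>, a
    nonzero coefficient of \<open>G\<close> would need a negative total degree.\<close>
  show le: "d \<le> n"
  proof (rule ccontr)
    assume "\<not> d \<le> n"
    have "coeff3 G i j k = 0" for i j k
    proof (rule ccontr)
      assume nz: "coeff3 G i j k \<noteq> 0"
      from eq have "2 ^ d * (2 ^ (i + j + k) * coeff3 G i j k) = 2 ^ n * coeff3 G i j k"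
        by (metis coeff3_const3_mult coeff3_scale2)
      with nz have "(2::complex) ^ (d + (i + j + k)) = 2 ^ n" by (simp add: power_add mult.assoc)
      then have "norm ((2::complex) ^ (d + (i + j + k))) = norm ((2::complex) ^ n)" by simp
      then have "(2::real) ^ (d + (i + j + k)) = 2 ^ n" by (simp only: norm_power norm_numeral)
      then have "d + (i + j + k) = n" by (simp del: power_add add: power_inject_exp)
      with \<open>\<not> d \<le> n\<close> show False by simp
    qed
    then have "G = 0" by (intro coeff3_ext) simp
    with FG(2) show False by simp
  qed
  have "const3 (2 ^ n) = const3 (2 ^ d) * const3 (2 ^ (n - d))"
    using le by (simp flip: const3_mult power_add)
  with eq have "const3 (2 ^ d) * scale2 G = const3 (2 ^ d) * (const3 (2 ^ (n - d)) * G)"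
    by (simp add: mult.assoc)
  then show "homogeneous (n - d) G" by (simp add: homogeneous_iff_scale2)
qed

lemma homogeneous_dvd_degree_le:
  assumes "homogeneous d F" "homogeneous n P" "F dvd P" "P \<noteq> 0"
  shows "d \<le> n"
  using assms homogeneous_cofactor(1) by (metis dvdE)

section \<open>Partial derivatives, the chain rule along real curves, Euler's identity\<close>

lemma coeff3_partial:
  "coeff3 (partial 1 P) i j k = of_nat (Suc i) * coeff3 P (Suc i) j k"
  "coeff3 (partial 2 P) i j k = of_nat (Suc j) * coeff3 P i (Suc j) k"
  "coeff3 (partial 3 P) i j k = of_nat (Suc k) * coeff3 P i j (Suc k)"
proof -
  have [simp]: "coeff (of_nat n * p) k = of_nat n * coeff p k" for n k and p :: "'a::comm_semiring_1 poly"
    by (simp add: of_nat_poly)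
  show "coeff3 (partial 1 P) i j k = of_nat (Suc i) * coeff3 P (Suc i) j k"
    by (simp add: partial_def coeff3_def coeff_pderiv del: of_nat_Suc)
  show "coeff3 (partial 2 P) i j k = of_nat (Suc j) * coeff3 P i (Suc j) k"
    by (simp add: partial_def coeff3_def coeff_pderiv coeff_map_poly del: of_nat_Suc)
  show "coeff3 (partial 3 P) i j k = of_nat (Suc k) * coeff3 P i j (Suc k)"
    by (simp add: partial_def coeff3_def coeff_pderiv coeff_map_poly del: of_nat_Suc)
qed

lemma homogeneous_partial:
  assumes "homogeneous m P"
  shows "homogeneous (m - 1) (partial i P)"
proof -
  consider "i = 1" | "i = 2" | "i = 3" using exhaust_3 by blast
  then show ?thesis
    using assms unfolding homogeneous_def
    by cases (auto simp: coeff3_partial simp del: of_nat_Suc, fastforce+)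
qed

lemma partial_commute: "partial i (partial j P) = partial j (partial i P)"
proof -
  have "(i = 1 \<or> i = 2 \<or> i = 3) \<and> (j = 1 \<or> j = 2 \<or> j = 3)" using exhaust_3 by blast
  then show ?thesis
    by (elim conjE disjE) (auto intro!: coeff3_ext simp: coeff3_partial simp del: of_nat_Suc)
qed

lemma partial_pCons:
  "partial 1 (pCons p P) = P + pCons 0 (partial 1 P)"
  "partial 2 (pCons p P) = pCons (pderiv p) (partial 2 P)"
  "partial 3 (pCons p P) = pCons (map_poly pderiv p) (partial 3 P)"
  by (simp_all add: partial_def pderiv_pCons map_poly_pCons)

lemma has_vector_derivative_poly:
  fixes q :: "complex poly"
  assumes "(z has_vector_derivative dz) (at s within S)"
  shows "((\<lambda>s. poly q (z s)) has_vector_derivative poly (pderiv q) (z s) * dz) (at s within S)"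
proof (induction q)
  case (pCons a q)
  show ?case
    by (rule derivative_eq_intros has_vector_derivative_mult assms pCons.IH refl | 
        simp add: pderiv_pCons algebra_simps)+
qed simp

lemma has_vector_derivative_eval2:
  assumes y: "(y has_vector_derivative dy) (at s within S)" and z: "(z has_vector_derivative dz) (at s within S)"
  shows "((\<lambda>s. eval2 p (y s) (z s)) has_vector_derivative
    eval2 (pderiv p) (y s) (z s) * dy + eval2 (map_poly pderiv p) (y s) (z s) * dz) (at s within S)"
proof (induction p)
  case (pCons a p)
  have [simp]: "eval2 (p + q) u v = eval2 p u v + eval2 q u v" for p q u v by (simp add: eval2_def)
  show ?case
    using has_vector_derivative_add[OF has_vector_derivative_poly[OF z, of a] has_vector_derivative_mult[OF y pCons.IH]]
    by (simp add: pderiv_pCons map_poly_pCons algebra_simps)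
qed simp

text \<open>The parameter is real because the arcs are, while points and values are complex.\<close>

lemma has_vector_derivative_eval3:
  assumes X: "\<And>i. ((\<lambda>s. X s $ i) has_vector_derivative Z $ i) (at s within S)"
  shows "((\<lambda>s. eval3 P (X s)) has_vector_derivative
    (\<Sum>i\<in>UNIV. eval3 (partial i P) (X s) * Z $ i)) (at s within S)"
proof (induction P)
  case 0
  have "partial i 0 = 0" for i by (simp add: partial_def)
  then show ?case by simp
next
  case (pCons p P)
  show ?case
    using has_vector_derivative_add[OF has_vector_derivative_eval2[OF X[of 2] X[of 3], of p] 
        has_vector_derivative_mult[OF X[of 1] pCons.IH]]
    by (simp add: sum_3 partial_pCons algebra_simps)
qed

lemma has_vector_derivative_eval3_real:
  assumes "(y has_vector_derivative z) (at s within S)"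
  shows "((\<lambda>s. eval3 P (complexify (y s))) has_vector_derivative
    (\<Sum>i\<in>UNIV. eval3 (partial i P) (complexify (y s)) * complexify z $ i)) (at s within S)"
proof (rule has_vector_derivative_eval3)
  fix i
  have "((\<lambda>s. y s $ i) has_vector_derivative z $ i) (at s within S)"
    using assms bounded_linear.has_vector_derivative bounded_linear_vec_nth by blast
  then show "((\<lambda>s. complexify (y s) $ i) has_vector_derivative complexify z $ i) (at s within S)"
    using bounded_linear.has_vector_derivative[OF bounded_linear_of_real] by fastforce
qed

lemma eval3_homogeneous:
  assumes "homogeneous m P"
  shows "eval3 P (t *s x) = t ^ m * eval3 P x"
proof -
  have eq: "eval3 P x = (\<Sum>i\<le>degree P. x$1 ^ i * eval2 (coeff P i) (x$2) (x$3))" for P x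
    by (simp add: eval3_def eval2_def poly_altdef[of P] poly_sum mult.commute poly_power)
  have eq2: "eval2 p y z = (\<Sum>j\<le>degree p. y ^ j * poly (coeff p j) z)" for p y z
    by (simp add: eval2_def poly_altdef[of p] poly_sum mult.commute poly_power)
  have eq3: "eval3 P x = (\<Sum>i\<le>degree P. \<Sum>j\<le>degree (coeff P i). \<Sum>k\<le>degree (coeff (coeff P i) j).
      x$1 ^ i * (x$2 ^ j * (coeff3 P i j k * x$3 ^ k)))" for x
    by (simp add: eq eq2 poly_altdef sum_distrib_left flip: coeff3_def)
  have *: "(t * x$1) ^ i * ((t * x$2) ^ j * (coeff3 P i j k * (t * x$3) ^ k)) =
     t ^ m * ((x$1) ^ i * ((x$2) ^ j * (coeff3 P i j k * (x$3) ^ k)))" for i j k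
  proof (cases "coeff3 P i j k = 0")
    case False
    then have "m = i + j + k" using assms unfolding homogeneous_def by metis
    then show ?thesis by (simp add: power_mult_distrib power_add mult_ac)
  qed simp
  show ?thesis
    unfolding eq3 sum_distrib_left vector_smult_component * ..
qed

text \<open>Both sides are the derivative at \<open>s = 1\<close> of
  \<open>eval3 P (of_real s *s x)\<close>, once by the chain rule and once by homogeneity.\<close>

lemma euler_homogeneous:
  assumes "homogeneous m P"
  shows "(\<Sum>i\<in>UNIV. eval3 (partial i P) x * x $ i) = of_nat m * eval3 P x"
proof -
  have 1: "((\<lambda>s. eval3 P ((of_real s) *s x)) has_vector_derivative
    (\<Sum>i\<in>UNIV. eval3 (partial i P) (of_real 1 *s x) * x $ i)) (at 1)"
    by (rule has_vector_derivative_eval3) (auto intro!: derivative_eq_intros)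
  have "((\<lambda>s. of_real s ^ m * eval3 P x) has_vector_derivative of_nat m * eval3 P x) (at (1::real))"
    by (rule derivative_eq_intros refl has_vector_derivative_real_field | simp)+
  then show ?thesis
    using 1 by (simp add: eval3_homogeneous[OF assms] vector_derivative_unique_at)
qed

section \<open>Forms vanishing on a real arc\<close>

text \<open>Elimination of the outermost variable, in place of a resultant. A nonzero element
  \<open>D\<close> of least degree in the ideal of \<open>F\<close> and \<open>P\<close> divides
  both up to constants, by pseudo-division. If it still has positive degree, primality of
  \<open>F\<close> leaves only the case that \<open>F\<close> itself is free of that
  variable.\<close>

lemma irreducible_ideal_contains_const:
  fixes F P :: "'a::{factorial_ring_gcd, semiring_gcd_mult_normalize} poly"
  assumes irr: "irreducible F" and ndvd: "\<not> F dvd P"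
  shows "\<exists>a b r. r \<noteq> 0 \<and> a * F + b * P = [:r:]"
proof -
  define I where "I = {D. \<exists>a b. D = a * F + b * P}"
  have I_mult: "c * X \<in> I" if "X \<in> I" for c X
    using that unfolding I_def by (auto, metis distrib_left mult.assoc)
  have I_diff: "X - Y \<in> I" if "X \<in> I" "Y \<in> I" for X Y
  proof -
    from that obtain a b a' b' where "X = a * F + b * P" "Y = a' * F + b' * P" by (auto simp: I_def)
    then have "X - Y = (a - a') * F + (b - b') * P" by (simp add: algebra_simps)
    then show ?thesis by (auto simp: I_def)
  qed
  have FI: "F \<in> I" unfolding I_def by (auto intro: exI[of _ 1] exI[of _ 0])
  have PI: "P \<in> I" unfolding I_def by (auto intro: exI[of _ 1] exI[of _ 0])
  have "F \<noteq> 0" using irr by auto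
  define D where "D = arg_min degree (\<lambda>D. D \<in> I \<and> D \<noteq> 0)"
  have D: "D \<in> I" "D \<noteq> 0" and min: "\<And>X. X \<in> I \<Longrightarrow> X \<noteq> 0 \<Longrightarrow> degree D \<le> degree X"
    using arg_min_nat_lemma[of "\<lambda>D. D \<in> I \<and> D \<noteq> 0" F degree] FI \<open>F \<noteq> 0\<close> by (auto simp: D_def)
  have div: "\<exists>c q. c \<noteq> 0 \<and> smult c X = D * q" if "X \<in> I" for X
  proof -
    obtain q r where qr: "pseudo_divmod X D = (q, r)" by force
    define c where "c = coeff D (degree D) ^ (Suc (degree X) - degree D)"
    have 1: "smult c X = D * q + r" and 2: "r = 0 \<or> degree r < degree D"
      using pseudo_divmod[OF D(2) qr] by (auto simp: c_def)
    have "r = [:c:] * X - q * D" using 1 by (simp add: mult.commute)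
    then have "r \<in> I" using I_diff I_mult that D(1) by metis
    with 2 min have "r = 0" by (metis leD)
    moreover have "c \<noteq> 0" using D(2) by (simp add: c_def)
    ultimately show ?thesis using 1 by auto
  qed
  show ?thesis
  proof (cases "degree D = 0")
    case True
    then obtain r where "D = [:r:]" by (metis degree_eq_zeroE)
    with D show ?thesis unfolding I_def by auto metis
  next
    case False
    have prime: "prime_elem F" using irr by (rule irreducible_imp_prime_elem_gcd)
    obtain c1 q1 c2 q2 where q: "c1 \<noteq> 0" "smult c1 F = D * q1" "c2 \<noteq> 0" "smult c2 P = D * q2"
      using div FI PI by meson
    have "F dvd D * q1" using q(2) by (metis dvd_refl dvd_smult)
    then have "F dvd D \<or> F dvd q1" using prime by (simp add: prime_elem_dvd_mult_iff)
    then have "F dvd D"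
    proof
      assume "F dvd q1"
      then obtain q' where "q1 = F * q'" by auto
      with q(2) have "F * [:c1:] = F * (D * q')" by (simp add: mult.left_commute)
      with \<open>F \<noteq> 0\<close> have "[:c1:] = D * q'" by (metis mult_cancel_left)
      moreover from this q(1) have "q' \<noteq> 0" by auto
      ultimately have "degree D + degree q' = 0" using D(2) by (metis degree_mult_eq degree_pCons_0)
      with False show ?thesis by simp
    qed auto
    then have "F dvd [:c2:] * P" using q(4) by (simp add: dvd_mult2)
    then have "F dvd [:c2:]" using ndvd prime_elem_dvd_mult_iff[OF prime, of "[:c2:]" P] by blast
    then have "degree F = 0" using q(3)
      by (metis degree_pCons_0 dvd_imp_degree_le le_zero_eq pCons_eq_0_iff)
    then obtain r where "F = [:r:]" by (metis degree_eq_zeroE)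
    then have "r \<noteq> 0" "1 * F + 0 * P = [:r:]" using \<open>F \<noteq> 0\<close> by auto
    then show ?thesis by metis
  qed
qed

lemma eval2_slice: "\<exists>\<rho>. \<forall>y. poly \<rho> y = eval2 r y t"
proof (induction r)
  case 0 show ?case by (intro exI[of _ 0]) simp
next
  case (pCons q p)
  then obtain \<rho> where "\<forall>y. poly \<rho> y = eval2 p y t" by blast
  then show ?case by (intro exI[of _ "pCons (poly q t) \<rho>"]) simp
qed

text \<open>In the projective plane: no subarc lies on a line. All subarcs are included because the
  vanishing argument first shrinks the interval to where a coordinate is nonzero.\<close>

definition nonplanar_on :: "real \<Rightarrow> real \<Rightarrow> (real \<Rightarrow> real^3) \<Rightarrow> bool" where
  "nonplanar_on a b y \<longleftrightarrow> a < b \<and> continuous_on {a<..<b} y \<and>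
     (\<forall>m a' b'. m \<noteq> 0 \<longrightarrow> a \<le> a' \<longrightarrow> a' < b' \<longrightarrow> b' \<le> b \<longrightarrow> (\<exists>s\<in>{a'<..<b'}. m \<bullet> y s \<noteq> 0))"

lemma subinterval_nonzero:
  fixes f :: "real \<Rightarrow> 'a::real_normed_vector"
  assumes "continuous_on {a<..<b} f" "s \<in> {a<..<b}" "f s \<noteq> 0"
  obtains a' b' where "a \<le> a'" "a' < b'" "b' \<le> b" "\<And>t. t \<in> {a'<..<b'} \<Longrightarrow> f t \<noteq> 0"
proof -
  have "open ({a<..<b} \<inter> f -` (- {0}))"
    using assms(1) by (intro continuous_open_preimage) auto
  moreover have "s \<in> {a<..<b} \<inter> f -` (- {0})" using assms by auto
  ultimately obtain e where e: "e > 0" "ball s e \<subseteq> {a<..<b} \<inter> f -` (- {0})"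
    by (meson openE)
  have sub: "{s - e<..<s + e} \<subseteq> {a<..<b} \<inter> f -` (- {0})"
    using e(2) by (auto simp: ball_eq_greaterThanLessThan)
  then have "{s - e<..<s + e} \<subseteq> {a<..<b}" by auto
  then have "a \<le> s - e" "s + e \<le> b"
    using \<open>e > 0\<close> by (auto simp: greaterThanLessThan_subseteq_greaterThanLessThan)
  with sub e(1) show ?thesis by (intro that[of "s - e" "s + e"]) auto
qed

text \<open>If \<open>F\<close> did not divide \<open>P\<close>, elimination of the first variable
  would give a nonzero \<open>r\<close> in the other two that vanishes on the cone over the arc. The
  ratio of these two coordinates takes infinitely many values on the arc, which forces
  \<open>r = 0\<close>.\<close>

lemma irreducible_dvd_if_vanishing_on_arc:
  assumes irr: "irreducible F" and F: "homogeneous d F" and P: "homogeneous e P"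
    and y: "nonplanar_on a b y"
    and Fy: "\<And>s. s \<in> {a<..<b} \<Longrightarrow> eval3 F (complexify (y s)) = 0"
    and Py: "\<And>s. s \<in> {a<..<b} \<Longrightarrow> eval3 P (complexify (y s)) = 0"
  shows "F dvd P"
proof (rule ccontr)
  assume "\<not> F dvd P"
  from irreducible_ideal_contains_const[OF irr this]
  obtain A B r where r: "r \<noteq> 0" "A * F + B * P = [:r:]" by blast
  have cone: "eval2 r (of_real (t * y s $ 2)) (of_real (t * y s $ 3)) = 0" if "s \<in> {a<..<b}" for s t
  proof -
    have "eval3 F (complexify (t *\<^sub>R y s)) = 0" "eval3 P (complexify (t *\<^sub>R y s)) = 0"
      using Fy[OF that] Py[OF that] eval3_homogeneous[OF F] eval3_homogeneous[OF P] by simp_all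
    then have "eval3 (A * F + B * P) (complexify (t *\<^sub>R y s)) = 0" by (simp only: eval3_simps) simp
    then have "eval3 [:r:] (complexify (t *\<^sub>R y s)) = 0" by (simp only: r(2))
    then show ?thesis by simp
  qed
  have cont: "continuous_on {a<..<b} (\<lambda>s. y s $ i)" for i
    using y by (auto simp: nonplanar_on_def intro!: continuous_intros)
  have "\<exists>s\<in>{a<..<b}. vector [0,0,1] \<bullet> y s \<noteq> 0"
  proof -
    have "(vector [0,0,1] :: real^3) \<noteq> 0" by (metis vector_3(3) zero_index zero_neq_one)
    then show ?thesis using y unfolding nonplanar_on_def by blast
  qed
  then obtain s0 where s0: "s0 \<in> {a<..<b}" "y s0 $ 3 \<noteq> 0" by (auto simp: inner_vec_def sum_3)
  obtain a' b' where ab': "a \<le> a'" "a' < b'" "b' \<le> b" and nz: "\<And>t. t \<in> {a'<..<b'} \<Longrightarrow> y t $ 3 \<noteq> 0"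
    using subinterval_nonzero[OF cont s0] by blast
  define u where "u s = y s $ 2 / y s $ 3" for s
  have cu: "continuous_on {a'<..<b'} u"
    unfolding u_def using nz ab' by (intro continuous_on_divide continuous_on_subset[OF cont]) auto
  \<comment> \<open>A finite connected image is a single point \<open>c\<close>, and then this
    subarc lies in the plane where the second coordinate is \<open>c\<close> times the
    third.\<close>
  have inf: "infinite (u ` {a'<..<b'})"
  proof
    assume fin: "finite (u ` {a'<..<b'})"
    have "connected (u ` {a'<..<b'})" by (intro connected_continuous_image cu) simp
    with fin obtain c where c: "u ` {a'<..<b'} \<subseteq> {c}"
      using connected_finite_iff_sing[of "u ` {a'<..<b'}"] by (metis empty_subsetI order_refl)
    have "(vector [0,1,-c] :: real^3) \<noteq> 0" by (metis vector_3(2) zero_index zero_neq_one)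
    then obtain s where s: "s \<in> {a'<..<b'}" "(vector [0,1,-c] :: real^3) \<bullet> y s \<noteq> 0"
      using y ab' unfolding nonplanar_on_def by meson
    from s c have "u s = c" by blast
    with s nz[OF s(1)] show False by (simp add: u_def inner_vec_def sum_3 field_simps)
  qed
  \<comment> \<open>With the third coordinate fixed at \<open>t\<close>, \<open>r\<close> is a
    polynomial in the second one with the infinitely many roots \<open>t * u s\<close>.\<close>
  have vanish: "eval2 r z (of_real t) = 0" if "t \<noteq> 0" for z t
  proof -
    obtain \<rho> where \<rho>: "\<And>y. poly \<rho> y = eval2 r y (of_real t)" using eval2_slice by metis
    have ne: "eval2 r (of_real t * v) (of_real t) = 0" if v: "v \<in> of_real ` u ` {a'<..<b'}" for v
    proof -
      from v obtain s where "s \<in> {a'<..<b'}" "v = of_real (u s)" by blast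
      then show ?thesis using cone[of s "t / y s $ 3"] nz[of s] ab' by (simp add: u_def)
    qed
    let ?S = "(\<lambda>v. of_real t * v) ` complex_of_real ` u ` {a'<..<b'}"
    have "infinite ?S" using that inf
      by (subst finite_image_iff; (subst finite_image_iff)?) (auto simp: inj_on_def)
    then have "\<rho> = 0" by (rule poly_eq_0_on_infinite) (use ne \<rho> in auto)
    then show ?thesis using \<rho>[of z] by simp
  qed
  have "infinite (complex_of_real ` (- {0}))"
    by (subst finite_image_iff) (auto simp: inj_on_def infinite_UNIV_char_0)
  then have "poly r [:z:] = 0" for z
    by (rule poly_eq_0_on_infinite) (use vanish in \<open>auto simp: eval2_def\<close>)
  moreover have "infinite (range (\<lambda>z::complex. [:z:]))"
    by (subst finite_image_iff) (auto simp: inj_on_def infinite_UNIV_char_0)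
  ultimately have "r = 0" using poly_eq_0_on_infinite[of "range (\<lambda>z::complex. [:z:])" r] by auto
  with r show False by simp
qed

section \<open>The Hessian along a tangent direction\<close>

lemma partial_add: "partial i (P + Q) = partial i P + partial i Q"
proof -
  have "i = 1 \<or> i = 2 \<or> i = 3" using exhaust_3 by blast
  then show ?thesis by (elim disjE) (auto intro!: coeff3_ext simp: coeff3_partial algebra_simps simp del: of_nat_Suc)
qed

lemma partial_const3_mult: "partial i (const3 c * P) = const3 c * partial i P"
proof -
  have "i = 1 \<or> i = 2 \<or> i = 3" using exhaust_3 by blast
  then show ?thesis
    by (elim disjE) (auto intro!: coeff3_ext simp: coeff3_partial coeff3_const3_mult simp del: of_nat_Suc)
qed

definition dir_deriv :: "complex^3 \<Rightarrow> poly3 \<Rightarrow> poly3" where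
  "dir_deriv z P = const3 (z$1) * partial 1 P + const3 (z$2) * partial 2 P + const3 (z$3) * partial 3 P"

lemma eval3_dir_deriv: "eval3 (dir_deriv z P) x = (\<Sum>i\<in>UNIV. eval3 (partial i P) x * z $ i)"
  by (simp add: dir_deriv_def sum_3 mult.commute)

lemma partial_dir_deriv: "partial i (dir_deriv z P) = dir_deriv z (partial i P)"
  by (simp only: dir_deriv_def partial_add partial_const3_mult partial_commute[of i])

definition bil :: "'a::comm_ring_1^3^3 \<Rightarrow> 'a^3 \<Rightarrow> 'a^3 \<Rightarrow> 'a" where
  "bil S p q = (\<Sum>i\<in>UNIV. \<Sum>j\<in>UNIV. p$i * S$i$j * q$j)"

text \<open>The matrix on the right is \<open>M S M\<^sup>T\<close> for the matrix \<open>M\<close>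
  with rows \<open>x, z, u\<close>: the Gram matrix of \<open>S\<close> in an adapted basis.\<close>

lemma det_congruence:
  fixes S :: "'a::comm_ring_1^3^3"
  shows "det (vector [x, z, u] :: 'a^3^3) ^ 2 * det S =
    det (vector [vector [bil S x x, bil S x z, bil S x u], vector [bil S z x, bil S z z, bil S z u],
      vector [bil S u x, bil S u z, bil S u u]] :: 'a^3^3)"
proof -
  let ?M = "vector [x, z, u] :: 'a^3^3"
  have "?M ** S ** transpose ?M = vector [vector [bil S x x, bil S x z, bil S x u],
      vector [bil S z x, bil S z z, bil S z u], vector [bil S u x, bil S u z, bil S u u]]"
    by (simp add: vec_eq_iff forall_3 matrix_matrix_mult_def transpose_def bil_def sum_3 algebra_simps)
  moreover have "det (?M ** S ** transpose ?M) = det ?M ^ 2 * det S"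
    unfolding det_mul det_transpose power2_eq_square by (simp only: mult_ac)
  ultimately show ?thesis by simp
qed

text \<open>The product rule applied to Sarrus' rule: the derivative of the determinant at
  \<open>a\<close> in direction \<open>t\<close>.\<close>

definition det_deriv :: "complex^3^3 \<Rightarrow> complex^3^3 \<Rightarrow> complex" where
  "det_deriv a t =
     t$1$1 * a$2$2 * a$3$3 + a$1$1 * t$2$2 * a$3$3 + a$1$1 * a$2$2 * t$3$3
   + t$1$2 * a$2$3 * a$3$1 + a$1$2 * t$2$3 * a$3$1 + a$1$2 * a$2$3 * t$3$1
   + t$1$3 * a$2$1 * a$3$2 + a$1$3 * t$2$1 * a$3$2 + a$1$3 * a$2$1 * t$3$2
   - t$1$1 * a$2$3 * a$3$2 - a$1$1 * t$2$3 * a$3$2 - a$1$1 * a$2$3 * t$3$2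
   - t$1$2 * a$2$1 * a$3$3 - a$1$2 * t$2$1 * a$3$3 - a$1$2 * a$2$1 * t$3$3
   - t$1$3 * a$2$2 * a$3$1 - a$1$3 * t$2$2 * a$3$1 - a$1$3 * a$2$2 * t$3$1"

lemma has_vector_derivative_det:
  assumes "\<And>i j. ((\<lambda>s. a s $ i $ j) has_vector_derivative t $ i $ j) (at s)"
  shows "((\<lambda>s. det (a s)) has_vector_derivative det_deriv (a s) t) (at s)"
proof -
  have m: "((\<lambda>s. a s $ i $ j * a s $ k $ l * a s $ m $ n) has_vector_derivative
      (t $ i $ j * a s $ k $ l * a s $ m $ n + a s $ i $ j * t $ k $ l * a s $ m $ n
        + a s $ i $ j * a s $ k $ l * t $ m $ n)) (at s)" for i j k l m n
    by (rule has_vector_derivative_eq_rhs[OF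
          has_vector_derivative_mult[OF has_vector_derivative_mult[OF assms assms] assms]])
       (simp add: algebra_simps)
  show ?thesis
    unfolding det_3
    by (rule has_vector_derivative_eq_rhs,
        (rule has_vector_derivative_add has_vector_derivative_diff m)+) (simp add: det_deriv_def)
qed

text \<open>
  In the basis \<open>x, z, u\<close> the first column of the Hessian of a form at a zero \<open>x\<close>, with \<open>z\<close> tangent,
  is \<open>(0, 0, q)\<close>, so that its determinant is \<open>- q\<^sup>2\<close> times the second derivative along \<open>z\<close>; the
  derivative of the determinant along \<open>z\<close> turns out to involve only the third derivative.
\<close>

lemma hessian_tangential_derivative_algebra:
  fixes a t :: "complex^3^3" and x z u f :: "complex^3"
  assumes sym: "\<And>i j. a$i$j = a$j$i" "\<And>i j. t$i$j = t$j$i"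
    and ax: "\<And>i. (\<Sum>j\<in>UNIV. a$i$j * x$j) = d1 * f$i"
    and tx: "\<And>i. (\<Sum>j\<in>UNIV. t$i$j * x$j) = d2 * (\<Sum>j\<in>UNIV. a$i$j * z$j)"
    and fx: "(\<Sum>i\<in>UNIV. f$i * x$i) = 0" and fz: "(\<Sum>i\<in>UNIV. f$i * z$i) = 0"
    and D: "det (vector [x, z, u] :: complex^3^3) \<noteq> 0"
  shows "bil a z z * det_deriv a t = det a * bil t z z"
proof -
  have bsym: "bil a p q = bil a q p" "bil t p q = bil t q p" for p q
    by (simp_all add: bil_def sum_3 sym[of 2 1] sym[of 3 1] sym[of 3 2] algebra_simps)
  have bx: "bil a p x = d1 * (\<Sum>i\<in>UNIV. f$i * p$i)" for p
  proof -
    have "bil a p x = (\<Sum>i\<in>UNIV. p$i * (\<Sum>j\<in>UNIV. a$i$j * x$j))"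
      by (simp add: bil_def sum_distrib_left mult.assoc)
    also have "\<dots> = d1 * (\<Sum>i\<in>UNIV. f$i * p$i)"
      unfolding ax by (simp add: sum_distrib_left algebra_simps)
    finally show ?thesis .
  qed
  have tbx: "bil t p x = d2 * bil a p z" for p
  proof -
    have "bil t p x = (\<Sum>i\<in>UNIV. p$i * (\<Sum>j\<in>UNIV. t$i$j * x$j))"
      by (simp add: bil_def sum_distrib_left mult.assoc)
    also have "\<dots> = d2 * bil a p z"
      unfolding tx by (simp add: bil_def sum_distrib_left algebra_simps)
    finally show ?thesis .
  qed
  define q where "q = bil a u x"
  define A where "A = bil a z z"
  define \<phi> where "\<phi> = bil a u z"
  have axx: "bil a x x = 0" and azx: "bil a z x = 0" by (simp_all add: bx fx fz)
  define D2 where "D2 = det (vector [x, z, u] :: complex^3^3) ^ 2"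
  \<comment> \<open>The perturbation of \<open>a\<close> by \<open>e\<close> times \<open>t\<close>
    turns the derivative of the determinant into the derivative at \<open>e = 0\<close> of the
    congruence identity, whose Gram matrix \<open>c e\<close> is known.\<close>
  have lin: "bil (\<chi> i j. a$i$j + of_real e * t$i$j) p r = bil a p r + of_real e * bil t p r" for e p r
    by (simp add: bil_def sum.distrib sum_distrib_left algebra_simps)
  define c where "c = (\<lambda>e. vector [vector [0, of_real e * (d2 * A), q + of_real e * (d2 * \<phi>)],
      vector [of_real e * (d2 * A), A + of_real e * bil t z z, \<phi> + of_real e * bil t u z],
      vector [q + of_real e * (d2 * \<phi>), \<phi> + of_real e * bil t u z, bil a u u + of_real e * bil t u u]] :: complex^3^3)"
  have tzx: "bil t x x = 0" "bil t z x = d2 * A" "bil t u x = d2 * \<phi>"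
    using tbx[of x] tbx[of z] tbx[of u] azx bsym(1)[of x z] by (simp_all add: A_def \<phi>_def)
  have eq: "D2 * det (\<chi> i j. a$i$j + of_real e * t$i$j) = det (c e)" for e :: real
  proof -
    have vals: "bil a x x = 0" "bil a x z = 0" "bil a z x = 0" "bil a z z = A" "bil a u x = q" "bil a x u = q"
      "bil a u z = \<phi>" "bil a z u = \<phi>" "bil t x x = 0" "bil t z x = d2 * A" "bil t x z = d2 * A"
      "bil t u x = d2 * \<phi>" "bil t x u = d2 * \<phi>" "bil t z u = bil t u z"
      by (simp_all only: axx azx bsym(1)[of x z] bsym(1)[of x u] bsym(1)[of z u] bsym(2)[of x z] bsym(2)[of x u]
         bsym(2)[of z u] tzx q_def A_def \<phi>_def)
    show ?thesis
      unfolding D2_def det_congruence lin c_def vals by simp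
  qed
  define c' where "c' = (vector [vector [0, d2 * A, d2 * \<phi>], vector [d2 * A, bil t z z, bil t u z],
      vector [d2 * \<phi>, bil t u z, bil t u u]] :: complex^3^3)"
  have "((\<lambda>e. det (c e)) has_vector_derivative det_deriv (c 0) c') (at 0)"
  proof (rule has_vector_derivative_det)
    fix i j :: 3
    have "(i = 1 \<or> i = 2 \<or> i = 3) \<and> (j = 1 \<or> j = 2 \<or> j = 3)" using exhaust_3 by blast
    then show "((\<lambda>e. c e $ i $ j) has_vector_derivative c' $ i $ j) (at 0)"
      by (elim conjE disjE) (auto simp: c_def c'_def intro!: derivative_eq_intros)
  qed
  moreover have "((\<lambda>e. det (\<chi> i j. a$i$j + of_real e * t$i$j)) has_vector_derivative
      det_deriv (\<chi> i j. a$i$j + of_real 0 * t$i$j) t) (at 0)"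
    by (rule has_vector_derivative_det) (auto intro!: derivative_eq_intros)
  then have "((\<lambda>e. D2 * det (\<chi> i j. a$i$j + of_real e * t$i$j)) has_vector_derivative
      D2 * det_deriv a t) (at 0)"
    by (intro derivative_eq_intros) (auto simp: det_deriv_def)
  ultimately have "D2 * det_deriv a t = det_deriv (c 0) c'"
    unfolding eq by (rule vector_derivative_unique_at[rotated])
  \<comment> \<open>The contributions with the factor \<open>d2 * q * A * \<phi>\<close> cancel;
    only the third derivative along \<open>z\<close> remains.\<close>
  also have "\<dots> = - (q^2 * bil t z z)"
    by (simp add: det_deriv_def c_def c'_def power2_eq_square algebra_simps)
  finally have 1: "D2 * det_deriv a t = - (q^2 * bil t z z)" .
  have "D2 * det a = det (c 0)" using eq[of 0] by (simp add: vec_lambda_eta)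
  also have "\<dots> = - (q^2 * A)"
    by (simp add: det_3 c_def power2_eq_square algebra_simps)
  finally have 2: "D2 * det a = - (q^2 * A)" .
  have "D2 * (A * det_deriv a t) = D2 * (det a * bil t z z)"
    using 1 2 by (metis (no_types, lifting) mult.assoc mult.commute mult_minus_right)
  moreover have "D2 \<noteq> 0" using D by (simp add: D2_def)
  ultimately show ?thesis by (simp add: A_def)
qed

lemma eval3_Hess: "eval3 (Hess F) x = det (\<chi> i j. eval3 (partial i (partial j F)) x)"
  by (simp add: Hess_def det_3)

lemma homogeneous_Hess:
  assumes "homogeneous d F"
  shows "homogeneous (3 * (d - 2)) (Hess F)"
proof -
  have h: "homogeneous (d - 2) (partial i (partial j F))" for i j
    using homogeneous_partial[OF homogeneous_partial[OF assms]] by (simp add: numeral_2_eq_2)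
  have "homogeneous ((d - 2) + (d - 2) + (d - 2)) (Hess F)"
    unfolding Hess_def det_3 by (simp, intro homogeneous_diff homogeneous_add homogeneous_mult h)
  moreover have "(d - 2) + (d - 2) + (d - 2) = 3 * (d - 2)" by linarith
  ultimately show ?thesis by (simp only:)
qed

text \<open>Euler's identity for the first and second partial derivatives supplies the factors
  \<open>d1\<close> and \<open>d2\<close> of the algebraic lemma. The logarithmic derivative of the
  Hessian along the tangent becomes the ratio of the third to the second derivative of
  \<open>F\<close>, which is also what the expansion of \<open>F\<close> on its tangent line
  produces.\<close>

lemma hessian_tangential_derivative:
  assumes F: "homogeneous d F" and x: "eval3 F x = 0" and z: "eval3 (dir_deriv z F) x = 0"
    and D: "det (vector [x, z, u] :: complex^3^3) \<noteq> 0"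
  shows "eval3 (dir_deriv z (dir_deriv z F)) x * eval3 (dir_deriv z (Hess F)) x =
    eval3 (Hess F) x * eval3 (dir_deriv z (dir_deriv z (dir_deriv z F))) x"
proof -
  define a where "a = (\<chi> i j. eval3 (partial i (partial j F)) x)"
  define t where "t = (\<chi> i j. eval3 (dir_deriv z (partial i (partial j F))) x)"
  define f where "f = gradient F x"
  let ?X = "\<lambda>s. x + of_real s *s z"
  have 1: "((\<lambda>s. eval3 P (?X s)) has_vector_derivative eval3 (dir_deriv z P) x) (at 0)" for P
  proof -
    have "((\<lambda>s. eval3 P (?X s)) has_vector_derivative
        (\<Sum>i\<in>UNIV. eval3 (partial i P) (?X 0) * z $ i)) (at 0)"
      by (rule has_vector_derivative_eval3) (auto intro!: derivative_eq_intros)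
    then show ?thesis by (simp add: eval3_dir_deriv)
  qed
  have "((\<lambda>s. det (\<chi> i j. eval3 (partial i (partial j F)) (?X s))) has_vector_derivative
      det_deriv (\<chi> i j. eval3 (partial i (partial j F)) (?X 0)) t) (at 0)"
    by (rule has_vector_derivative_det) (simp add: t_def 1)
  with 1[of "Hess F"] have H: "eval3 (dir_deriv z (Hess F)) x = det_deriv a t"
    by (simp add: eval3_Hess a_def vector_derivative_unique_at)
  have F1: "homogeneous (d - 1) (partial i F)" for i using F by (rule homogeneous_partial)
  have F2: "homogeneous (d - 1 - 1) (partial i (partial j F))" for i j
    using F1 by (rule homogeneous_partial)
  have "bil a z z * det_deriv a t = det a * bil t z z"
  proof (rule hessian_tangential_derivative_algebra[where f = f and x = x and u = u])
    show "a$i$j = a$j$i" "t$i$j = t$j$i" for i j by (simp_all add: a_def t_def partial_commute[of i j])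
    show "(\<Sum>j\<in>UNIV. a$i$j * x$j) = of_nat (d - 1) * f$i" for i
      using euler_homogeneous[OF F1[of i], of x] by (simp add: a_def f_def gradient_def partial_commute[of i])
    show "(\<Sum>i\<in>UNIV. f$i * x$i) = 0"
      using euler_homogeneous[OF F, of x] x by (simp add: f_def gradient_def)
    show "(\<Sum>i\<in>UNIV. f$i * z$i) = 0"
      using z by (simp add: f_def gradient_def eval3_dir_deriv)
    show "(\<Sum>j\<in>UNIV. t$i$j * x$j) = of_nat (d - 1 - 1) * (\<Sum>j\<in>UNIV. a$i$j * z$j)" for i
    proof -
      \<comment> \<open>Symmetry of the third partial derivatives lets the contraction with
        \<open>x\<close> come before that with \<open>z\<close>, so that Euler's identity
        applies.\<close>
      have pc: "partial k (partial i (partial j F)) = partial j (partial i (partial k F))" for k j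
        by (simp only: partial_commute[of i j F] partial_commute[of k j "partial i F"] partial_commute[of k i F])
      have "(\<Sum>j\<in>UNIV. t$i$j * x$j) =
        (\<Sum>j\<in>UNIV. \<Sum>k\<in>UNIV. eval3 (partial k (partial i (partial j F))) x * z$k * x$j)"
        by (simp add: t_def eval3_dir_deriv sum_distrib_right)
      also have "\<dots> = (\<Sum>k\<in>UNIV. \<Sum>j\<in>UNIV. eval3 (partial k (partial i (partial j F))) x * z$k * x$j)"
        by (rule sum.swap)
      also have "\<dots> = (\<Sum>k\<in>UNIV. (\<Sum>j\<in>UNIV. eval3 (partial j (partial i (partial k F))) x * x$j) * z$k)"
        unfolding sum_distrib_right
        by (intro sum.cong refl) (simp only: pc mult.assoc mult.commute[of "z $ _"])
      also have "\<dots> = of_nat (d - 1 - 1) * (\<Sum>j\<in>UNIV. a$i$j * z$j)"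
        by (simp only: euler_homogeneous[OF F2]) (simp add: a_def sum_distrib_left mult.assoc)
      finally show ?thesis .
    qed
  qed (rule D)
  moreover have "bil a z z = eval3 (dir_deriv z (dir_deriv z F)) x"
    by (simp add: bil_def a_def eval3_dir_deriv sum_3 partial_dir_deriv algebra_simps partial_commute[of 2 1] partial_commute[of 3 1] partial_commute[of 3 2])
  moreover have "bil t z z = eval3 (dir_deriv z (dir_deriv z (dir_deriv z F))) x"
    by (simp add: bil_def t_def partial_dir_deriv eval3_dir_deriv[of _ "dir_deriv z _"]
       eval3_dir_deriv[of _ "dir_deriv z (dir_deriv z _)"])
      (simp add: sum_3 algebra_simps)
  ultimately show ?thesis by (simp add: H eval3_Hess a_def)
qed

section \<open>Restriction of a form to a line\<close>

lemma line_poly_exists: "\<exists>p. \<forall>e. poly p e = eval3 P (x + e *s z)"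
proof -
  have q: "\<exists>p. \<forall>e. poly p e = poly q (x$3 + e * z$3)" for q
    by (rule exI[of _ "pcompose q [:x$3, z$3:]"]) (simp add: poly_pcompose)
  have q2: "\<exists>p. \<forall>e. poly p e = eval2 q (x$2 + e * z$2) (x$3 + e * z$3)" for q
  proof (induction q)
    case 0 show ?case by (rule exI[of _ 0]) simp
  next
    case (pCons a q)
    obtain r s where "\<forall>e. poly r e = poly a (x$3 + e * z$3)"
      "\<forall>e. poly s e = eval2 q (x$2 + e * z$2) (x$3 + e * z$3)" using q pCons.IH by meson
    then show ?case by (intro exI[of _ "r + [:x$2, z$2:] * s"]) (simp add: algebra_simps)
  qed
  show ?thesis
  proof (induction P)
    case 0 show ?case by (rule exI[of _ 0]) simp
  next
    case (pCons a P)
    obtain r s where "\<forall>e. poly r e = eval2 a (x$2 + e * z$2) (x$3 + e * z$3)"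
      "\<forall>e. poly s e = eval3 P (x + e *s z)" using q2 pCons.IH by meson
    then show ?case by (intro exI[of _ "r + [:x$1, z$1:] * s"]) (simp add: algebra_simps)
  qed
qed

definition line_poly :: "complex^3 \<Rightarrow> complex^3 \<Rightarrow> poly3 \<Rightarrow> complex poly" where
  "line_poly x z P = (SOME p. \<forall>e. poly p e = eval3 P (x + e *s z))"

lemma poly_line_poly [simp]: "poly (line_poly x z P) e = eval3 P (x + e *s z)"
  using someI_ex[OF line_poly_exists[of P x z]] by (simp add: line_poly_def)

lemma poly_eqI_real:
  fixes p q :: "complex poly"
  assumes "\<And>e. e \<noteq> 0 \<Longrightarrow> poly p (of_real e) = poly q (of_real e)"
  shows "p = q"
proof -
  have "infinite (complex_of_real ` (- {0}))"
    by (subst finite_image_iff) (auto simp: inj_on_def infinite_UNIV_char_0)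
  then have "p - q = 0" by (rule poly_eq_0_on_infinite) (use assms in auto)
  then show ?thesis by simp
qed

lemma pderiv_line_poly: "pderiv (line_poly x z P) = line_poly x z (dir_deriv z P)"
proof (rule poly_eqI_real)
  fix e :: real
  have "((\<lambda>s. poly (line_poly x z P) (of_real s)) has_vector_derivative
     poly (pderiv (line_poly x z P)) (of_real e) * 1) (at e)"
    by (rule has_vector_derivative_poly) (auto intro!: derivative_eq_intros)
  moreover have "((\<lambda>s. eval3 P (x + of_real s *s z)) has_vector_derivative
        (\<Sum>i\<in>UNIV. eval3 (partial i P) (x + of_real e *s z) * z $ i)) (at e)"
    by (rule has_vector_derivative_eval3) (auto intro!: derivative_eq_intros)
  ultimately show "poly (pderiv (line_poly x z P)) (of_real e) = poly (line_poly x z (dir_deriv z P)) (of_real e)"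
    by (simp add: eval3_dir_deriv vector_derivative_unique_at)
qed

text \<open>On the tangent line \<open>F\<close> is \<open>e^2 * u\<close>, so
  \<open>F ^ k * g\<close> is \<open>e^(2*k) * w\<close> with \<open>w = u ^ k * g\<close>. Evenness
  passes to \<open>w\<close>, and the vanishing of its linear coefficient is the claim up to a
  nonzero power of \<open>poly u 0\<close>.\<close>

lemma even_expansion:
  assumes even: "\<And>e::real. eval3 (F ^ k * g) (x + of_real e *s z) = eval3 (F ^ k * g) (x - of_real e *s z)"
    and F0: "eval3 F x = 0" and F1: "eval3 (dir_deriv z F) x = 0"
    and F2: "eval3 (dir_deriv z (dir_deriv z F)) x \<noteq> 0" and k: "k \<ge> 1"
  shows "of_nat k * eval3 (dir_deriv z (dir_deriv z (dir_deriv z F))) x * eval3 g x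
    + 3 * eval3 (dir_deriv z (dir_deriv z F)) x * eval3 (dir_deriv z g) x = 0"
proof -
  define f where "f = line_poly x z F"
  have [simp]: "poly p 0 = coeff p 0" for p :: "complex poly" by (simp add: poly_0_coeff_0)
  have c: "coeff f 0 = 0" "coeff f 1 = 0" "2 * coeff f 2 = eval3 (dir_deriv z (dir_deriv z F)) x"
    "6 * coeff f 3 = eval3 (dir_deriv z (dir_deriv z (dir_deriv z F))) x"
  proof -
    have "coeff f 0 = poly f 0" by simp
    then show "coeff f 0 = 0" using F0 by (simp add: f_def del: \<open>\<And>p. poly p 0 = coeff p 0\<close>)
    have "coeff f 1 = poly (pderiv f) 0" by (simp add: coeff_pderiv)
    then show "coeff f 1 = 0" using F1 by (simp add: f_def pderiv_line_poly del: \<open>\<And>p. poly p 0 = coeff p 0\<close>)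
    have "2 * coeff f 2 = poly (pderiv (pderiv f)) 0" by (simp add: coeff_pderiv numeral_2_eq_2)
    then show "2 * coeff f 2 = eval3 (dir_deriv z (dir_deriv z F)) x"
      by (simp add: f_def pderiv_line_poly del: \<open>\<And>p. poly p 0 = coeff p 0\<close>)
    have "6 * coeff f 3 = poly (pderiv (pderiv (pderiv f))) 0" by (simp add: coeff_pderiv numeral_3_eq_3)
    then show "6 * coeff f 3 = eval3 (dir_deriv z (dir_deriv z (dir_deriv z F))) x"
      by (simp add: f_def pderiv_line_poly del: \<open>\<And>p. poly p 0 = coeff p 0\<close>)
  qed
  obtain u where u: "f = pCons 0 (pCons 0 u)"
    using c(1,2) by (metis coeff_pCons_0 coeff_pCons_Suc One_nat_def pCons_cases)
  define G where "G = line_poly x z g"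
  define w where "w = u ^ k * G"
  have "w = pcompose w [:0, -1:]"
  proof (rule poly_eqI_real)
    fix e :: real assume "e \<noteq> 0"
    have fe: "poly f e = e\<^sup>2 * poly u e" for e by (simp add: u power2_eq_square)
    have "poly (f ^ k * G) (of_real e) = poly (f ^ k * G) (- of_real e)"
      using even[of e] by (simp add: f_def G_def)
    then have "(of_real e ^ 2) ^ k * poly w (of_real e) = (of_real e ^ 2) ^ k * poly w (- of_real e)"
      by (simp add: w_def poly_power fe power_mult_distrib mult.assoc)
    with \<open>e \<noteq> 0\<close> show "poly w (of_real e) = poly (pcompose w [:0, -1:]) (of_real e)"
      by (simp add: poly_pcompose)
  qed
  then have "coeff w 1 = (- 1) ^ 1 * coeff w 1" by (metis coeff_pcompose_linear)
  then have "coeff w 1 = 0" by simp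
  then have "poly (pderiv w) 0 = 0" by (simp add: coeff_pderiv)
  then have "of_nat k * poly u 0 ^ (k - 1) * poly (pderiv u) 0 * poly G 0 + poly u 0 ^ k * poly (pderiv G) 0 = 0"
    by (simp only: w_def pderiv_mult pderiv_power poly_add poly_mult poly_smult poly_power)
       (simp add: algebra_simps poly_power)
  moreover have "poly u 0 ^ k = poly u 0 * poly u 0 ^ (k - 1)" using k by (cases k) auto
  moreover have u0: "poly u 0 = coeff f 2" "poly (pderiv u) 0 = coeff f 3"
    by (simp_all add: u coeff_pderiv numeral_2_eq_2 numeral_3_eq_3)
  ultimately have "poly u 0 ^ (k - 1) * (of_nat k * coeff f 3 * poly G 0 + coeff f 2 * poly (pderiv G) 0) = 0"
    by (simp add: algebra_simps)
  moreover have "poly u 0 \<noteq> 0" using u0(1) c(3) F2 by auto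
  ultimately have "of_nat k * coeff f 3 * poly G 0 + coeff f 2 * poly (pderiv G) 0 = 0" by simp
  moreover have "poly G 0 = eval3 g x" "poly (pderiv G) 0 = eval3 (dir_deriv z g) x"
    unfolding G_def pderiv_line_poly poly_line_poly by simp_all
  \<comment> \<open>The factor 6 clears the factorials: \<open>6 * coeff f 3\<close> is the third
    and \<open>2 * coeff f 2\<close> the second derivative, which leaves the 3.\<close>
  ultimately have "of_nat k * (6 * coeff f 3) * eval3 g x + 3 * (2 * coeff f 2) * eval3 (dir_deriv z g) x = 0"
    by (simp add: algebra_simps) algebra
  then show ?thesis by (simp only: c)
qed

section \<open>Geodesics and angular momentum\<close>

text \<open>The trigonometric functions of constant curvature \<open>K\<close>; one formula for
  geodesics then serves both surfaces.\<close>

definition cosK :: "real \<Rightarrow> real \<Rightarrow> real" where "cosK K t = (if K = 1 then cos t else cosh t)"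
definition sinK :: "real \<Rightarrow> real \<Rightarrow> real" where "sinK K t = (if K = 1 then sin t else sinh t)"

lemma cosK_0 [simp]: "cosK K 0 = 1" and sinK_0 [simp]: "sinK K 0 = 0"
  and cosK_minus [simp]: "cosK K (- t) = cosK K t" and sinK_minus [simp]: "sinK K (- t) = - sinK K t"
  by (auto simp: cosK_def sinK_def)

lemma cosK_sinK:
  assumes "K = 1 \<or> K = -1"
  shows "(cosK K t)\<^sup>2 + K * (sinK K t)\<^sup>2 = 1"
  using assms by (auto simp: cosK_def sinK_def cosh_square_eq)

lemma sinK_diff: "sinK K (s - t) = sinK K s * cosK K t - cosK K s * sinK K t"
  by (auto simp: cosK_def sinK_def sin_diff sinh_diff)

lemma has_real_derivative_cosK [derivative_intros]:
  assumes "K = 1 \<or> K = -1" "(f has_real_derivative f') (at t within S)"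
  shows "((\<lambda>t. cosK K (f t)) has_real_derivative - K * sinK K (f t) * f') (at t within S)"
  using assms by (auto simp: cosK_def sinK_def intro!: derivative_eq_intros)

lemma has_real_derivative_sinK [derivative_intros]:
  assumes "K = 1 \<or> K = -1" "(f has_real_derivative f') (at t within S)"
  shows "((\<lambda>t. sinK K (f t)) has_real_derivative cosK K (f t) * f') (at t within S)"
  using assms by (auto simp: cosK_def sinK_def intro!: derivative_eq_intros)

lemma continuous_on_cosK [continuous_intros]: "continuous_on (S :: real set) f \<Longrightarrow> continuous_on S (\<lambda>t. cosK K (f t))"
  unfolding cosK_def by (cases "K = 1") (simp_all add: continuous_on_cos continuous_on_cosh)

lemma continuous_on_sinK [continuous_intros]: "continuous_on (S :: real set) f \<Longrightarrow> continuous_on S (\<lambda>t. sinK K (f t))"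
  unfolding sinK_def by (cases "K = 1") (simp_all add: continuous_on_sin continuous_on_sinh)

lemma form_add: "form K (x + y) z = form K x z + form K y z" "form K z (x + y) = form K z x + form K z y"
  and form_diff: "form K (x - y) z = form K x z - form K y z" "form K z (x - y) = form K z x - form K z y"
  and form_scaleR: "form K (c *\<^sub>R x) z = c * form K x z" "form K z (c *\<^sub>R x) = c * form K z x"
  and form_minus: "form K (- x) z = - form K x z" "form K z (- x) = - form K z x"
  and form_0: "form K 0 z = 0" "form K z 0 = 0"
  by (simp_all add: form_def algebra_simps)

lemmas form_simps = form_add form_diff form_scaleR form_minus form_0

lemma form_commute: "form K x y = form K y x"
  by (simp add: form_def mult.commute)

lemma form_nondegenerate:
  assumes "K \<noteq> 0" "\<And>x. form K e x = 0"
  shows "e = 0"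
proof -
  have "e $ 1 = 0" "e $ 2 = 0" "e $ 3 = 0"
    using assms(1) assms(2)[of "axis 1 1"] assms(2)[of "axis 2 1"] assms(2)[of "axis 3 1"]
    by (simp_all add: form_def axis_def)
  then show ?thesis by (simp add: vec_eq_iff forall_3)
qed

lemma surface_iff:
  assumes "K = 1 \<or> K = -1"
  shows "x \<in> surface K \<longleftrightarrow> form K x x = K \<and> (K = -1 \<longrightarrow> x$3 > 0)"
proof -
  have "norm x = 1 \<longleftrightarrow> x \<bullet> x = 1" by (metis norm_eq_1)
  then show ?thesis using assms
    by (auto simp: surface_def form_def inner_vec_def sum_3 power2_eq_square)
qed

lemma has_vector_derivative_form:
  assumes "(f has_vector_derivative f') (at t within S)" "(g has_vector_derivative g') (at t within S)"
  shows "((\<lambda>t. form K (f t) (g t)) has_vector_derivative form K f' (g t) + form K (f t) g') (at t within S)"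
proof -
  have c: "((\<lambda>t. h t $ i) has_vector_derivative h' $ i) (at t within S)"
    if "(h has_vector_derivative h') (at t within S)" for h h' and i :: 3
    using that bounded_linear.has_vector_derivative bounded_linear_vec_nth by blast
  show ?thesis unfolding form_def
    by (rule derivative_eq_intros has_vector_derivative_mult c assms refl | simp add: algebra_simps)+
qed

text \<open>The acceleration \<open>w\<close> is normal, hence a multiple of the position.
  Differentiating \<open>form K c v = 0\<close> gives \<open>form K c w = -1\<close>, and
  \<open>form K c c = K\<close> with \<open>K * K = 1\<close> fixes the multiple.\<close>

lemma unit_geodesic_acceleration:
  assumes K: "K = 1 \<or> K = -1" and g: "unit_geodesic K {0..l} c v" and l: "0 < l" and t: "t \<in> {0..l}"
  shows "form K (c t) (v t) = 0" and "(v has_vector_derivative - K *\<^sub>R c t) (at t within {0..l})"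
proof -
  \<comment> \<open>Derivatives at the ends of the interval are one-sided; they are still unique, as
    every point of a nondegenerate interval is a limit point of it.\<close>
  have uniq: "d = d'" if "(f has_vector_derivative d) (at s within {0..l})"
      "(g has_vector_derivative d') (at s within {0..l})" "s \<in> {0..l}" "\<And>x. x \<in> {0..l} \<Longrightarrow> f x = g x"
    for f g :: "real \<Rightarrow> real" and d d' s
  proof -
    have "(g has_vector_derivative d) (at s within {0..l})"
      using has_vector_derivative_transform[OF that(3) _ that(1)] that(4) by metis
    moreover have "s islimpt {0..l}"
      using that(3) l islimpt_Icc by blast
    ultimately show ?thesis
      using that(2) vector_derivative_unique_within[of s "{0..l}" g d d'] by (simp add: trivial_limit_within)
  qed
  have c: "(c has_vector_derivative v s) (at s within {0..l})" if "s \<in> {0..l}" for s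
    using g that by (simp add: unit_geodesic_def)
  have cc: "form K (c s) (c s) = K" and vv: "form K (v s) (v s) = 1" if "s \<in> {0..l}" for s
    using g that surface_iff[OF K, of "c s"] unfolding unit_geodesic_def by blast+
  have perp: "form K (c s) (v s) = 0" if s: "s \<in> {0..l}" for s
  proof -
    have "form K (v s) (c s) + form K (c s) (v s) = 0"
    proof (rule uniq[OF has_vector_derivative_form[OF c[OF s] c[OF s]] _ s])
      show "((\<lambda>_. K) has_vector_derivative 0) (at s within {0..l})" by simp
    qed (rule cc)
    then show ?thesis by (simp add: form_commute[of K "v s"])
  qed
  show "form K (c t) (v t) = 0" by (rule perp[OF t])
  from g t obtain w where w: "(v has_vector_derivative w) (at t within {0..l})"
    "\<And>u. u \<in> tangent_plane K (c t) \<Longrightarrow> form K w u = 0" unfolding unit_geodesic_def by blast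
  have "form K (v t) (v t) + form K (c t) w = 0"
  proof (rule uniq[OF has_vector_derivative_form[OF c[OF t] w(1)] _ t])
    show "((\<lambda>_. 0) has_vector_derivative 0) (at t within {0..l})" by simp
  qed (rule perp)
  moreover have "form K (v t) (v t) = 1" "form K (c t) (c t) = K"
    using vv[OF t] cc[OF t] .
  ultimately have cw: "form K (c t) w = -1" "form K (c t) (c t) = K" by simp_all
  have "w + K *\<^sub>R c t = 0"
  proof (rule form_nondegenerate[where K = K])
    fix x
    \<comment> \<open>The tangential part of \<open>x\<close>; the factor \<open>K\<close> stands
      for \<open>1 / form K (c t) (c t)\<close>, which is the same number.\<close>
    define u where "u = x - (K * form K (c t) x) *\<^sub>R c t"
    have "u \<in> tangent_plane K (c t)"
      using K cw by (auto simp: u_def tangent_plane_def form_simps)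
    then have "form K w u = 0" "form K (c t) u = 0" using w(2) by (auto simp: tangent_plane_def)
    then have "form K (w + K *\<^sub>R c t) u = 0" by (simp add: form_simps)
    moreover have "form K (w + K *\<^sub>R c t) (c t) = 0"
      using K cw form_commute[of K w] by (auto simp: form_simps)
    ultimately show "form K (w + K *\<^sub>R c t) x = 0" by (simp add: u_def form_simps)
  qed (use K in auto)
  then have "w = - K *\<^sub>R c t" by (simp add: eq_neg_iff_add_eq_0)
  with w(1) show "(v has_vector_derivative - K *\<^sub>R c t) (at t within {0..l})" by simp
qed

text \<open>Position and velocity are transported back to time 0 by the inverse of the linear flow
  of \<open>c'' = - K c\<close>; the resulting vectors \<open>?P\<close> and \<open>?Q\<close> have
  zero derivative.\<close>

lemma unit_geodesic_eq:
  assumes K: "K = 1 \<or> K = -1" and g: "unit_geodesic K {0..l} c v" and l: "0 < l" and t: "t \<in> {0..l}"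
  shows "c t = cosK K t *\<^sub>R c 0 + sinK K t *\<^sub>R v 0"
    and "v t = (- K * sinK K t) *\<^sub>R c 0 + cosK K t *\<^sub>R v 0"
proof -
  have c: "(c has_vector_derivative v s) (at s within {0..l})" if "s \<in> {0..l}" for s
    using g that by (simp add: unit_geodesic_def)
  note v = unit_geodesic_acceleration(2)[OF K g l]
  have C: "(cosK K has_real_derivative - K * sinK K s) (at s within I)"
    and S: "(sinK K has_real_derivative cosK K s) (at s within I)" for s I
    using has_real_derivative_cosK[OF K DERIV_ident] has_real_derivative_sinK[OF K DERIV_ident] by simp_all
  let ?P = "\<lambda>s. cosK K s *\<^sub>R c s - sinK K s *\<^sub>R v s"
  let ?Q = "\<lambda>s. (K * sinK K s) *\<^sub>R c s + cosK K s *\<^sub>R v s"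
  have "(?P has_vector_derivative 0) (at s within {0..l})" if "s \<in> {0..l}" for s
  proof -
    have "(?P has_vector_derivative (cosK K s *\<^sub>R v s + (- K * sinK K s) *\<^sub>R c s) -
        (sinK K s *\<^sub>R (- K *\<^sub>R c s) + cosK K s *\<^sub>R v s)) (at s within {0..l})"
      by (intro has_vector_derivative_diff has_vector_derivative_scaleR C S c v that)
    moreover have "(cosK K s *\<^sub>R v s + (- K * sinK K s) *\<^sub>R c s) -
        (sinK K s *\<^sub>R (- K *\<^sub>R c s) + cosK K s *\<^sub>R v s) = 0" by (simp add: mult.commute)
    ultimately show ?thesis by (simp only:)
  qed
  then obtain dP where "\<And>s. s \<in> {0..l} \<Longrightarrow> ?P s = dP"
    using has_vector_derivative_zero_constant[OF convex_real_interval(5)] by blast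
  from this[OF t] this[of 0] l have P: "?P t = ?P 0" by simp
  have "(?Q has_vector_derivative 0) (at s within {0..l})" if "s \<in> {0..l}" for s
  proof -
    have "(?Q has_vector_derivative ((K * sinK K s) *\<^sub>R v s + (K * cosK K s) *\<^sub>R c s) +
        (cosK K s *\<^sub>R (- K *\<^sub>R c s) + (- K * sinK K s) *\<^sub>R v s)) (at s within {0..l})"
      by (intro has_vector_derivative_add has_vector_derivative_scaleR DERIV_cmult C S c v that)
    moreover have "((K * sinK K s) *\<^sub>R v s + (K * cosK K s) *\<^sub>R c s) +
        (cosK K s *\<^sub>R (- K *\<^sub>R c s) + (- K * sinK K s) *\<^sub>R v s) = 0" by (simp add: mult.commute)
    ultimately show ?thesis by (simp only:)
  qed
  then obtain dQ where "\<And>s. s \<in> {0..l} \<Longrightarrow> ?Q s = dQ"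
    using has_vector_derivative_zero_constant[OF convex_real_interval(5)] by blast
  from this[OF t] this[of 0] l have Q: "?Q t = ?Q 0" by simp
  have c2: "(cosK K t)\<^sup>2 = 1 - K * (sinK K t)\<^sup>2" using cosK_sinK[OF K, of t] by simp
  have "cosK K t *\<^sub>R ?P t + sinK K t *\<^sub>R ?Q t = ((cosK K t)\<^sup>2 + K * (sinK K t)\<^sup>2) *\<^sub>R c t"
    by (simp add: algebra_simps power2_eq_square)
  also have "\<dots> = c t" by (simp add: c2)
  finally show "c t = cosK K t *\<^sub>R c 0 + sinK K t *\<^sub>R v 0" using P Q by simp
  have "(- K * sinK K t) *\<^sub>R ?P t + cosK K t *\<^sub>R ?Q t = ((cosK K t)\<^sup>2 + K * (sinK K t)\<^sup>2) *\<^sub>R v t"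
    by (simp add: algebra_simps power2_eq_square)
  also have "\<dots> = v t" by (simp add: c2)
  finally show "v t = (- K * sinK K t) *\<^sub>R c 0 + cosK K t *\<^sub>R v 0" using P Q by simp
qed

text \<open>Cauchy-Schwarz in the first two coordinates. The bound keeps geodesics of the
  hyperboloid on its upper sheet.\<close>

lemma hyperbolic_tangent_bound:
  assumes "form (-1) p p = -1" "form (-1) p v = 0" "form (-1) v v = 1" "p$3 > 0"
  shows "\<bar>v$3\<bar> < p$3"
proof -
  have 1: "(p$1)\<^sup>2 + (p$2)\<^sup>2 = (p$3)\<^sup>2 - 1" "(v$1)\<^sup>2 + (v$2)\<^sup>2 = (v$3)\<^sup>2 + 1" "p$1 * v$1 + p$2 * v$2 = p$3 * v$3"
    using assms by (auto simp: form_def power2_eq_square)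
  have "(p$1 * v$1 + p$2 * v$2)\<^sup>2 \<le> ((p$1)\<^sup>2 + (p$2)\<^sup>2) * ((v$1)\<^sup>2 + (v$2)\<^sup>2)"
  proof -
    have "((p$1)\<^sup>2 + (p$2)\<^sup>2) * ((v$1)\<^sup>2 + (v$2)\<^sup>2) - (p$1 * v$1 + p$2 * v$2)\<^sup>2 = (p$1 * v$2 - p$2 * v$1)\<^sup>2"
      by (simp add: power2_eq_square algebra_simps)
    then show ?thesis by (metis diff_ge_0_iff_ge zero_le_power2)
  qed
  then have "(v$3)\<^sup>2 < (p$3)\<^sup>2" unfolding 1 by (simp add: algebra_simps power_mult_distrib)
  then show ?thesis using assms(4) by (metis abs_le_square_iff abs_of_pos linorder_not_le)
qed

lemma geodesic_point_in_surface:
  assumes K: "K = 1 \<or> K = -1" and p: "p \<in> surface K" and v: "form K p v = 0" "form K v v = 1"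
  shows "cosK K t *\<^sub>R p + sinK K t *\<^sub>R v \<in> surface K"
proof -
  have pp: "form K p p = K" using p surface_iff[OF K] by blast
  have "form K (cosK K t *\<^sub>R p + sinK K t *\<^sub>R v) (cosK K t *\<^sub>R p + sinK K t *\<^sub>R v) =
      K * ((cosK K t)\<^sup>2 + K * (sinK K t)\<^sup>2)"
    using K by (auto simp: form_simps pp v form_commute[of K v p] power2_eq_square algebra_simps)
  then have 1: "form K (cosK K t *\<^sub>R p + sinK K t *\<^sub>R v) (cosK K t *\<^sub>R p + sinK K t *\<^sub>R v) = K"
    by (simp add: cosK_sinK[OF K])
  have "(cosK K t *\<^sub>R p + sinK K t *\<^sub>R v) $ 3 > 0" if "K = -1"
  proof -
    have p3: "p$3 > 0" using p that surface_iff[OF K] by blast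
    have "\<bar>v$3\<bar> < p$3" using hyperbolic_tangent_bound pp v p3 that by blast
    moreover have "\<bar>sinh t\<bar> < cosh t"
    proof -
      have "\<bar>sinh t\<bar>\<^sup>2 < (cosh t)\<^sup>2" by (simp add: cosh_square_eq)
      then show ?thesis by (rule power_less_imp_less_base) (simp add: less_imp_le)
    qed
    ultimately have "\<bar>sinh t\<bar> * \<bar>v$3\<bar> < cosh t * p$3"
      by (intro mult_strict_mono) (auto simp: p3)
    then have "- (cosh t * p$3) < sinh t * v$3" by (metis abs_le_iff abs_mult linorder_not_le minus_less_iff order.asym less_le neg_less_iff_less)
    then show ?thesis using that by (simp add: cosK_def sinK_def)
  qed
  with 1 show ?thesis by (simp add: surface_iff[OF K])
qed

text \<open>The shift \<open>\<tau>\<close> lets a flight that starts at time 0 be written in terms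
  of its end point at a bounce.\<close>

lemma geodesic_line:
  assumes K: "K = 1 \<or> K = -1" and p: "p \<in> surface K" and v: "form K p v = 0" "form K v v = 1"
  shows "unit_geodesic K I (\<lambda>t. cosK K (t + \<tau>) *\<^sub>R p + sinK K (t + \<tau>) *\<^sub>R v)
    (\<lambda>t. (- K * sinK K (t + \<tau>)) *\<^sub>R p + cosK K (t + \<tau>) *\<^sub>R v)"
  unfolding unit_geodesic_def
proof (intro ballI conjI)
  fix t assume "t \<in> I"
  have C: "((\<lambda>t. cosK K (t + \<tau>)) has_real_derivative - K * sinK K (t + \<tau>)) (at t within I)"
    and S: "((\<lambda>t. sinK K (t + \<tau>)) has_real_derivative cosK K (t + \<tau>)) (at t within I)"
    by (rule derivative_eq_intros K refl | simp)+
  let ?c = "cosK K (t + \<tau>) *\<^sub>R p + sinK K (t + \<tau>) *\<^sub>R v"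
  let ?v = "(- K * sinK K (t + \<tau>)) *\<^sub>R p + cosK K (t + \<tau>) *\<^sub>R v"
  have pp: "form K p p = K" using p surface_iff[OF K] by blast
  show "?c \<in> surface K" by (rule geodesic_point_in_surface[OF assms])
  show "((\<lambda>t. cosK K (t + \<tau>) *\<^sub>R p + sinK K (t + \<tau>) *\<^sub>R v) has_vector_derivative ?v) (at t within I)"
    by (rule has_vector_derivative_eq_rhs[OF has_vector_derivative_add[OF
          has_vector_derivative_scaleR[OF C has_vector_derivative_const]
          has_vector_derivative_scaleR[OF S has_vector_derivative_const]]]) simp
  have "form K ?v ?v = (cosK K (t + \<tau>))\<^sup>2 + K * (sinK K (t + \<tau>))\<^sup>2"
    using K by (auto simp: form_simps pp v form_commute[of K v p] power2_eq_square algebra_simps)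
  then show "form K ?v ?v = 1" by (simp add: cosK_sinK[OF K])
  show "\<exists>w. ((\<lambda>t. (- K * sinK K (t + \<tau>)) *\<^sub>R p + cosK K (t + \<tau>) *\<^sub>R v) has_vector_derivative w) (at t within I) \<and>
      (\<forall>u\<in>tangent_plane K ?c. form K w u = 0)"
  proof (intro exI conjI ballI)
    show "((\<lambda>t. (- K * sinK K (t + \<tau>)) *\<^sub>R p + cosK K (t + \<tau>) *\<^sub>R v) has_vector_derivative (- K) *\<^sub>R ?c) (at t within I)"
      by (rule has_vector_derivative_eq_rhs[OF has_vector_derivative_add[OF
            has_vector_derivative_scaleR[OF DERIV_cmult[OF S] has_vector_derivative_const]
            has_vector_derivative_scaleR[OF C has_vector_derivative_const]]]) (simp add: scaleR_add_right)
    show "form K ((- K) *\<^sub>R ?c) u = 0" if "u \<in> tangent_plane K ?c" for u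
      using that unfolding form_scaleR tangent_plane_def by simp
  qed
qed

text \<open>For \<open>z\<close> orthogonal to \<open>r\<close>, the tangent vector \<open>v\<close> at \<open>r\<close> with angular momentum \<open>r \<times> v = z\<close>.\<close>

definition vel :: "real \<Rightarrow> real^3 \<Rightarrow> real^3 \<Rightarrow> real^3" where
  "vel K r z = cross3 z (vector [K * r$1, K * r$2, r$3])"

lemmas coords = form_def vel_def cross3_def vec_eq_iff forall_3 inner_vec_def sum_3

lemma vel_linear: "vel K r (x + y) = vel K r x + vel K r y" "vel K r (x - y) = vel K r x - vel K r y"
  "vel K r (a *\<^sub>R x) = a *\<^sub>R vel K r x" "vel K r (- x) = - vel K r x"
  by (simp_all add: coords algebra_simps)

lemma form_vel:
  assumes K: "K = 1 \<or> K = -1"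
  shows "form K r (vel K r z) = 0"
  using K by (auto simp: coords algebra_simps)

lemma cross3_vel:
  assumes K: "K = 1 \<or> K = -1" and r: "form K r r = K" and z: "z \<bullet> r = 0"
  shows "cross3 r (vel K r z) = z"
proof -
  have "cross3 r (vel K r z) = (K * form K r r) *\<^sub>R z - (z \<bullet> r) *\<^sub>R vector [K * r$1, K * r$2, r$3]"
    using K by (auto simp: coords algebra_simps)
  then show ?thesis using K r z by auto
qed

lemma form_vel_vel:
  assumes K: "K = 1 \<or> K = -1" and r: "form K r r = K" and z: "z \<bullet> r = 0"
  shows "form K (vel K r z) (vel K r z') = form K z z'"
proof -
  have "form K (vel K r z) (vel K r z') = K * form K r r * form K z z' - K * ((z \<bullet> r) * (z' \<bullet> r))"
    using K by (auto simp: coords algebra_simps)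
  then show ?thesis using K r z by auto
qed

lemma vel_cross3:
  assumes K: "K = 1 \<or> K = -1" and r: "form K r r = K" and v: "form K r v = 0"
  shows "vel K r (cross3 r v) = v"
proof -
  have "vel K r (cross3 r v) = (K * form K r r) *\<^sub>R v - (K * form K r v) *\<^sub>R r"
    using K by (auto simp: coords algebra_simps)
  then show ?thesis using K r v by auto
qed

text \<open>Cramer's rule in the basis \<open>a\<close>, \<open>b\<close>,
  \<open>cross3 a b\<close>.\<close>

lemma cross3_decompose:
  assumes "cross3 a b \<noteq> 0" "x \<bullet> cross3 a b = 0"
  obtains \<alpha> \<beta> where "x = \<alpha> *\<^sub>R a + \<beta> *\<^sub>R b"
proof -
  let ?G = "cross3 a b"
  have "(?G \<bullet> ?G) *\<^sub>R x = (cross3 x b \<bullet> ?G) *\<^sub>R a + (cross3 a x \<bullet> ?G) *\<^sub>R b + (x \<bullet> ?G) *\<^sub>R ?G"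
    by (simp add: coords algebra_simps)
  then have "(?G \<bullet> ?G) *\<^sub>R x = (cross3 x b \<bullet> ?G) *\<^sub>R a + (cross3 a x \<bullet> ?G) *\<^sub>R b"
    using assms(2) by simp
  then have "x = (1 / (?G \<bullet> ?G)) *\<^sub>R ((cross3 x b \<bullet> ?G) *\<^sub>R a + (cross3 a x \<bullet> ?G) *\<^sub>R b)"
    using assms(1) by (metis inner_eq_zero_iff scaleR_one scaleR_scaleR nonzero_eq_divide_eq)
  then have "x = (cross3 x b \<bullet> ?G / (?G \<bullet> ?G)) *\<^sub>R a + (cross3 a x \<bullet> ?G / (?G \<bullet> ?G)) *\<^sub>R b"
    by (simp add: scaleR_add_right)
  then show ?thesis by (rule that)
qed

lemma orthogonal_to_both:
  assumes "cross3 a b \<noteq> 0" "z \<bullet> a = 0" "z \<bullet> b = 0"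
  obtains \<mu> where "z = \<mu> *\<^sub>R cross3 a b"
proof -
  let ?G = "cross3 a b"
  have "(?G \<bullet> ?G) *\<^sub>R z = (z \<bullet> ?G) *\<^sub>R ?G + (z \<bullet> a) *\<^sub>R cross3 b ?G - (z \<bullet> b) *\<^sub>R cross3 a ?G"
    by (simp add: coords algebra_simps)
  then have "(?G \<bullet> ?G) *\<^sub>R z = (z \<bullet> ?G) *\<^sub>R ?G" using assms by simp
  then have "(1 / (?G \<bullet> ?G)) *\<^sub>R ((?G \<bullet> ?G) *\<^sub>R z) = (z \<bullet> ?G / (?G \<bullet> ?G)) *\<^sub>R ?G"
    by simp
  then have "z = (z \<bullet> ?G / (?G \<bullet> ?G)) *\<^sub>R ?G" using assms(1) by simp
  then show ?thesis by (rule that)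
qed

section \<open>The cone over a convex domain\<close>

text \<open>Geodesics are plane sections through the origin, so geodesic convexity of
  \<open>\<Omega>\<close> turns into closure of this cone under addition.\<close>

definition cone_of :: "(real^3) set \<Rightarrow> (real^3) set" where
  "cone_of \<Omega> = {t *\<^sub>R p | t p. 0 < t \<and> p \<in> \<Omega>}"

lemma cone_ofI: "0 < t \<Longrightarrow> p \<in> \<Omega> \<Longrightarrow> t *\<^sub>R p \<in> cone_of \<Omega>"
  by (auto simp: cone_of_def)

lemma cone_ofE:
  assumes "x \<in> cone_of \<Omega>"
  obtains t p where "0 < t" "p \<in> \<Omega>" "x = t *\<^sub>R p"
  using assms by (auto simp: cone_of_def)

lemma subset_cone_of: "\<Omega> \<subseteq> cone_of \<Omega>"
proof
  fix p assume "p \<in> \<Omega>"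
  then show "p \<in> cone_of \<Omega>" using cone_ofI[of 1 p] by simp
qed

lemma cone_of_scaleR: "x \<in> cone_of \<Omega> \<Longrightarrow> 0 < s \<Longrightarrow> s *\<^sub>R x \<in> cone_of \<Omega>"
  by (elim cone_ofE) (auto intro: cone_ofI)

lemma cone_of_Int_surface:
  assumes K: "K = 1 \<or> K = -1" and \<Omega>: "\<Omega> \<subseteq> surface K" and x: "x \<in> cone_of \<Omega>" "form K x x = K"
  shows "x \<in> \<Omega>"
proof -
  obtain t p where t: "0 < t" "p \<in> \<Omega>" "x = t *\<^sub>R p" using x(1) by (rule cone_ofE)
  have "form K p p = K" using \<Omega> t(2) surface_iff[OF K] by blast
  then have "t * t * K = K" using x(2) t(3) by (simp add: form_simps)
  then have "t * t = 1" using K by auto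
  then have "t = 1" using t(1) by (metis abs_of_pos abs_square_eq_1 power2_eq_square)
  with t show ?thesis by simp
qed

lemma convex_domain_subset: "convex_domain K \<Omega> \<Longrightarrow> \<Omega> \<subseteq> surface K"
  by (auto simp: convex_domain_def openin_contains_ball dest: openin_subset)

text \<open>The radial projection \<open>N\<close> is continuous on the open cone \<open>D\<close>
  over the surface, and the cone is the preimage of an open set under it.\<close>

lemma open_cone_of:
  assumes K: "K = 1 \<or> K = -1" and op: "openin (top_of_set (surface K)) \<Omega>"
  shows "open (cone_of \<Omega>)"
proof -
  define D where "D = {x. 0 < K * form K x x} \<inter> {x. K = -1 \<longrightarrow> 0 < x$3}"
  define N where "N x = (1 / sqrt (K * form K x x)) *\<^sub>R x" for x
  have cf: "continuous_on S (\<lambda>x. K * form K x x)" for S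
    unfolding form_def by (intro continuous_intros)
  have "open {x. 0 < K * form K x x}"
    using open_Collect_less[OF continuous_on_const cf] by simp
  moreover have "open {x::real^3. K = -1 \<longrightarrow> 0 < x$3}"
  proof (cases "K = -1")
    case True
    have "open {x::real^3. 0 < x$3}" by (intro open_Collect_less continuous_intros)
    with True show ?thesis by simp
  qed simp
  ultimately have oD: "open D" by (simp add: D_def open_Int)
  have cN: "continuous_on D N"
    unfolding N_def by (intro continuous_intros cf) (auto simp: D_def)
  have NS: "N x \<in> surface K" if "x \<in> D" for x
  proof -
    have pos: "0 < K * form K x x" using that by (simp add: D_def)
    have "form K (N x) (N x) = (1 / sqrt (K * form K x x))\<^sup>2 * form K x x"
      by (simp add: N_def form_simps power2_eq_square)
    also have "\<dots> = K" using pos K by (auto simp: power_divide field_simps)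
    finally have "form K (N x) (N x) = K" .
    moreover have "K = -1 \<longrightarrow> N x $ 3 > 0" using that pos by (auto simp: N_def D_def)
    ultimately show ?thesis by (simp add: surface_iff[OF K])
  qed
  obtain T where T: "open T" "\<Omega> = surface K \<inter> T" using op by (auto simp: openin_open)
  have "cone_of \<Omega> = D \<inter> N -` T"
  proof (intro set_eqI iffI)
    fix x assume "x \<in> cone_of \<Omega>"
    then obtain t p where t: "0 < t" "p \<in> \<Omega>" "x = t *\<^sub>R p" by (rule cone_ofE)
    have p: "form K p p = K" "K = -1 \<longrightarrow> p$3 > 0" using T t(2) surface_iff[OF K] by auto
    then have fx: "K * form K x x = t\<^sup>2" using K t(3) by (auto simp: form_simps power2_eq_square)
    then have "x \<in> D" using t p by (auto simp: D_def)
    moreover have "N x = p" using t(1) by (simp add: N_def fx) (simp add: t(3))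
    ultimately show "x \<in> D \<inter> N -` T" using t(2) T by auto
  next
    fix x assume x: "x \<in> D \<inter> N -` T"
    then have "N x \<in> \<Omega>" using NS T by auto
    moreover have pos: "0 < sqrt (K * form K x x)" using x by (auto simp: D_def)
    ultimately have "sqrt (K * form K x x) *\<^sub>R N x \<in> cone_of \<Omega>" by (intro cone_ofI)
    then show "x \<in> cone_of \<Omega>" using pos by (auto simp: N_def split: if_splits)
  qed
  then show ?thesis using oD cN T(1) by (simp add: continuous_open_preimage)
qed

section \<open>Shortest geodesics and sums of cone points\<close>

lemma unit_geodesic_subset: "unit_geodesic K I c v \<Longrightarrow> J \<subseteq> I \<Longrightarrow> unit_geodesic K J c v"
  unfolding unit_geodesic_def by (meson has_vector_derivative_within_subset subsetD)

lemma unit_geodesic_start: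
  assumes "K = 1 \<or> K = -1" "unit_geodesic K {0..l} c v" "0 < l"
  shows "c 0 \<in> surface K" "form K (c 0) (v 0) = 0" "form K (v 0) (v 0) = 1"
  using assms(2,3) unit_geodesic_acceleration(1)[OF assms, of 0] unfolding unit_geodesic_def by auto

text \<open>A great-circle arc longer than \<open>pi\<close> can be shortened: by the complementary
  arc if it is less than a full turn, by dropping a full turn if it is more. The lengths
  \<open>pi\<close> and \<open>2 * pi\<close> end at \<open>- p\<close> and
  \<open>p\<close>.\<close>

lemma shortest_geodesic_sphere:
  assumes seg: "geodesic_segment 1 p q l c" and ne: "p \<noteq> q" "p \<noteq> - q"
    and min: "\<And>l' c'. geodesic_segment 1 p q l' c' \<Longrightarrow> l \<le> l'"
  shows "l < pi"
proof (rule ccontr)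
  assume "\<not> l < pi"
  from seg obtain v where l: "0 < l" and g: "unit_geodesic 1 {0..l} c v" and c: "c 0 = p" "c l = q"
    by (auto simp: geodesic_segment_def)
  have eq: "c t = cos t *\<^sub>R p + sin t *\<^sub>R v 0" if "t \<in> {0..l}" for t
    using unit_geodesic_eq(1)[OF _ g l that] c by (simp add: cosK_def sinK_def)
  have q: "q = cos l *\<^sub>R p + sin l *\<^sub>R v 0" using eq[of l] l c by simp
  have start: "p \<in> surface 1" "form 1 p (v 0) = 0" "form 1 (v 0) (v 0) = 1"
    using unit_geodesic_start[OF _ g l] c by auto
  consider "l = pi" | "pi < l" "l < 2 * pi" | "l = 2 * pi" | "2 * pi < l" using \<open>\<not> l < pi\<close> by linarith
  then show False
  proof cases
    case 1 with q ne(2) show False by simp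
  next
    case 3 with q ne(1) show False by simp
  next
    case 4
    have "c (l - 2 * pi) = q"
      using eq[of "l - 2 * pi"] 4 pi_gt_zero by (simp add: q cos_diff sin_diff)
    then have "geodesic_segment 1 p q (l - 2 * pi) c"
      using 4 c g unit_geodesic_subset[OF g, of "{0..l - 2 * pi}"] pi_gt_zero by (auto simp: geodesic_segment_def)
    from min[OF this] show False using pi_gt_zero by simp
  next
    case 2
    let ?c = "\<lambda>t. cosK 1 (t + 0) *\<^sub>R p + sinK 1 (t + 0) *\<^sub>R (- v 0)"
    have "unit_geodesic 1 {0..2 * pi - l} ?c (\<lambda>t. (- 1 * sinK 1 (t + 0)) *\<^sub>R p + cosK 1 (t + 0) *\<^sub>R (- v 0))"
      by (rule geodesic_line) (use start in \<open>simp_all add: form_simps\<close>)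
    moreover have "?c (2 * pi - l) = q" by (simp add: cosK_def sinK_def q cos_diff sin_diff)
    ultimately have "geodesic_segment 1 p q (2 * pi - l) ?c"
      using 2 unfolding geodesic_segment_def by (auto simp: cosK_def sinK_def)
    from min[OF this] show False using 2 by simp
  qed
qed

lemma convex_segment:
  assumes K: "K = 1 \<or> K = -1" and cv: "convex_domain K \<Omega>"
    and pq: "p \<in> \<Omega>" "q \<in> \<Omega>" "p \<noteq> q" "p \<noteq> - q"
  obtains l c v where "0 < l" "unit_geodesic K {0..l} c v" "c ` {0..l} \<subseteq> \<Omega>" "c 0 = p" "c l = q"
    "\<And>t. 0 < t \<Longrightarrow> t \<le> l \<Longrightarrow> 0 < sinK K t"
proof -
  obtain l c where lc: "geodesic_segment K p q l c" "c ` {0..l} \<subseteq> \<Omega>"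
    "\<And>l' c'. geodesic_segment K p q l' c' \<Longrightarrow> l \<le> l'"
    using cv pq unfolding convex_domain_def by meson
  from lc(1) obtain v where l: "0 < l" and g: "unit_geodesic K {0..l} c v" and c: "c 0 = p" "c l = q"
    by (auto simp: geodesic_segment_def)
  have "0 < sinK K t" if t: "0 < t" "t \<le> l" for t
  proof (cases "K = 1")
    case True
    then have "l < pi" using shortest_geodesic_sphere[of p q l c] lc pq by blast
    then show ?thesis using t True by (simp add: sinK_def sin_gt_zero)
  next
    case False
    then show ?thesis using t by (simp add: sinK_def)
  qed
  with that[OF l g lc(2) c] show ?thesis by blast
qed

text \<open>On the connecting segment, \<open>sinK K l *\<^sub>R c \<theta>\<close> is the
  combination of \<open>p\<close> and \<open>q\<close> with coefficients
  \<open>sinK K (l - \<theta>)\<close> and \<open>sinK K \<theta>\<close>. By the intermediate value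
  theorem some \<open>\<theta>\<close> realizes the ratio \<open>s : t\<close>.\<close>

lemma cone_of_add_nonantipodal:
  assumes K: "K = 1 \<or> K = -1" and cv: "convex_domain K \<Omega>"
    and pq: "p \<in> \<Omega>" "q \<in> \<Omega>" "p \<noteq> - q" and st: "0 < s" "0 < t"
  shows "s *\<^sub>R p + t *\<^sub>R q \<in> cone_of \<Omega>"
proof (cases "p = q")
  case True
  then have "s *\<^sub>R p + t *\<^sub>R q = (s + t) *\<^sub>R p" by (simp add: scaleR_add_left)
  then show ?thesis using cone_ofI[of "s + t" p] st pq by simp
next
  case False
  obtain l c v where l: "0 < l" and g: "unit_geodesic K {0..l} c v" and c: "c ` {0..l} \<subseteq> \<Omega>" "c 0 = p" "c l = q"
    and pos: "\<And>t. 0 < t \<Longrightarrow> t \<le> l \<Longrightarrow> 0 < sinK K t"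
    using convex_segment[OF K cv pq(1,2) False pq(3)] by blast
  define f where "f \<theta> = s * sinK K \<theta> - t * sinK K (l - \<theta>)" for \<theta>
  have "continuous_on {0..l} f" unfolding f_def by (intro continuous_intros)
  moreover have "f 0 < 0" "0 < f l" using pos[of l] l st by (auto simp: f_def)
  ultimately obtain \<theta> where \<theta>: "0 \<le> \<theta>" "\<theta> \<le> l" "f \<theta> = 0"
    using IVT'[of f 0 0 l] l by auto
  then have "\<theta> \<noteq> 0" using \<open>f 0 < 0\<close> by auto
  with \<theta> have S: "0 < sinK K \<theta>" using pos by simp
  have Sl: "0 < sinK K l" using pos l by simp
  have q: "q = cosK K l *\<^sub>R p + sinK K l *\<^sub>R v 0" using unit_geodesic_eq(1)[OF K g l, of l] l c by simp
  have ct: "c \<theta> = cosK K \<theta> *\<^sub>R p + sinK K \<theta> *\<^sub>R v 0" using unit_geodesic_eq(1)[OF K g l, of \<theta>] \<theta> c by simp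
  have "sinK K l *\<^sub>R c \<theta> = sinK K (l - \<theta>) *\<^sub>R p + sinK K \<theta> *\<^sub>R q"
    unfolding q ct sinK_diff by (simp add: algebra_simps)
  then have "t *\<^sub>R (sinK K l *\<^sub>R c \<theta>) = (t * sinK K (l - \<theta>)) *\<^sub>R p + (t * sinK K \<theta>) *\<^sub>R q"
    by (simp add: scaleR_add_right)
  also have "\<dots> = sinK K \<theta> *\<^sub>R (s *\<^sub>R p + t *\<^sub>R q)"
    using \<theta>(3) by (simp add: f_def scaleR_add_right mult.commute)
  finally have "(1 / sinK K \<theta>) *\<^sub>R (t *\<^sub>R (sinK K l *\<^sub>R c \<theta>)) = (1 / sinK K \<theta>) *\<^sub>R (sinK K \<theta> *\<^sub>R (s *\<^sub>R p + t *\<^sub>R q))"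
    by simp
  then have "s *\<^sub>R p + t *\<^sub>R q = (t * sinK K l / sinK K \<theta>) *\<^sub>R c \<theta>" using S by simp
  moreover have "0 < t * sinK K l / sinK K \<theta>" using st Sl S by simp
  moreover have "c \<theta> \<in> \<Omega>" using c(1) \<theta> by auto
  ultimately show ?thesis using cone_ofI by metis
qed

text \<open>A point of the cone slightly off \<open>p\<close> in the direction of \<open>q\<close>,
  added to \<open>- p\<close>, would put a positive multiple of \<open>q\<close> in the cone,
  although \<open>q\<close> lies outside.\<close>

lemma no_antipodal_pair:
  assumes K: "K = 1 \<or> K = -1" and cv: "convex_domain K \<Omega>" and q: "q \<in> surface K" "q \<notin> \<Omega>"
    and p: "p \<in> \<Omega>"
  shows "- p \<notin> \<Omega>"
proof
  assume mp: "- p \<in> \<Omega>"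
  have op: "open (cone_of \<Omega>)" using cv K by (intro open_cone_of) (auto simp: convex_domain_def)
  have sub: "\<Omega> \<subseteq> surface K" by (rule convex_domain_subset[OF cv])
  have qq: "form K q q = K" and pp: "form K p p = K" using q p sub surface_iff[OF K] by blast+
  have lim: "((\<lambda>e. p + e *\<^sub>R q) \<longlongrightarrow> p + 0 *\<^sub>R q) (at_right 0)" by (intro tendsto_intros)
  have "eventually (\<lambda>e. p + e *\<^sub>R q \<in> cone_of \<Omega>) (at_right 0)"
    using topological_tendstoD[OF lim op] subset_cone_of p by auto
  then obtain e where e: "0 < e" "p + e *\<^sub>R q \<in> cone_of \<Omega>"
    by (metis (mono_tags, lifting) eventually_at_right_field dense gt_ex)
  then obtain t r where t: "0 < t" "r \<in> \<Omega>" "p + e *\<^sub>R q = t *\<^sub>R r" by (metis cone_ofE)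
  \<comment> \<open>Otherwise \<open>q\<close> would be a multiple of \<open>p\<close>, hence
    \<open>p\<close> or \<open>- p\<close>, and both lie in \<open>\<Omega>\<close>.\<close>
  have "r \<noteq> - (- p)"
  proof
    assume "r = - (- p)"
    then have "e *\<^sub>R q = (t - 1) *\<^sub>R p" using t(3) by (simp add: algebra_simps)
    then have "(1 / e) *\<^sub>R (e *\<^sub>R q) = (1 / e) *\<^sub>R ((t - 1) *\<^sub>R p)" by simp
    then have qp: "q = ((t - 1) / e) *\<^sub>R p" using e by simp
    then have "((t - 1) / e)\<^sup>2 * K = K" using qq pp by (simp add: form_simps power2_eq_square mult.assoc)
    then have "((t - 1) / e)\<^sup>2 = 1" using K by auto
    then have "(t - 1) / e = 1 \<or> (t - 1) / e = -1" by (simp only: power2_eq_1_iff)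
    then show False using qp q(2) p mp by auto
  qed
  then have "t *\<^sub>R r + 1 *\<^sub>R (- p) \<in> cone_of \<Omega>"
    using cone_of_add_nonantipodal[OF K cv t(2) mp _ t(1), of 1] by simp
  moreover have "t *\<^sub>R r + 1 *\<^sub>R (- p) = e *\<^sub>R q" unfolding t(3)[symmetric] by simp
  ultimately have "e *\<^sub>R q \<in> cone_of \<Omega>" by (simp only:)
  from cone_of_scaleR[OF this, of "1 / e"] e have "q \<in> cone_of \<Omega>" by simp
  with cone_of_Int_surface[OF K sub _ qq] q(2) show False by blast
qed

lemma cone_of_add:
  assumes K: "K = 1 \<or> K = -1" and cv: "convex_domain K \<Omega>" and q: "q \<in> surface K" "q \<notin> \<Omega>"
    and xy: "x \<in> cone_of \<Omega>" "y \<in> cone_of \<Omega>"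
  shows "x + y \<in> cone_of \<Omega>"
proof -
  obtain s p where s: "0 < s" "p \<in> \<Omega>" "x = s *\<^sub>R p" using xy(1) by (rule cone_ofE)
  obtain t r where t: "0 < t" "r \<in> \<Omega>" "y = t *\<^sub>R r" using xy(2) by (rule cone_ofE)
  have "p \<noteq> - r" using no_antipodal_pair[OF K cv q t(2)] s(2) by auto
  then show ?thesis using cone_of_add_nonantipodal[OF K cv s(2) t(2) _ s(1) t(1)] s t by simp
qed

section \<open>Boundary points and inward directions\<close>

lemma boundary_point:
  assumes op: "openin (top_of_set (surface K)) \<Omega>" and q: "q \<in> boundary K \<Omega>"
  shows "q \<in> surface K" "q \<notin> \<Omega>" "q \<in> closure \<Omega>"
proof -
  have "q \<in> (top_of_set (surface K)) closure_of \<Omega>" "q \<notin> (top_of_set (surface K)) interior_of \<Omega>"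
    using q by (auto simp: boundary_def frontier_of_def)
  moreover from this(1) show "q \<in> surface K" using closure_of_subset_topspace by fastforce
  moreover have "closure (surface K \<inter> \<Omega>) \<subseteq> closure \<Omega>" by (intro closure_mono) auto
  ultimately show "q \<notin> \<Omega>" "q \<in> closure \<Omega>"
    using op by (auto simp: interior_of_openin closure_of_subtopology)
qed

text \<open>A nearby \<open>y\<close> in \<open>C\<close> replaces \<open>x\<close>, and the small
  difference is absorbed by \<open>p\<close>, around which \<open>C\<close> contains a ball.\<close>

lemma open_cone_add_closure:
  fixes C :: "'a::real_normed_vector set"
  assumes op: "open C" and add: "\<And>x y. x \<in> C \<Longrightarrow> y \<in> C \<Longrightarrow> x + y \<in> C" and p: "p \<in> C" and x: "x \<in> closure C"
  shows "p + x \<in> C"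
proof -
  obtain e where e: "0 < e" "ball p e \<subseteq> C" using op p by (meson openE)
  obtain y where y: "y \<in> C" "dist y x < e" using x e(1) by (meson closure_approachable)
  have "p + (x - y) \<in> ball p e" using y(2) by (simp add: dist_norm norm_minus_commute)
  then have "(p + (x - y)) + y \<in> C" using e(2) y(1) add by blast
  then show ?thesis by simp
qed

text \<open>
  At a boundary point \<open>q\<close> with tangent vector \<open>g\<close>, the cone over the domain, enlarged by the line
  \<open>\<real> q\<close>, is an open convex cone that is invariant under adding multiples of \<open>g\<close> as well; hence
  it contains an open half-space, and all directions pointing into this half-space are inward.
\<close>

lemma inward_half_space:
  fixes C :: "(real^3) set"
  assumes op: "open C" and add: "\<And>x y. x \<in> C \<Longrightarrow> y \<in> C \<Longrightarrow> x + y \<in> C"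
    and scale: "\<And>x s. x \<in> C \<Longrightarrow> 0 < s \<Longrightarrow> s *\<^sub>R x \<in> C" and ne: "C \<noteq> {}"
    and c: "(c has_vector_derivative g) (at s)" and arc: "\<And>t. t \<in> {a<..<b} \<Longrightarrow> c t \<in> closure C"
    and s: "s \<in> {a<..<b}" and G: "cross3 (c s) g \<noteq> 0"
  obtains \<sigma> :: real where "\<sigma> \<noteq> 0"
    "\<And>w. 0 < \<sigma> * (cross3 (c s) g \<bullet> w) \<Longrightarrow> \<exists>\<delta>>0. \<forall>t. 0 < t \<longrightarrow> t < \<delta> \<longrightarrow> c s + t *\<^sub>R w \<in> C"
proof -
  define q where "q = c s"
  define E where "E = {p - \<mu> *\<^sub>R q | p \<mu>. p \<in> C}"
  have EI: "x \<in> C \<Longrightarrow> x - \<mu> *\<^sub>R q \<in> E" for x \<mu> by (auto simp: E_def)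
  have E_scale: "t *\<^sub>R x \<in> E" if "x \<in> E" "0 < t" for x t
  proof -
    from that obtain p \<mu> where "p \<in> C" "x = p - \<mu> *\<^sub>R q" by (auto simp: E_def)
    then have "t *\<^sub>R x = t *\<^sub>R p - (t * \<mu>) *\<^sub>R q" "t *\<^sub>R p \<in> C" using scale that by (auto simp: scaleR_diff_right)
    then show ?thesis using EI by metis
  qed
  have E_q: "x + t *\<^sub>R q \<in> E" if "x \<in> E" for x t
  proof -
    from that obtain p \<mu> where "p \<in> C" "x = p - \<mu> *\<^sub>R q" by (auto simp: E_def)
    then have "x + t *\<^sub>R q = p - (\<mu> - t) *\<^sub>R q" by (simp add: algebra_simps)
    then show ?thesis using EI \<open>p \<in> C\<close> by metis
  qed
  have E_open: "open E"
  proof -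
    have "E = (\<Union>\<mu>. (\<lambda>p. p - \<mu> *\<^sub>R q) ` C)" by (auto simp: E_def)
    then show ?thesis by (auto intro!: open_UN open_translation_subtract op)
  qed
  have E_arc: "x + t *\<^sub>R c s' \<in> E" if "x \<in> E" "0 < t" "s' \<in> {a<..<b}" for x t s'
  proof -
    from that obtain p \<mu> where p: "p \<in> C" "x = p - \<mu> *\<^sub>R q" by (auto simp: E_def)
    have "(1 / t) *\<^sub>R p + c s' \<in> C"
      by (rule open_cone_add_closure[OF op add]) (use p that scale arc in auto)
    then have "t *\<^sub>R ((1 / t) *\<^sub>R p + c s') \<in> C" using scale that by blast
    then have "p + t *\<^sub>R c s' \<in> C" using that by (simp add: scaleR_add_right)
    from EI[OF this, of \<mu>] show ?thesis by (simp add: p algebra_simps)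
  qed
  \<comment> \<open>\<open>\<alpha> *\<^sub>R g\<close> is approximated by
    \<open>\<alpha> / h\<close> times the chord from \<open>c s\<close> to \<open>c (s + h)\<close>.
    The far end may be added as an arc point, the near end is a multiple of \<open>q\<close>, and
    the error is absorbed because \<open>E\<close> is open.\<close>
  have E_g: "x + \<alpha> *\<^sub>R g \<in> E" if "x \<in> E" for x \<alpha>
  proof (cases "\<alpha> = 0")
    case False
    obtain e where e: "0 < e" "ball x e \<subseteq> E" using E_open \<open>x \<in> E\<close> by (meson openE)
    have "((\<lambda>h. norm (c (s + h) - c s - h *\<^sub>R g) / norm h) \<longlongrightarrow> 0) (at 0)"
      using c by (simp add: has_vector_derivative_def has_derivative_at)
    then have ev1: "eventually (\<lambda>h. dist (norm (c (s + h) - c s - h *\<^sub>R g) / norm h) 0 < e / \<bar>\<alpha>\<bar>) (at 0)"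
      using e(1) False by (intro tendstoD) auto
    have "((\<lambda>h. s + h) \<longlongrightarrow> s + 0) (at 0)" by (intro tendsto_intros)
    then have ev2: "eventually (\<lambda>h. s + h \<in> {a<..<b}) (at 0)"
      by (rule topological_tendstoD) (use s in auto)
    from eventually_conj[OF ev1 ev2] obtain d where d: "0 < d" "\<And>h. h \<noteq> 0 \<Longrightarrow> dist h 0 < d \<Longrightarrow>
        norm (c (s + h) - c s - h *\<^sub>R g) / norm h < e / \<bar>\<alpha>\<bar> \<and> s + h \<in> {a<..<b}"
      unfolding eventually_at by auto
    \<comment> \<open>The sign of \<open>h\<close> follows that of \<open>\<alpha>\<close>, since
      arc points may be added only with positive coefficients.\<close>
    define h where "h = sgn \<alpha> * (d / 2)"
    have h: "h \<noteq> 0" "dist h 0 < d" "0 < \<alpha> / h"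
      using False d(1) by (auto simp: h_def abs_mult sgn_if divide_less_0_iff)
    define y where "y = x - (\<alpha> / h) *\<^sub>R (c (s + h) - c s - h *\<^sub>R g)"
    have "norm ((\<alpha> / h) *\<^sub>R (c (s + h) - c s - h *\<^sub>R g)) =
        \<bar>\<alpha>\<bar> * (norm (c (s + h) - c s - h *\<^sub>R g) / norm h)" by (simp add: abs_divide)
    also have "\<dots> < e" using d(2)[OF h(1,2)] False by (simp add: field_simps)
    finally have "y \<in> ball x e" by (simp add: y_def dist_norm)
    then have "y \<in> E" using e by blast
    then have "y + (\<alpha> / h) *\<^sub>R c (s + h) \<in> E" using E_arc h d(2) by blast
    then have "(y + (\<alpha> / h) *\<^sub>R c (s + h)) + (- \<alpha> / h) *\<^sub>R q \<in> E" by (rule E_q)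
    moreover have "(y + (\<alpha> / h) *\<^sub>R c (s + h)) + (- \<alpha> / h) *\<^sub>R q = x + \<alpha> *\<^sub>R g"
      using h(1) by (simp add: y_def q_def algebra_simps)
    ultimately show ?thesis by simp
  qed (use that in simp)
  define \<Gamma> where "\<Gamma> = cross3 (c s) g"
  obtain u where u: "u \<in> E" "\<Gamma> \<bullet> u \<noteq> 0"
  proof -
    from ne EI obtain x where x: "x \<in> E" by blast
    obtain e where e: "0 < e" "ball x e \<subseteq> E" using E_open x by (meson openE)
    show ?thesis
    proof (cases "\<Gamma> \<bullet> x = 0")
      case False with x show ?thesis by (rule that)
    next
      case True
      have nz: "\<Gamma> \<noteq> 0" using G by (simp add: \<Gamma>_def)
      let ?y = "x + (e / (2 * norm \<Gamma>)) *\<^sub>R \<Gamma>"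
      have "?y \<in> ball x e" using e(1) nz by (simp add: dist_norm)
      moreover have "\<Gamma> \<bullet> ?y \<noteq> 0" using e(1) nz True by (simp add: inner_add_right)
      ultimately show ?thesis using that e(2) by blast
    qed
  qed
  show ?thesis
  proof (rule that[of "\<Gamma> \<bullet> u"])
    fix w assume w: "0 < (\<Gamma> \<bullet> u) * (cross3 (c s) g \<bullet> w)"
    \<comment> \<open>Modulo the span of \<open>q\<close> and \<open>g\<close>, under which
      \<open>E\<close> is invariant, \<open>w\<close> is the positive multiple \<open>b\<close> of
      \<open>u\<close>.\<close>
    define b where "b = (\<Gamma> \<bullet> w) / (\<Gamma> \<bullet> u)"
    have b: "0 < b" using w u(2) by (auto simp: b_def \<Gamma>_def zero_less_mult_iff zero_less_divide_iff)
    have "cross3 q g \<bullet> (w - b *\<^sub>R u) = 0"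
      using u(2) by (simp add: inner_diff_right b_def \<Gamma>_def q_def)
    then have "(w - b *\<^sub>R u) \<bullet> cross3 q g = 0" by (simp add: inner_commute)
    moreover have "cross3 q g \<noteq> 0" using G by (simp add: q_def)
    ultimately obtain \<alpha> \<beta> where "w - b *\<^sub>R u = \<alpha> *\<^sub>R q + \<beta> *\<^sub>R g" using cross3_decompose by metis
    then have "w = (b *\<^sub>R u + \<alpha> *\<^sub>R q) + \<beta> *\<^sub>R g" by (simp add: algebra_simps)
    then have "w \<in> E" using E_g E_q E_scale u(1) b by metis
    then obtain p \<mu> where p: "p \<in> C" "w = p - \<mu> *\<^sub>R q" by (auto simp: E_def)
    \<comment> \<open>Small enough that the coefficient \<open>1 - t * \<mu>\<close> of
      \<open>q\<close> stays positive.\<close>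
    define \<delta> where "\<delta> = 1 / (1 + \<bar>\<mu>\<bar>)"
    have "q + t *\<^sub>R w \<in> C" if t: "0 < t" "t < \<delta>" for t
    proof -
      have "t * (1 + \<bar>\<mu>\<bar>) < 1" using t by (simp add: \<delta>_def field_simps)
      then have "t * \<bar>\<mu>\<bar> < 1" using t by (simp add: algebra_simps)
      moreover have "t * \<mu> \<le> t * \<bar>\<mu>\<bar>" using t by simp
      ultimately have pos: "0 < 1 - t * \<mu>" by linarith
      have "(t / (1 - t * \<mu>)) *\<^sub>R p + q \<in> C"
        by (rule open_cone_add_closure[OF op add]) (use p t pos scale arc[OF s] q_def in auto)
      then have "(1 - t * \<mu>) *\<^sub>R ((t / (1 - t * \<mu>)) *\<^sub>R p + q) \<in> C" using scale pos by blast
      moreover have "(1 - t * \<mu>) *\<^sub>R ((t / (1 - t * \<mu>)) *\<^sub>R p + q) = q + t *\<^sub>R w"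
      proof -
        have "(1 - t * \<mu>) *\<^sub>R ((t / (1 - t * \<mu>)) *\<^sub>R p + q) = t *\<^sub>R p + (1 - t * \<mu>) *\<^sub>R q"
          using pos by (simp add: scaleR_add_right)
        then show ?thesis by (simp add: p algebra_simps)
      qed
      ultimately show ?thesis by simp
    qed
    moreover have "0 < \<delta>" by (simp add: \<delta>_def)
    ultimately show "\<exists>\<delta>>0. \<forall>t. 0 < t \<longrightarrow> t < \<delta> \<longrightarrow> c s + t *\<^sub>R w \<in> C" by (auto simp: q_def)
  qed (use u in simp)
qed

section \<open>Functions that are forms on many planes\<close>

text \<open>Homogeneous polynomial functions of a real vector, generated by rules instead of
  coefficients so that their algebra runs by rule induction. The zero function belongs to every
  degree.\<close>

inductive form_fun :: "nat \<Rightarrow> (real^3 \<Rightarrow> complex) \<Rightarrow> bool" where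
  const: "form_fun 0 (\<lambda>_. c)"
| lin: "form_fun n p \<Longrightarrow> form_fun (Suc n) (\<lambda>x. of_real (m \<bullet> x) * p x)"
| add: "form_fun n p \<Longrightarrow> form_fun n q \<Longrightarrow> form_fun n (\<lambda>x. p x + q x)"

lemma form_fun_cmult: "form_fun n p \<Longrightarrow> form_fun n (\<lambda>x. c * p x)"
proof (induction rule: form_fun.induct)
  case (const d) show ?case by (rule form_fun.const)
next
  case (lin n p m)
  from form_fun.lin[OF lin.IH, of m] show ?case by (simp add: mult.left_commute)
next
  case (add n p q)
  from form_fun.add[OF add.IH] show ?case by (simp add: distrib_left)
qed

lemma form_fun_0: "form_fun n (\<lambda>_. 0)"
proof (induction n)
  case 0 show ?case by (rule form_fun.const)
next
  case (Suc n) from form_fun.lin[OF this, of 0] show ?case by simp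
qed

lemma form_fun_diff: "form_fun n p \<Longrightarrow> form_fun n q \<Longrightarrow> form_fun n (\<lambda>x. p x - q x)"
  using form_fun.add[of n p "\<lambda>x. (-1) * q x"] form_fun_cmult[of n q "-1"] by simp

lemma form_fun_sum: "(\<And>i. i \<in> I \<Longrightarrow> form_fun n (p i)) \<Longrightarrow> form_fun n (\<lambda>x. \<Sum>i\<in>I. p i x)"
  by (induction I rule: infinite_finite_induct) (simp_all add: form_fun_0 form_fun.add)

lemma form_fun_mult: "form_fun n p \<Longrightarrow> form_fun m q \<Longrightarrow> form_fun (n + m) (\<lambda>x. p x * q x)"
proof (induction rule: form_fun.induct)
  case (const d) then show ?case by (simp add: form_fun_cmult)
next
  case (lin n p l)
  from form_fun.lin[OF lin.IH[OF lin.prems], of l] show ?case by (simp add: mult.assoc)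
next
  case (add n p r)
  from form_fun.add[OF add.IH(1)[OF add.prems] add.IH(2)[OF add.prems]] show ?case by (simp add: distrib_right)
qed

lemma form_fun_power: "form_fun n p \<Longrightarrow> form_fun (k * n) (\<lambda>x. p x ^ k)"
  by (induction k) (auto intro: form_fun.const form_fun_mult)

lemma form_fun_linear: "form_fun 1 (\<lambda>x. of_real (m \<bullet> x))"
  using form_fun.lin[OF form_fun.const[of 1], of m] by simp

lemma form_fun_quadratic: "form_fun 2 (\<lambda>x. of_real (form K x x))"
proof -
  have *: "form_fun 2 (\<lambda>x. c * (of_real (axis i 1 \<bullet> x) * of_real (axis i 1 \<bullet> x)))" for c and i :: 3
    using form_fun_cmult[OF form_fun_mult[OF form_fun_linear form_fun_linear, of "axis i 1" "axis i 1"], of c] 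
    by (simp add: numeral_2_eq_2)
  have "form_fun 2 (\<lambda>x. (1 * (of_real (axis 1 1 \<bullet> x) * of_real (axis 1 1 \<bullet> x)) +
      1 * (of_real (axis 2 1 \<bullet> x) * of_real (axis 2 1 \<bullet> x))) +
      of_real K * (of_real (axis 3 1 \<bullet> x) * of_real (axis 3 1 \<bullet> x)))"
    by (intro form_fun.add *)
  then show ?thesis by (simp add: form_def inner_axis' )
qed

lemma form_fun_scaleR: "form_fun n p \<Longrightarrow> p (t *\<^sub>R x) = of_real t ^ n * p x"
  by (induction rule: form_fun.induct) (simp_all add: algebra_simps)

lemma form_fun_continuous: "form_fun n p \<Longrightarrow> continuous_on S p"
  by (induction rule: form_fun.induct) (auto intro!: continuous_intros)

lemma form_fun_degree_0:
  assumes "form_fun 0 p"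
  shows "p x = p y"
  using form_fun_scaleR[OF assms, of 0 x] form_fun_scaleR[OF assms, of 0 y] by simp

lemma form_fun_imp_poly3: "form_fun n p \<Longrightarrow> \<exists>P. homogeneous n P \<and> (\<forall>x. eval3 P (complexify x) = p x)"
proof (induction rule: form_fun.induct)
  case (const c)
  show ?case by (rule exI[of _ "const3 c"]) (simp add: homogeneous_const3)
next
  case (lin n p m)
  then obtain P where P: "homogeneous n P" "\<And>x. eval3 P (complexify x) = p x" by blast
  have "homogeneous (1 + n) (lin3 (complexify m) * P)"
    by (intro homogeneous_mult homogeneous_lin3 P)
  then show ?case
    by (intro exI[of _ "lin3 (complexify m) * P"]) (simp add: P inner_vec_def sum_3)
next
  case (add n p q)
  then obtain P Q where "homogeneous n P" "\<And>x. eval3 P (complexify x) = p x"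
    "homogeneous n Q" "\<And>x. eval3 Q (complexify x) = q x" by blast
  then show ?case by (intro exI[of _ "P + Q"]) (simp add: homogeneous_add)
qed

text \<open>Division with remainder by the linear form \<open>e\<close> on the plane spanned by \<open>u\<close> and \<open>w\<close>.\<close>

lemma form_fun_divide:
  assumes "form_fun n q"
  shows "\<exists>c q'. (if n = 0 then q' = (\<lambda>_. 0) else form_fun (n - 1) q') \<and>
    (\<forall>z. z = (e \<bullet> z) *\<^sub>R u + (b \<bullet> z) *\<^sub>R w \<longrightarrow> q z = c * of_real (b \<bullet> z) ^ n + of_real (e \<bullet> z) * q' z)"
  using assms
proof (induction rule: form_fun.induct)
  case (const c)
  show ?case by (intro exI[of _ c] exI[of _ "\<lambda>_. 0"]) simp
next
  case (lin n p m)
  then obtain c q' where q': "if n = 0 then q' = (\<lambda>_. 0) else form_fun (n - 1) q'"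
    "\<And>z. z = (e \<bullet> z) *\<^sub>R u + (b \<bullet> z) *\<^sub>R w \<Longrightarrow> p z = c * of_real (b \<bullet> z) ^ n + of_real (e \<bullet> z) * q' z" by blast
  \<comment> \<open>On the plane \<open>m\<close> acts as \<open>m \<bullet> u\<close> times
    \<open>e\<close> plus \<open>m \<bullet> w\<close> times \<open>b\<close>: the first part goes
    entirely into the quotient, the second multiplies the old quotient and remainder.\<close>
  define q'' where "q'' z = of_real (m \<bullet> u) * p z + of_real (m \<bullet> w) * (of_real (b \<bullet> z) * q' z)" for z
  have "form_fun n (\<lambda>z. of_real (b \<bullet> z) * q' z)"
    using q'(1) form_fun.lin[of "n - 1" q' b] by (cases "n = 0") (auto simp: form_fun_0)
  then have "form_fun n q''"
    unfolding q''_def by (intro form_fun.add form_fun_cmult lin.hyps)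
  moreover have "of_real (m \<bullet> z) * p z = (of_real (m \<bullet> w) * c) * of_real (b \<bullet> z) ^ Suc n + of_real (e \<bullet> z) * q'' z"
    if z: "z = (e \<bullet> z) *\<^sub>R u + (b \<bullet> z) *\<^sub>R w" for z
  proof -
    have "m \<bullet> z = (e \<bullet> z) * (m \<bullet> u) + (b \<bullet> z) * (m \<bullet> w)"
      by (subst z) (simp add: inner_add_right)
    then show ?thesis using q'(2)[OF z] by (simp add: q''_def algebra_simps)
  qed
  ultimately show ?case by (intro exI[of _ "of_real (m \<bullet> w) * c"] exI[of _ q'']) auto
next
  case (add n p q)
  then obtain c p' d q' where *: "if n = 0 then p' = (\<lambda>_. 0) else form_fun (n - 1) p'"
    "\<And>z. z = (e \<bullet> z) *\<^sub>R u + (b \<bullet> z) *\<^sub>R w \<Longrightarrow> p z = c * of_real (b \<bullet> z) ^ n + of_real (e \<bullet> z) * p' z"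
    "if n = 0 then q' = (\<lambda>_. 0) else form_fun (n - 1) q'"
    "\<And>z. z = (e \<bullet> z) *\<^sub>R u + (b \<bullet> z) *\<^sub>R w \<Longrightarrow> q z = d * of_real (b \<bullet> z) ^ n + of_real (e \<bullet> z) * q' z" by blast
  show ?case
  proof (intro exI[of _ "c + d"] exI[of _ "\<lambda>z. p' z + q' z"] conjI allI impI)
    show "if n = 0 then (\<lambda>z. p' z + q' z) = (\<lambda>_. 0) else form_fun (n - 1) (\<lambda>z. p' z + q' z)"
      using *(1,3) by (auto intro: form_fun.add)
  qed (use *(2,4) in \<open>simp add: algebra_simps\<close>)
qed

section \<open>Vectors in general position\<close>

lemma cross3_eq_0_imp_parallel:
  assumes "cross3 x y = 0" "y \<noteq> 0"
  obtains c where "x = c *\<^sub>R y"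
proof -
  have "(y \<bullet> y) *\<^sub>R x = (x \<bullet> y) *\<^sub>R y + cross3 y (cross3 x y)"
    by (simp add: coords algebra_simps)
  then have "(1 / (y \<bullet> y)) *\<^sub>R ((y \<bullet> y) *\<^sub>R x) = ((x \<bullet> y) / (y \<bullet> y)) *\<^sub>R y" using assms(1) by simp
  then have "x = ((x \<bullet> y) / (y \<bullet> y)) *\<^sub>R y" using assms(2) by simp
  then show ?thesis by (rule that)
qed

lemma exists_orthogonal: "\<exists>w::real^3. w \<noteq> 0 \<and> w \<bullet> v = 0"
proof (cases "v$1 = 0 \<and> v$2 = 0")
  case True
  then show ?thesis
    by (intro exI[of _ "vector [1, 0, 0]"]) (simp add: coords)
next
  case False
  then show ?thesis
    by (intro exI[of _ "vector [- v$2, v$1, 0]"]) (auto simp: coords)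
qed

lemma open_avoid_hyperplanes:
  fixes C :: "'a::euclidean_space set"
  assumes "finite W" "0 \<notin> W" "open C" "C \<noteq> {}"
  shows "\<exists>e\<in>C. \<forall>w\<in>W. e \<bullet> w \<noteq> 0"
  using assms
proof (induction W arbitrary: C rule: finite_induct)
  case (insert w W)
  have cl: "open {e. e \<bullet> w \<noteq> 0}"
    by (intro open_Collect_neq continuous_intros)
  have "C \<inter> {e. e \<bullet> w \<noteq> 0} \<noteq> {}"
  proof
    assume "C \<inter> {e. e \<bullet> w \<noteq> 0} = {}"
    then have sub: "C \<subseteq> {e. w \<bullet> e = 0}" by (auto simp: inner_commute)
    have "interior {e. w \<bullet> e = 0} = {}"
      using insert.prems(1) by (intro interior_hyperplane) auto
    then show False using sub insert.prems(2,3) interior_maximal by blast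
  qed
  then obtain e where "e \<in> C \<inter> {e. e \<bullet> w \<noteq> 0}" "\<forall>w\<in>W. e \<bullet> w \<noteq> 0"
    using insert.IH[of "C \<inter> {e. e \<bullet> w \<noteq> 0}"] insert.prems cl by (auto simp: open_Int)
  then show ?case by auto
qed auto

text \<open>No \<open>f\<close> is parallel to \<open>r\<close>, so each condition excludes only a
  line of the plane orthogonal to \<open>r\<close>. A small step along \<open>d\<close>, a multiple
  of the projection of \<open>f\<close> to that plane, leaves this line.\<close>

lemma plane_avoid_lines:
  fixes r :: "real^3"
  assumes "finite F" "\<And>f. f \<in> F \<Longrightarrow> cross3 f r \<noteq> 0" "z0 \<bullet> r = 0" "0 < \<epsilon>"
  shows "\<exists>z. z \<bullet> r = 0 \<and> dist z z0 < \<epsilon> \<and> (\<forall>f\<in>F. z \<bullet> f \<noteq> 0)"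
  using assms
proof (induction F arbitrary: \<epsilon> rule: finite_induct)
  case empty then show ?case by (intro exI[of _ z0]) simp
next
  case (insert f F)
  obtain z where z: "z \<bullet> r = 0" "dist z z0 < \<epsilon>" "\<forall>f\<in>F. z \<bullet> f \<noteq> 0"
    using insert.IH[of \<epsilon>] insert.prems by auto
  define d where "d = cross3 r (cross3 f r)"
  have dr: "d \<bullet> r = 0" by (simp add: d_def coords algebra_simps)
  have "d \<bullet> f = cross3 f r \<bullet> cross3 f r" by (simp add: d_def coords algebra_simps)
  moreover have "cross3 f r \<noteq> 0" using insert.prems(1) by blast
  ultimately have df: "d \<bullet> f \<noteq> 0" by simp
  have lim: "((\<lambda>t. z + t *\<^sub>R d) \<longlongrightarrow> z + 0 *\<^sub>R d) (at_right 0)" by (intro tendsto_intros)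
  have op: "open (ball z0 \<epsilon> \<inter> (\<Inter>f\<in>F. {z. z \<bullet> f \<noteq> 0}))"
    using insert.hyps by (intro open_Int open_INT ballI open_Collect_neq continuous_intros) auto
  have ev1: "eventually (\<lambda>t. z + t *\<^sub>R d \<in> ball z0 \<epsilon> \<inter> (\<Inter>f\<in>F. {z. z \<bullet> f \<noteq> 0})) (at_right 0)"
    by (rule topological_tendstoD[OF lim op]) (use z in \<open>auto simp: dist_commute\<close>)
  have ev2: "eventually (\<lambda>t. (z + t *\<^sub>R d) \<bullet> f \<noteq> 0) (at_right (0::real))"
  proof (cases "z \<bullet> f = 0")
    case True
    have "(z + t *\<^sub>R d) \<bullet> f \<noteq> 0" if "t > 0" for t
      using that True df by (simp add: inner_add_left)
    then show ?thesis by (auto simp: eventually_at_right_field intro: exI[of _ 1])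
  next
    case False
    have "open {z. z \<bullet> f \<noteq> 0}" by (intro open_Collect_neq continuous_intros)
    then have "eventually (\<lambda>t. z + t *\<^sub>R d \<in> {z. z \<bullet> f \<noteq> 0}) (at_right 0)"
      by (rule topological_tendstoD[OF lim]) (use False in simp)
    then show ?thesis by simp
  qed
  from eventually_happens'[OF _ eventually_conj[OF ev1 ev2]]
  obtain t where t: "z + t *\<^sub>R d \<in> ball z0 \<epsilon> \<inter> (\<Inter>f\<in>F. {z. z \<bullet> f \<noteq> 0})" "(z + t *\<^sub>R d) \<bullet> f \<noteq> 0"
    by (auto simp: trivial_limit_at_right_real)
  then show ?case using z(1) dr
    by (intro exI[of _ "z + t *\<^sub>R d"]) (auto simp: inner_add_left dist_commute)
qed

text \<open>
  The induction subtracts from \<open>h\<close> its form on one plane \<open>e\<^sup>\<bottom>\<close> and divides by the linear form \<open>e\<close>,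
  which lowers the degree by one on all other planes; the finite sets \<open>E\<close> and \<open>W\<close> collect
  the vectors that have to be avoided.
\<close>

lemma forms_on_planes_generic:
  assumes op: "open C" and ne: "C \<noteq> {}"
  shows "\<lbrakk>finite E; finite W; 0 \<notin> E; 0 \<notin> W;
     \<And>r. r \<in> C \<Longrightarrow> \<forall>w\<in>W. r \<bullet> w \<noteq> 0 \<Longrightarrow>
       \<exists>p. form_fun n p \<and> (\<forall>z. z \<noteq> 0 \<longrightarrow> z \<bullet> r = 0 \<longrightarrow> (\<forall>e\<in>E. z \<bullet> e \<noteq> 0) \<longrightarrow> h z = p z)\<rbrakk>
   \<Longrightarrow> \<exists>\<Psi> E' W'. form_fun n \<Psi> \<and> finite E' \<and> finite W' \<and> 0 \<notin> E' \<and> 0 \<notin> W' \<and>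
     (\<forall>r\<in>C. (\<forall>w\<in>W'. r \<bullet> w \<noteq> 0) \<longrightarrow>
       (\<forall>z. z \<noteq> 0 \<longrightarrow> z \<bullet> r = 0 \<longrightarrow> (\<forall>e\<in>E'. z \<bullet> e \<noteq> 0) \<longrightarrow> h z = \<Psi> z))"
proof (induction n arbitrary: h E W rule: less_induct)
  case (less n)
  note fin = less.prems(1-4) and H = less.prems(5)
  define orth where "orth v = (SOME w::real^3. w \<noteq> 0 \<and> w \<bullet> v = 0)" for v
  have orth: "orth v \<noteq> 0" "orth v \<bullet> v = 0" for v
    using someI_ex[OF exists_orthogonal[of v]] by (auto simp: orth_def)
  have not_parallel: "cross3 x v \<noteq> 0" if x: "x \<bullet> orth v \<noteq> 0" and v: "v \<noteq> 0" for x v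
  proof
    assume "cross3 x v = 0"
    then obtain c where "x = c *\<^sub>R v" using cross3_eq_0_imp_parallel v by blast
    with x orth(2)[of v] show False by (simp add: inner_commute)
  qed
  \<comment> \<open>\<open>orth v\<close> is orthogonal to \<open>v\<close>, so a vector with
    nonzero product with it is not parallel to \<open>v\<close>. For \<open>v = 0\<close> this only
    makes \<open>e\<close> nonzero.\<close>
  obtain e where e: "e \<in> C" "\<forall>w\<in>insert (orth 0) (W \<union> orth ` E). e \<bullet> w \<noteq> 0"
    using open_avoid_hyperplanes[of "insert (orth 0) (W \<union> orth ` E)" C] fin orth(1) op ne by (metis (no_types, lifting) Un_iff finite.insertI finite_UnI finite_imageI imageE insertE)
  have e0: "e \<noteq> 0" using e(2) by auto
  obtain p0 where p0: "form_fun n p0"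
    "\<And>z. z \<noteq> 0 \<Longrightarrow> z \<bullet> e = 0 \<Longrightarrow> \<forall>e\<in>E. z \<bullet> e \<noteq> 0 \<Longrightarrow> h z = p0 z" using H[OF e(1)] e(2) by blast
  \<comment> \<open>For such \<open>r\<close> the planes orthogonal to \<open>r\<close> and
    \<open>e\<close> meet in the line of \<open>cross3 r e\<close>, and this vector avoids the
    exceptions of \<open>E\<close>, so the forms of both planes equal \<open>h\<close>
    there.\<close>
  define W' where "W' = insert (orth e) (W \<union> cross3 e ` E)"
  have W': "finite W'" "0 \<notin> W'"
  proof -
    have "cross3 e x \<noteq> 0" if "x \<in> E" for x
      by (rule not_parallel) (use e(2) that fin(3) in auto)
    then show "finite W'" "0 \<notin> W'"
      using fin orth(1)[of e] by (auto simp: W'_def)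
  qed
  have key: "cross3 r e \<noteq> 0 \<and> (\<exists>p. form_fun n p \<and> p (cross3 r e) = p0 (cross3 r e) \<and>
      (\<forall>z. z \<noteq> 0 \<longrightarrow> z \<bullet> r = 0 \<longrightarrow> (\<forall>e\<in>E. z \<bullet> e \<noteq> 0) \<longrightarrow> h z = p z))"
    if r: "r \<in> C" "\<forall>w\<in>W'. r \<bullet> w \<noteq> 0" for r
  proof -
    obtain p where p: "form_fun n p" "\<And>z. z \<noteq> 0 \<Longrightarrow> z \<bullet> r = 0 \<Longrightarrow> \<forall>e\<in>E. z \<bullet> e \<noteq> 0 \<Longrightarrow> h z = p z"
      using H[OF r(1)] r(2) by (auto simp: W'_def)
    have nz: "cross3 r e \<noteq> 0" using not_parallel r(2) e0 by (auto simp: W'_def)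
    moreover have "cross3 r e \<bullet> e' \<noteq> 0" if "e' \<in> E" for e'
    proof -
      have "cross3 r e \<bullet> e' = r \<bullet> cross3 e e'" by (simp add: coords algebra_simps)
      then show ?thesis using r(2) that by (auto simp: W'_def)
    qed
    ultimately have "p (cross3 r e) = p0 (cross3 r e)"
      using p(2)[of "cross3 r e"] p0(2)[of "cross3 r e"] by (simp add: dot_cross_self)
    with nz p show ?thesis by blast
  qed
  show ?case
  proof (cases n)
    case 0
    show ?thesis
    proof (rule exI[of _ p0], rule exI[of _ E], rule exI[of _ W'], intro conjI ballI impI allI)
      fix r z assume r: "r \<in> C" "\<forall>w\<in>W'. r \<bullet> w \<noteq> 0" "z \<noteq> 0" "z \<bullet> r = 0" "\<forall>e\<in>E. z \<bullet> e \<noteq> 0"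
      then obtain p where "form_fun n p" "p (cross3 r e) = p0 (cross3 r e)" "h z = p z" using key by blast
      with 0 p0(1) show "h z = p0 z" using form_fun_degree_0 by metis
    qed (use fin W' p0 in auto)
  next
    case (Suc m)
    define h1 where "h1 z = (h z - p0 z) / of_real (e \<bullet> z)" for z
    have h1_forms: "\<exists>p. form_fun m p \<and> (\<forall>z. z \<noteq> 0 \<longrightarrow> z \<bullet> r = 0 \<longrightarrow> (\<forall>e\<in>insert e E. z \<bullet> e \<noteq> 0) \<longrightarrow> h1 z = p z)"
      if r: "r \<in> C" "\<forall>w\<in>W'. r \<bullet> w \<noteq> 0" for r
    proof -
      from key[OF r] obtain p where nz: "cross3 r e \<noteq> 0" and p: "form_fun n p" "p (cross3 r e) = p0 (cross3 r e)"
        "\<And>z. z \<noteq> 0 \<Longrightarrow> z \<bullet> r = 0 \<Longrightarrow> \<forall>e\<in>E. z \<bullet> e \<noteq> 0 \<Longrightarrow> h z = p z" by blast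
      define w where "w = cross3 r e"
      define v where "v = cross3 r w"
      have "v \<bullet> e = - (w \<bullet> w)" by (simp add: v_def w_def coords algebra_simps)
      then have ve: "v \<bullet> e \<noteq> 0" using nz by (simp add: w_def)
      have ww: "w \<bullet> w \<noteq> 0" using nz by (simp add: w_def)
      define u where "u = (1 / (v \<bullet> e)) *\<^sub>R v"
      define b where "b = (1 / (w \<bullet> w)) *\<^sub>R w"
      have dec: "z = (e \<bullet> z) *\<^sub>R u + (b \<bullet> z) *\<^sub>R w" if "z \<bullet> r = 0" for z
      proof -
        have "cross3 w v \<noteq> 0"
        proof
          assume "cross3 w v = 0"
          moreover have "cross3 w v = (w \<bullet> w) *\<^sub>R r" by (simp add: v_def w_def coords algebra_simps)
          ultimately have "r = 0" using ww by simp
          then show False using nz by simp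
        qed
        moreover have "z \<bullet> cross3 w v = 0"
        proof -
          have "cross3 w v = (w \<bullet> w) *\<^sub>R r" by (simp add: v_def w_def coords algebra_simps)
          then show ?thesis using that by simp
        qed
        ultimately obtain \<alpha> \<beta> where z: "z = \<alpha> *\<^sub>R w + \<beta> *\<^sub>R v" using cross3_decompose by metis
        have "e \<bullet> w = 0" "w \<bullet> v = 0" by (simp_all add: w_def v_def dot_cross_self)
        then have "e \<bullet> z = \<beta> * (v \<bullet> e)" "b \<bullet> z = \<alpha>"
          using ww by (simp_all add: z b_def inner_add_right inner_commute)
        then show ?thesis using ve by (simp add: u_def z)
      qed
      obtain c q where q: "form_fun m q"
        "\<And>z. z = (e \<bullet> z) *\<^sub>R u + (b \<bullet> z) *\<^sub>R w \<Longrightarrow> p z - p0 z = c * of_real (b \<bullet> z) ^ n + of_real (e \<bullet> z) * q z"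
        using form_fun_divide[OF form_fun_diff[OF p(1) p0(1)], of e u b w] Suc by auto
      have "w \<bullet> r = 0" "e \<bullet> w = 0" "b \<bullet> w = 1" using ww by (simp_all add: w_def b_def dot_cross_self)
      \<comment> \<open>The remainder is \<open>c\<close> times a power of \<open>b\<close>; it
        vanishes at \<open>w = cross3 r e\<close>, where \<open>p\<close> and \<open>p0\<close>
        agree and \<open>b \<bullet> w = 1\<close>.\<close>
      then have "c = 0" using q(2)[OF dec, of w] p(2) by (simp add: w_def)
      show ?thesis
      proof (intro exI[of _ q] conjI allI impI)
        fix z assume z: "z \<noteq> 0" "z \<bullet> r = 0" "\<forall>e\<in>insert e E. z \<bullet> e \<noteq> 0"
        then have "h z - p0 z = of_real (e \<bullet> z) * q z" "e \<bullet> z \<noteq> 0"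
          using p(3)[of z] q(2)[OF dec] \<open>c = 0\<close> by (auto simp: inner_commute)
        then show "h1 z = q z" by (simp add: h1_def)
      qed (rule q)
    qed
    have "\<exists>\<Psi> E' W''. form_fun m \<Psi> \<and> finite E' \<and> finite W'' \<and> 0 \<notin> E' \<and> 0 \<notin> W'' \<and>
     (\<forall>r\<in>C. (\<forall>w\<in>W''. r \<bullet> w \<noteq> 0) \<longrightarrow>
       (\<forall>z. z \<noteq> 0 \<longrightarrow> z \<bullet> r = 0 \<longrightarrow> (\<forall>e\<in>E'. z \<bullet> e \<noteq> 0) \<longrightarrow> h1 z = \<Psi> z))"
    proof (rule less.IH[of m "insert e E" W' h1])
      show "m < n" using Suc by simp
      show "finite (insert e E)" "0 \<notin> insert e E" using fin e0 by auto
    qed (fact W', fact W', rule h1_forms)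
    then obtain \<Psi> E' W'' where \<Psi>: "form_fun m \<Psi>" "finite E'" "finite W''" "0 \<notin> E'" "0 \<notin> W''"
      and eq: "\<forall>r\<in>C. (\<forall>w\<in>W''. r \<bullet> w \<noteq> 0) \<longrightarrow>
       (\<forall>z. z \<noteq> 0 \<longrightarrow> z \<bullet> r = 0 \<longrightarrow> (\<forall>e\<in>E'. z \<bullet> e \<noteq> 0) \<longrightarrow> h1 z = \<Psi> z)"
      by (elim exE conjE)
    show ?thesis
    proof (rule exI[of _ "\<lambda>z. p0 z + of_real (e \<bullet> z) * \<Psi> z"], rule exI[of _ "insert e E'"],
        rule exI[of _ W''], intro conjI ballI impI allI)
      show "form_fun n (\<lambda>z. p0 z + of_real (e \<bullet> z) * \<Psi> z)"
        using form_fun.add[OF p0(1)] form_fun.lin[OF \<Psi>(1), of e] Suc by simp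
      fix r z assume r: "r \<in> C" "\<forall>w\<in>W''. r \<bullet> w \<noteq> 0" "z \<noteq> 0" "z \<bullet> r = 0" "\<forall>e\<in>insert e E'. z \<bullet> e \<noteq> 0"
      have "z \<bullet> e \<noteq> 0" "\<forall>e\<in>E'. z \<bullet> e \<noteq> 0" using r(5) by simp_all
      with eq r(1-4) have "h1 z = \<Psi> z" "e \<bullet> z \<noteq> 0" by (simp_all add: inner_commute)
      then show "h z = p0 z + of_real (e \<bullet> z) * \<Psi> z" by (auto simp: h1_def field_simps)
    qed (use \<Psi> e0 in auto)
  qed
qed


text \<open>The exceptions are removed in two rounds. For \<open>r\<close> in general position,
  equality spreads over the whole plane by continuity. For arbitrary \<open>r\<close> and
  \<open>z\<close>, the vector \<open>r\<close> is moved within the plane orthogonal to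
  \<open>z\<close> into general position, which does not affect \<open>h z\<close>.\<close>

lemma forms_on_planes:
  assumes op: "open C" and ne: "C \<noteq> {}"
    and H: "\<And>r. r \<in> C \<Longrightarrow> \<exists>p. form_fun n p \<and> (\<forall>z. z \<noteq> 0 \<longrightarrow> z \<bullet> r = 0 \<longrightarrow> h z = p z)"
  shows "\<exists>\<Psi>. form_fun n \<Psi> \<and> (\<forall>r\<in>C. \<forall>z. z \<noteq> 0 \<longrightarrow> z \<bullet> r = 0 \<longrightarrow> h z = \<Psi> z)"
proof -
  have "\<exists>\<Psi> E W. form_fun n \<Psi> \<and> finite E \<and> finite W \<and> 0 \<notin> E \<and> 0 \<notin> W \<and>
     (\<forall>r\<in>C. (\<forall>w\<in>W. r \<bullet> w \<noteq> 0) \<longrightarrow>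
       (\<forall>z. z \<noteq> 0 \<longrightarrow> z \<bullet> r = 0 \<longrightarrow> (\<forall>e\<in>E. z \<bullet> e \<noteq> 0) \<longrightarrow> h z = \<Psi> z))"
    by (rule forms_on_planes_generic[OF op ne, of "{}" "{}" n h]) (use H in simp_all)
  then obtain \<Psi> E W where \<Psi>: "form_fun n \<Psi>" "finite E" "finite W" "0 \<notin> E" "0 \<notin> W"
    and eq: "\<forall>r\<in>C. (\<forall>w\<in>W. r \<bullet> w \<noteq> 0) \<longrightarrow>
       (\<forall>z. z \<noteq> 0 \<longrightarrow> z \<bullet> r = 0 \<longrightarrow> (\<forall>e\<in>E. z \<bullet> e \<noteq> 0) \<longrightarrow> h z = \<Psi> z)"
    by (elim exE conjE)
  have generic: "h z0 = \<Psi> z0"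
    if r: "r \<in> C" "\<forall>e\<in>E. cross3 e r \<noteq> 0" "r \<noteq> 0" and z0: "z0 \<noteq> 0" "z0 \<bullet> r = 0" for r z0
  proof -
    obtain p where p: "form_fun n p" "\<And>z. z \<noteq> 0 \<Longrightarrow> z \<bullet> r = 0 \<Longrightarrow> h z = p z" using H[OF r(1)] by blast
    have "p z0 = \<Psi> z0"
    proof (rule ccontr)
      assume ne: "p z0 \<noteq> \<Psi> z0"
      have "open {z. p z \<noteq> \<Psi> z}"
        by (intro open_Collect_neq form_fun_continuous[OF p(1)] form_fun_continuous[OF \<Psi>(1)])
      then have "open ({z. p z \<noteq> \<Psi> z} - {0})" by (intro open_Diff) auto
      then obtain \<epsilon> where \<epsilon>: "0 < \<epsilon>" "ball z0 \<epsilon> \<subseteq> {z. p z \<noteq> \<Psi> z} - {0}"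
        using ne z0(1) by (metis (mono_tags, lifting) DiffI empty_iff insert_iff mem_Collect_eq openE)
      \<comment> \<open>The added vectors keep \<open>z\<close> from being parallel to any
        \<open>w\<close> in \<open>W\<close>, so that \<open>r\<close> can afterwards be moved
        within the plane orthogonal to \<open>z\<close> off the planes given by
        \<open>W\<close>.\<close>
      define F where "F = E \<union> cross3 r ` {w \<in> W. w \<bullet> r = 0}"
      have "cross3 f r \<noteq> 0" if f: "f \<in> F" for f
      proof (cases "f \<in> E")
        case False
        then obtain w where w: "w \<in> W" "w \<bullet> r = 0" "f = cross3 r w" using f by (auto simp: F_def)
        have "cross3 f r = (r \<bullet> r) *\<^sub>R w - (w \<bullet> r) *\<^sub>R r" by (simp add: w(3) coords algebra_simps)
        moreover have "w \<noteq> 0" using w(1) \<Psi>(5) by auto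
        ultimately show ?thesis using w(2) r(3) by simp
      qed (use r in auto)
      moreover have "finite F" using \<Psi>(2,3) by (simp add: F_def)
      ultimately obtain z where z: "z \<bullet> r = 0" "dist z z0 < \<epsilon>" "\<forall>f\<in>F. z \<bullet> f \<noteq> 0"
        using plane_avoid_lines[of F r z0 \<epsilon>] z0(2) \<epsilon>(1) by blast
      have zb: "p z \<noteq> \<Psi> z" "z \<noteq> 0" using \<epsilon>(2) z(2) by (auto simp: dist_commute subset_iff)
      have wz: "cross3 w z \<noteq> 0" if "w \<in> W" for w
      proof
        assume "cross3 w z = 0"
        then obtain c where c: "w = c *\<^sub>R z" using cross3_eq_0_imp_parallel zb(2) by blast
        then have "w \<bullet> r = 0" using z(1) by simp
        then have "z \<bullet> cross3 r w \<noteq> 0" using z(3) that by (auto simp: F_def)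
        moreover have "z \<bullet> cross3 r w = 0" by (simp add: c coords algebra_simps)
        ultimately show False by simp
      qed
      obtain \<delta> where \<delta>: "0 < \<delta>" "ball r \<delta> \<subseteq> C" using op r(1) by (meson openE)
      obtain r' where r': "r' \<bullet> z = 0" "dist r' r < \<delta>" "\<forall>w\<in>W. r' \<bullet> w \<noteq> 0"
        using plane_avoid_lines[of W z r \<delta>] \<Psi>(3) wz z(1) \<delta>(1) by (auto simp: inner_commute)
      then have "r' \<in> C" using \<delta>(2) by (auto simp: dist_commute subset_iff)
      then have "h z = \<Psi> z" using eq r' zb(2) z(3) by (simp add: inner_commute F_def)
      with p(2)[of z] zb z(1) show False by simp
    qed
    then show ?thesis using p(2) z0 by simp
  qed
  have "h z = \<Psi> z" if r: "r \<in> C" and z: "z \<noteq> 0" "z \<bullet> r = 0" for r z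
  proof -
    obtain v where v: "v \<noteq> 0" "v \<bullet> z = 0" using exists_orthogonal by blast
    define F where "F = insert v {cross3 e z | e. e \<in> E \<and> cross3 e z \<noteq> 0}"
    have orth_nz: "cross3 x z \<noteq> 0" if "x \<noteq> 0" "x \<bullet> z = 0" for x
    proof
      assume "cross3 x z = 0"
      then obtain c where "x = c *\<^sub>R z" using cross3_eq_0_imp_parallel z(1) by blast
      with that z(1) show False by auto
    qed
    have "finite {cross3 e z | e. e \<in> E}" using \<Psi>(2) by simp
    then have "finite F" unfolding F_def by (auto elim: rev_finite_subset)
    moreover have "cross3 f z \<noteq> 0" if "f \<in> F" for f
      using that v by (intro orth_nz) (auto simp: F_def dot_cross_self)
    moreover obtain \<delta> where \<delta>: "0 < \<delta>" "ball r \<delta> \<subseteq> C" using op r by (meson openE)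
    ultimately obtain r' where r': "r' \<bullet> z = 0" "dist r' r < \<delta>" "\<forall>f\<in>F. r' \<bullet> f \<noteq> 0"
      using plane_avoid_lines[of F z r \<delta>] z(2) by (auto simp: inner_commute)
    have r'0: "r' \<noteq> 0" using r'(3) by (auto simp: F_def)
    have "r' \<in> C" using \<delta>(2) r'(2) by (auto simp: dist_commute subset_iff)
    moreover have "cross3 e r' \<noteq> 0" if "e \<in> E" for e
    proof
      assume "cross3 e r' = 0"
      then obtain c where c: "e = c *\<^sub>R r'" using cross3_eq_0_imp_parallel r'0 by blast
      moreover have "e \<noteq> 0" using that \<Psi>(4) by auto
      ultimately have "cross3 e z \<noteq> 0" using r'(1) by (intro orth_nz) auto
      then have "r' \<bullet> cross3 e z \<noteq> 0" using r'(3) that by (auto simp: F_def)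
      moreover have "r' \<bullet> cross3 e z = 0" by (simp add: c coords algebra_simps)
      ultimately show False by simp
    qed
    ultimately show ?thesis using generic[of r' z] z(1) r'(1) r'0 by (auto simp: inner_commute)
  qed
  with \<Psi>(1) show ?thesis by blast
qed

section \<open>Conservation along flights and at bounces\<close>

text \<open>Tangent planes of the hyperboloid are spacelike, by Lagrange's identity in the first two
  coordinates.\<close>

lemma form_tangent_pos:
  assumes K: "K = 1 \<or> K = -1" and p: "form K p p = K" "form K p v = 0" "v \<noteq> 0"
  shows "0 < form K v v"
proof (cases "K = 1")
  case True
  have "form 1 v v = v \<bullet> v" by (simp add: form_def inner_vec_def sum_3)
  with True p(3) show ?thesis by simp
next
  case False
  then have [simp]: "K = -1" using K by simp
  have 1: "(p$3)\<^sup>2 = 1 + (p$1)\<^sup>2 + (p$2)\<^sup>2" "p$3 * v$3 = p$1 * v$1 + p$2 * v$2"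
    using p by (auto simp: form_def power2_eq_square)
  define N where "N = (v$1)\<^sup>2 + (v$2)\<^sup>2"
  have "(p$1 * v$1 + p$2 * v$2)\<^sup>2 + (p$1 * v$2 - p$2 * v$1)\<^sup>2 = ((p$3)\<^sup>2 - 1) * N"
    unfolding 1 N_def by (simp add: power2_eq_square algebra_simps)
  moreover have "0 \<le> (p$1 * v$2 - p$2 * v$1)\<^sup>2" by simp
  ultimately have "(p$3 * v$3)\<^sup>2 \<le> ((p$3)\<^sup>2 - 1) * N" unfolding 1 by linarith
  then have le: "(p$3)\<^sup>2 * (v$3)\<^sup>2 + N \<le> (p$3)\<^sup>2 * N" by (simp add: power_mult_distrib algebra_simps)
  have p3: "0 < (p$3)\<^sup>2" unfolding 1(1) by (simp add: add_pos_nonneg)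
  have "N \<noteq> 0"
  proof
    assume "N = 0"
    then have "v$1 = 0" "v$2 = 0" by (auto simp: N_def sum_power2_eq_zero_iff)
    moreover from this have "v$3 = 0" using 1(2) p3 by auto
    ultimately show False using p(3) by (simp add: vec_eq_iff forall_3)
  qed
  then have "0 < N" by (simp add: N_def less_le)
  with le have "(p$3)\<^sup>2 * (v$3)\<^sup>2 < (p$3)\<^sup>2 * N" by linarith
  then have "(v$3)\<^sup>2 < N" using p3 by simp
  then show ?thesis by (simp add: form_def N_def power2_eq_square)
qed

text \<open>\<open>vel K r\<close> is isometric on the vectors orthogonal to \<open>r\<close> and
  takes values in the tangent plane, where \<open>form\<close> is positive. This justifies the
  square root in the normalization of lines.\<close>

lemma form_line_pos:
  assumes K: "K = 1 \<or> K = -1" and r: "form K r r = K" and z: "z \<bullet> r = 0" "z \<noteq> 0"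
  shows "0 < form K z z"
proof -
  have "vel K r z \<noteq> 0" using cross3_vel[OF K r z(1)] z(2) by auto
  from form_tangent_pos[OF K r form_vel[OF K] this] show ?thesis
    using form_vel_vel[OF K r z(1)] by simp
qed

text \<open>Angular momentum is conserved because the linear flow on the plane of \<open>q\<close>
  and \<open>w\<close> has determinant 1, and \<open>vel\<close> recovers the velocity from
  it.\<close>

lemma geodesic_vel:
  assumes K: "K = 1 \<or> K = -1" and q: "form K q q = K" and w: "form K q w = 0" "form K w w = 1"
  shows "vel K (cosK K t *\<^sub>R q + sinK K t *\<^sub>R w) (cross3 q w) = (- K * sinK K t) *\<^sub>R q + cosK K t *\<^sub>R w"
    and "cross3 q w \<bullet> (cosK K t *\<^sub>R q + sinK K t *\<^sub>R w) = 0"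
proof -
  let ?r = "cosK K t *\<^sub>R q + sinK K t *\<^sub>R w" and ?v = "(- K * sinK K t) *\<^sub>R q + cosK K t *\<^sub>R w"
  have KK: "K * K = 1" using K by auto
  have "form K ?r ?r = K * ((cosK K t)\<^sup>2 + K * (sinK K t)\<^sup>2)"
    using K by (auto simp: form_simps q w form_commute[of K w q] power2_eq_square algebra_simps)
  then have rr: "form K ?r ?r = K" by (simp add: cosK_sinK[OF K])
  have rv: "form K ?r ?v = 0"
    using K by (auto simp: form_simps q w form_commute[of K w q] algebra_simps)
  have "cross3 ?r ?v = ((cosK K t)\<^sup>2 + K * (sinK K t)\<^sup>2) *\<^sub>R cross3 q w"
    by (simp add: cross3_def vec_eq_iff forall_3 power2_eq_square algebra_simps)
  then have "cross3 ?r ?v = cross3 q w" by (simp add: cosK_sinK[OF K])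
  with vel_cross3[OF K rr rv] show "vel K ?r (cross3 q w) = ?v" by simp
  show "cross3 q w \<bullet> ?r = 0" by (simp add: inner_add_right dot_cross_self)
qed

text \<open>The last sign condition says that the flight with momentum \<open>z\<close> runs from
  \<open>r\<close> to \<open>r'\<close>: the segment between them has momentum \<open>M\<close> with
  \<open>cross3 r r' = sinK K l *\<^sub>R M\<close> and positive sine, and the normalization forces
  \<open>z = M\<close>.\<close>

lemma flight_invariant_oriented:
  assumes K: "K = 1 \<or> K = -1" and cv: "convex_domain K \<Omega>"
    and inv: "\<And>s s'. billiard_orbit K \<Omega> s s' \<Longrightarrow> \<Phi> s = \<Phi> s'"
    and r: "r \<in> \<Omega>" "r' \<in> \<Omega>" "r \<noteq> - r'" and z: "z \<bullet> r = 0" "z \<bullet> r' = 0" "form K z z = 1" "0 < z \<bullet> cross3 r r'"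
  shows "\<Phi> (r, vel K r z) = \<Phi> (r', vel K r' z)"
proof -
  have ne: "r \<noteq> r'" using z(4) by auto
  obtain l c v where l: "0 < l" and g: "unit_geodesic K {0..l} c v" and c: "c ` {0..l} \<subseteq> \<Omega>" "c 0 = r" "c l = r'"
    and S: "\<And>t. 0 < t \<Longrightarrow> t \<le> l \<Longrightarrow> 0 < sinK K t"
    using convex_segment[OF K cv r(1,2) ne r(3)] by blast
  note st = unit_geodesic_start[OF K g l, unfolded c(2)]
  have rr: "form K r r = K" using st(1) surface_iff[OF K] by blast
  have r': "r' = cosK K l *\<^sub>R r + sinK K l *\<^sub>R v 0" and vl: "v l = (- K * sinK K l) *\<^sub>R r + cosK K l *\<^sub>R v 0"
    using unit_geodesic_eq[OF K g l, of l] l c by auto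
  define M where "M = cross3 r (v 0)"
  have vM: "vel K r M = v 0" using vel_cross3[OF K rr st(2)] by (simp add: M_def)
  have MM: "form K M M = 1"
    using form_vel_vel[OF K rr, of M M] st(3) vM by (simp add: M_def dot_cross_self)
  have G: "cross3 r r' = sinK K l *\<^sub>R M"
    by (simp add: r' M_def cross_add_right cross_mult_right)
  have "cross3 r r' \<noteq> 0" using z(4) by auto
  then obtain \<mu> where \<mu>: "z = \<mu> *\<^sub>R cross3 r r'" using orthogonal_to_both z(1,2) by blast
  have "0 < \<mu>" using z(4) \<open>cross3 r r' \<noteq> 0\<close> using inner_ge_zero[of "cross3 r r'"]
    by (auto simp: \<mu> zero_less_mult_iff not_less[symmetric] simp del: inner_ge_zero)
  then have pos: "0 < \<mu> * sinK K l" using S[of l] l by simp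
  have zM: "z = (\<mu> * sinK K l) *\<^sub>R M" by (simp add: \<mu> G)
  then have "(\<mu> * sinK K l)\<^sup>2 = 1" using z(3) MM by (simp add: form_simps power2_eq_square)
  then have "\<mu> * sinK K l = 1" using pos by (simp add: power2_eq_1_iff)
  then have "z = M" using zM by simp
  moreover have "vel K r' M = v l"
    unfolding vl M_def r' by (rule geodesic_vel[OF K rr st(2,3)])
  moreover have "\<Phi> (c 0, v 0) = \<Phi> (c l, v l)"
    by (intro inv billiard_orbit.flight l g c)
  ultimately show ?thesis using vM c by simp
qed

text \<open>The two orientations differ by exchanging \<open>r\<close> and \<open>r'\<close>; the
  missing point \<open>q\<close> excludes antipodal points, for which the connecting line is not
  determined.\<close>

lemma flight_invariant:
  assumes K: "K = 1 \<or> K = -1" and cv: "convex_domain K \<Omega>" and q: "q \<in> surface K" "q \<notin> \<Omega>"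
    and inv: "\<And>s s'. billiard_orbit K \<Omega> s s' \<Longrightarrow> \<Phi> s = \<Phi> s'"
    and r: "r \<in> \<Omega>" "r' \<in> \<Omega>" and z: "z \<bullet> r = 0" "z \<bullet> r' = 0" "form K z z = 1"
  shows "\<Phi> (r, vel K r z) = \<Phi> (r', vel K r' z)"
proof (cases "r = r'")
  case False
  have anti: "r \<noteq> - r'" "r' \<noteq> - r" using no_antipodal_pair[OF K cv q] r by (metis minus_minus)+
  have rr: "form K r r = K" "form K r' r' = K"
    using r convex_domain_subset[OF cv] surface_iff[OF K] by blast+
  have nz: "cross3 r' r \<noteq> 0"
  proof
    assume "cross3 r' r = 0"
    moreover have "r \<noteq> 0" using rr K by (auto simp: form_simps)
    ultimately obtain c where c: "r' = c *\<^sub>R r" using cross3_eq_0_imp_parallel by blast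
    then have "c\<^sup>2 = 1" using rr K by (auto simp: form_simps power2_eq_square)
    then show False using c False anti by (auto simp: power2_eq_1_iff)
  qed
  obtain \<mu> where \<mu>: "z = \<mu> *\<^sub>R cross3 r' r" using orthogonal_to_both[OF nz] z by blast
  have "z \<bullet> cross3 r' r \<noteq> 0" using \<mu> nz z(3) by (auto simp: form_simps)
  moreover have "z \<bullet> cross3 r r' = - (z \<bullet> cross3 r' r)" using cross_skew[of r r'] by simp
  ultimately consider "0 < z \<bullet> cross3 r r'" | "0 < z \<bullet> cross3 r' r" by linarith
  then show ?thesis
  proof cases
    case 1
    show ?thesis by (rule flight_invariant_oriented[where \<Phi> = \<Phi>, OF K cv _ r anti(1) z 1]) (rule inv)
  next
    case 2
    show ?thesis
      by (rule flight_invariant_oriented[where \<Phi> = \<Phi>, OF K cv _ r(2,1) anti(2) z(2,1,3) 2, symmetric]) (rule inv)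
  qed
qed simp

text \<open>Under central projection the geodesic becomes the straight line
  \<open>q + t *\<^sub>R w\<close> with \<open>t = sinK K u / cosK K u\<close>, which is small for
  small \<open>u\<close>.\<close>

lemma geodesic_enters:
  assumes K: "K = 1 \<or> K = -1" and \<Omega>: "\<Omega> \<subseteq> surface K" and q: "q \<in> surface K"
    and w: "form K q w = 0" "form K w w = 1" and \<delta>: "0 < \<delta>" "\<And>t. 0 < t \<Longrightarrow> t < \<delta> \<Longrightarrow> q + t *\<^sub>R w \<in> cone_of \<Omega>"
  shows "\<exists>T>0. \<forall>u. 0 < u \<longrightarrow> u < T \<longrightarrow> cosK K u *\<^sub>R q + sinK K u *\<^sub>R w \<in> \<Omega>"
proof -
  have cc: "continuous_on UNIV (cosK K)" "continuous_on UNIV (sinK K)"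
    using continuous_on_cosK[of UNIV "\<lambda>x. x" K] continuous_on_sinK[of UNIV "\<lambda>x. x" K] by simp_all
  have cos0: "(cosK K \<longlongrightarrow> 1) (at_right 0)" and sin0: "(sinK K \<longlongrightarrow> 0) (at_right 0)"
    using continuous_on_tendsto_compose[OF cc(1) tendsto_ident_at, of 0 "{0<..}"]
      continuous_on_tendsto_compose[OF cc(2) tendsto_ident_at, of 0 "{0<..}"] by simp_all
  have quot: "((\<lambda>u. sinK K u / cosK K u) \<longlongrightarrow> 0 / 1) (at_right 0)"
    by (intro tendsto_divide cos0 sin0) simp
  have ev1: "eventually (\<lambda>u. 0 < cosK K u) (at_right 0)" by (rule order_tendstoD(1)[OF cos0]) simp
  have ev2: "eventually (\<lambda>u. sinK K u / cosK K u < \<delta>) (at_right 0)" by (rule order_tendstoD(2)[OF quot]) (use \<delta> in simp)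
  have ev3: "eventually (\<lambda>u. 0 < sinK K u) (at_right 0)"
    unfolding eventually_at_right_field
    by (rule exI[of _ 1]) (use pi_gt3 in \<open>auto simp: sinK_def intro!: sin_gt_zero\<close>)
  from eventually_conj[OF ev1 eventually_conj[OF ev2 ev3]]
  obtain T where T: "0 < T" "\<And>u. 0 < u \<Longrightarrow> u < T \<Longrightarrow> 0 < cosK K u \<and> sinK K u / cosK K u < \<delta> \<and> 0 < sinK K u"
    unfolding eventually_at_right_field by auto
  have "cosK K u *\<^sub>R q + sinK K u *\<^sub>R w \<in> \<Omega>" if u: "0 < u" "u < T" for u
  proof -
    from T(2)[OF u] have C: "0 < cosK K u" "sinK K u / cosK K u < \<delta>" "0 < sinK K u" by auto
    then have "cosK K u *\<^sub>R (q + (sinK K u / cosK K u) *\<^sub>R w) \<in> cone_of \<Omega>"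
      by (intro cone_of_scaleR \<delta>) auto
    then have "cosK K u *\<^sub>R q + sinK K u *\<^sub>R w \<in> cone_of \<Omega>" using C(1) by (simp add: scaleR_add_right)
    moreover have "form K (cosK K u *\<^sub>R q + sinK K u *\<^sub>R w) (cosK K u *\<^sub>R q + sinK K u *\<^sub>R w) = K"
      using geodesic_point_in_surface[OF K q w] surface_iff[OF K] by blast
    ultimately show ?thesis by (rule cone_of_Int_surface[OF K \<Omega>])
  qed
  with T(1) show ?thesis by blast
qed

text \<open>Here \<open>z2\<close> is the incoming and \<open>z1\<close> the outgoing momentum. The
  isometry \<open>vel\<close> sends \<open>cross3 (\<gamma> s) g\<close> to \<open>g\<close>, so the
  mirror conditions say that the normal component of the velocity changes sign and the tangential
  one is kept.\<close>

lemma bounce_invariant_oriented: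
  assumes K: "K = 1 \<or> K = -1" and cv: "convex_domain K \<Omega>"
    and inv: "\<And>s s'. billiard_orbit K \<Omega> s s' \<Longrightarrow> \<Phi> s = \<Phi> s'"
    and arc: "smooth_boundary_arc K \<Omega> a b \<gamma>" and s: "s \<in> {a<..<b}"
    and q: "\<gamma> s \<in> surface K" and g: "vector_derivative \<gamma> (at s) = g" "form K (\<gamma> s) g = 0"
    and in1: "0 < \<delta>1" "\<And>t. 0 < t \<Longrightarrow> t < \<delta>1 \<Longrightarrow> \<gamma> s + t *\<^sub>R vel K (\<gamma> s) z1 \<in> cone_of \<Omega>"
    and in2: "0 < \<delta>2" "\<And>t. 0 < t \<Longrightarrow> t < \<delta>2 \<Longrightarrow> \<gamma> s + t *\<^sub>R - vel K (\<gamma> s) z2 \<in> cone_of \<Omega>"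
    and z: "z1 \<bullet> \<gamma> s = 0" "z2 \<bullet> \<gamma> s = 0" "form K z1 z1 = 1" "form K z2 z2 = 1"
    and mirror: "z1 + z2 = \<mu> *\<^sub>R cross3 (\<gamma> s) g" "form K (z1 - z2) (cross3 (\<gamma> s) g) = 0"
  shows "\<exists>r1\<in>\<Omega>. \<exists>r2\<in>\<Omega>. z1 \<bullet> r1 = 0 \<and> z2 \<bullet> r2 = 0 \<and> \<Phi> (r1, vel K r1 z1) = \<Phi> (r2, vel K r2 z2)"
proof -
  define p where "p = \<gamma> s"
  define w where "w = vel K p z1"
  define v where "v = vel K p z2"
  have pS: "p \<in> surface K" using q by (simp add: p_def)
  then have pp: "form K p p = K" using surface_iff[OF K] by blast
  note zp = z[folded p_def]
  have w: "form K p w = 0" "form K w w = 1" "cross3 p w = z1"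
    using form_vel[OF K] form_vel_vel[OF K pp zp(1), of z1] zp(3) cross3_vel[OF K pp zp(1)] by (simp_all add: w_def)
  have v: "form K p v = 0" "form K v v = 1" "cross3 p v = z2"
    using form_vel[OF K] form_vel_vel[OF K pp zp(2), of z2] zp(4) cross3_vel[OF K pp zp(2)] by (simp_all add: v_def)
  have sub: "\<Omega> \<subseteq> surface K" by (rule convex_domain_subset[OF cv])
  obtain T1 where T1: "0 < T1" "\<And>u. 0 < u \<Longrightarrow> u < T1 \<Longrightarrow> cosK K u *\<^sub>R p + sinK K u *\<^sub>R w \<in> \<Omega>"
    using geodesic_enters[OF K sub pS w(1,2) in1(1)] in1(2) by (auto simp: p_def w_def)
  obtain T2 where T2: "0 < T2" "\<And>u. 0 < u \<Longrightarrow> u < T2 \<Longrightarrow> cosK K u *\<^sub>R p + sinK K u *\<^sub>R - v \<in> \<Omega>"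
    using geodesic_enters[OF K sub pS _ _ in2(1), of "- v"] in2(2) v(1,2) by (auto simp: p_def v_def form_simps)
  \<comment> \<open>Half of the time for which the geodesic is known to stay inside, so that the far
    end lies in the domain.\<close>
  define A where "A = T2 / 2"
  define B where "B = T1 / 2"
  have AB: "0 < A" "A < T2" "0 < B" "B < T1" using T1 T2 by (auto simp: A_def B_def)
  define c where "c t = cosK K (t + - A) *\<^sub>R p + sinK K (t + - A) *\<^sub>R v" for t
  define cv where "cv t = (- K * sinK K (t + - A)) *\<^sub>R p + cosK K (t + - A) *\<^sub>R v" for t
  define d where "d t = cosK K (t + 0) *\<^sub>R p + sinK K (t + 0) *\<^sub>R w" for t
  define dv where "dv t = (- K * sinK K (t + 0)) *\<^sub>R p + cosK K (t + 0) *\<^sub>R w" for t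
  have cin: "c t \<in> \<Omega>" if "0 \<le> t" "t < A" for t
    using T2(2)[of "A - t"] that AB cosK_minus[of K "A - t"] sinK_minus[of K "A - t"] by (simp add: c_def)
  have din: "d t \<in> \<Omega>" if "0 < t" "t \<le> B" for t
    using T1(2)[of t] that AB by (simp add: d_def)
  have gv: "vel K p (cross3 p g) = g" using vel_cross3[OF K pp] g(2) by (simp add: p_def)
  have "billiard_orbit K \<Omega> (c 0, cv 0) (d B, dv B)"
  proof (rule billiard_orbit.bounce[where a = a and b = b and \<beta> = \<gamma> and s = s])
    show "unit_geodesic K {0..A} c cv" unfolding c_def[abs_def] cv_def[abs_def] by (rule geodesic_line[OF K pS v(1,2)])
    show "unit_geodesic K {0..B} d dv" unfolding d_def[abs_def] dv_def[abs_def] by (rule geodesic_line[OF K pS w(1,2)])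
    show "c A = \<gamma> s" "d 0 = \<gamma> s" by (simp_all add: c_def d_def p_def)
    show "c ` {0..<A} \<subseteq> \<Omega>" "d ` {0<..B} \<subseteq> \<Omega>" using cin din by auto
    have e: "cv A = v" "dv 0 = w" by (simp_all add: cv_def dv_def)
    show "reflects K (\<gamma> s) (vector_derivative \<gamma> (at s)) (cv A) (dv 0)"
      unfolding reflects_def e g(1) p_def[symmetric]
    proof (intro conjI ballI impI)
      show "w \<in> tangent_plane K p" using w(1) by (simp add: tangent_plane_def)
      have "form K w g - form K v g = form K (z1 - z2) (cross3 p g)"
        using form_vel_vel[OF K pp zp(1), of "cross3 p g"] form_vel_vel[OF K pp zp(2), of "cross3 p g"]
        by (simp add: gv w_def v_def form_simps)
      then show "form K w g = form K v g" using mirror(2) by (simp add: p_def)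
      fix \<nu> assume "form K \<nu> g = 0"
      moreover have "w + v = \<mu> *\<^sub>R g"
        using mirror(1) gv by (simp add: w_def v_def vel_linear[symmetric] p_def) (simp add: vel_linear)
      then have "form K w \<nu> + form K v \<nu> = \<mu> * form K g \<nu>" by (simp add: form_simps flip: form_add(1))
      ultimately show "form K w \<nu> = - form K v \<nu>" by (simp add: form_commute[of K g])
    qed
  qed (use AB arc s in auto)
  then have "\<Phi> (c 0, cv 0) = \<Phi> (d B, dv B)" by (rule inv)
  moreover have "vel K (c 0) z2 = cv 0" "z2 \<bullet> c 0 = 0"
    using geodesic_vel[OF K pp v(1,2)] by (simp_all add: c_def cv_def v(3) del: cosK_minus sinK_minus)
  moreover have "vel K (d B) z1 = dv B" "z1 \<bullet> d B = 0"
    using geodesic_vel[OF K pp w(1,2)] by (simp_all add: d_def dv_def w(3))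
  ultimately show ?thesis using cin[of 0] din[of B] AB by (metis order.refl)
qed

text \<open>The normal components of the two velocities are opposite and nonzero, so exactly one of
  \<open>z1\<close> and \<open>z2\<close> points inward and serves as outgoing momentum; the claim
  is symmetric in them.\<close>

lemma bounce_invariant:
  assumes K: "K = 1 \<or> K = -1" and cv: "convex_domain K \<Omega>"
    and inv: "\<And>s s'. billiard_orbit K \<Omega> s s' \<Longrightarrow> \<Phi> s = \<Phi> s'"
    and arc: "smooth_boundary_arc K \<Omega> a b \<gamma>" and s: "s \<in> {a<..<b}"
    and g: "(\<gamma> has_vector_derivative g) (at s)" "form K (\<gamma> s) g = 0" "g \<noteq> 0"
    and z: "z1 \<bullet> \<gamma> s = 0" "z2 \<bullet> \<gamma> s = 0" "form K z1 z1 = 1" "form K z2 z2 = 1" "z1 \<noteq> z2"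
    and mirror: "z1 + z2 = \<mu> *\<^sub>R cross3 (\<gamma> s) g" "form K (z1 - z2) (cross3 (\<gamma> s) g) = 0"
  shows "\<exists>r1\<in>\<Omega>. \<exists>r2\<in>\<Omega>. z1 \<bullet> r1 = 0 \<and> z2 \<bullet> r2 = 0 \<and> \<Phi> (r1, vel K r1 z1) = \<Phi> (r2, vel K r2 z2)"
proof -
  have op: "openin (top_of_set (surface K)) \<Omega>" and ne: "\<Omega> \<noteq> {}" using cv by (auto simp: convex_domain_def)
  have bd: "\<gamma> t \<in> boundary K \<Omega>" if "t \<in> {a<..<b}" for t
    using arc that openin_subset by (fastforce simp: smooth_boundary_arc_def)
  note bp = boundary_point[OF op bd]
  have pS: "\<gamma> s \<in> surface K" using bp(1)[OF s] .
  then have pp: "form K (\<gamma> s) (\<gamma> s) = K" using surface_iff[OF K] by blast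
  define G where "G = cross3 (\<gamma> s) g"
  have vG: "vel K (\<gamma> s) G = g" using vel_cross3[OF K pp g(2)] by (simp add: G_def)
  have G0: "G \<noteq> 0" using vG g(3) by (auto simp: vel_def)
  have "closure \<Omega> \<subseteq> closure (cone_of \<Omega>)" by (intro closure_mono subset_cone_of)
  then have cl: "\<gamma> t \<in> closure (cone_of \<Omega>)" if "t \<in> {a<..<b}" for t using bp(3)[OF that] by blast
  have add: "x + y \<in> cone_of \<Omega>" if "x \<in> cone_of \<Omega>" "y \<in> cone_of \<Omega>" for x y
    by (rule cone_of_add[OF K cv bp(1,2)[OF s] that])
  obtain \<sigma> where \<sigma>: "\<sigma> \<noteq> 0" "\<And>w. 0 < \<sigma> * (G \<bullet> w) \<Longrightarrow> \<exists>\<delta>>0. \<forall>t. 0 < t \<longrightarrow> t < \<delta> \<longrightarrow> \<gamma> s + t *\<^sub>R w \<in> cone_of \<Omega>"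
    using inward_half_space[OF open_cone_of[OF K op] add cone_of_scaleR _ g(1) cl s] ne G0 subset_cone_of
    unfolding G_def by blast
  define w where "w = vel K (\<gamma> s) z1"
  define v where "v = vel K (\<gamma> s) z2"
  have wv: "w + v = \<mu> *\<^sub>R g"
    using mirror(1) vG by (simp add: w_def v_def vel_linear[symmetric]) (simp add: vel_linear G_def)
  have "G \<bullet> g = 0" by (simp add: G_def dot_cross_self)
  then have sum0: "G \<bullet> w + G \<bullet> v = 0" using wv by (simp flip: inner_add_right)
  \<comment> \<open>A tangential \<open>w\<close> makes both momenta multiples of \<open>G\<close>;
    the mirror conditions then give \<open>z1 = z2\<close>.\<close>
  have nz: "G \<bullet> w \<noteq> 0"
  proof
    assume "G \<bullet> w = 0"
    then have "w \<bullet> cross3 (\<gamma> s) g = 0" by (simp add: G_def inner_commute)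
    then obtain \<alpha> \<beta> where ab: "w = \<alpha> *\<^sub>R \<gamma> s + \<beta> *\<^sub>R g" using cross3_decompose[of "\<gamma> s" g w] G0 G_def by metis
    have "form K (\<gamma> s) w = 0" by (simp add: w_def form_vel[OF K])
    then have "\<alpha> = 0" using ab pp g(2) K by (auto simp: form_simps)
    have "z1 = cross3 (\<gamma> s) w" using cross3_vel[OF K pp z(1)] by (simp add: w_def)
    then have z1: "z1 = \<beta> *\<^sub>R G" using ab \<open>\<alpha> = 0\<close> by (simp add: G_def cross_mult_right)
    then have z2: "z2 = (\<mu> - \<beta>) *\<^sub>R G" using mirror(1) by (simp add: G_def algebra_simps)
    have "z1 - z2 = (2 * \<beta> - \<mu>) *\<^sub>R G" unfolding z1 z2 by (simp flip: scaleR_diff_left)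
    then have "(2 * \<beta> - \<mu>) * form K G G = 0" using mirror(2) by (simp add: form_simps G_def)
    moreover have "0 < form K G G"
      by (rule form_line_pos[OF K pp _ G0]) (simp add: G_def dot_cross_self)
    ultimately have "z1 - z2 = 0" using \<open>z1 - z2 = _\<close> by simp
    with z(5) show False by simp
  qed
  have vd: "vector_derivative \<gamma> (at s) = g" using g(1) by (rule vector_derivative_at)
  show ?thesis
  proof (cases "0 < \<sigma> * (G \<bullet> w)")
    case True
    then have "0 < \<sigma> * (G \<bullet> - v)" using sum0 by (simp add: eq_neg_iff_add_eq_0[symmetric])
    with True \<sigma>(2) obtain \<delta>1 \<delta>2 where d: "0 < \<delta>1" "\<forall>t. 0 < t \<longrightarrow> t < \<delta>1 \<longrightarrow> \<gamma> s + t *\<^sub>R w \<in> cone_of \<Omega>"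
      "0 < \<delta>2" "\<forall>t. 0 < t \<longrightarrow> t < \<delta>2 \<longrightarrow> \<gamma> s + t *\<^sub>R - v \<in> cone_of \<Omega>" by meson
    show ?thesis
      by (rule bounce_invariant_oriented[where \<Phi> = \<Phi>, OF K cv inv arc s pS vd g(2) d(1) _ d(3) _ z(1-4) mirror])
        (use d in \<open>auto simp: w_def v_def\<close>)
  next
    case False
    then have "\<sigma> * (G \<bullet> w) < 0" using nz \<sigma>(1) by (simp add: not_less less_le)
    then have "0 < \<sigma> * (G \<bullet> v)" "0 < \<sigma> * (G \<bullet> - w)" using sum0 by (simp_all add: eq_neg_iff_add_eq_0[symmetric] add.commute)
    with \<sigma>(2) obtain \<delta>1 \<delta>2 where d: "0 < \<delta>1" "\<forall>t. 0 < t \<longrightarrow> t < \<delta>1 \<longrightarrow> \<gamma> s + t *\<^sub>R v \<in> cone_of \<Omega>"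
      "0 < \<delta>2" "\<forall>t. 0 < t \<longrightarrow> t < \<delta>2 \<longrightarrow> \<gamma> s + t *\<^sub>R - w \<in> cone_of \<Omega>" by meson
    have m: "z2 + z1 = \<mu> *\<^sub>R cross3 (\<gamma> s) g" "form K (z2 - z1) (cross3 (\<gamma> s) g) = 0"
      using mirror by (simp_all add: form_simps add.commute)
    have "\<exists>r1\<in>\<Omega>. \<exists>r2\<in>\<Omega>. z2 \<bullet> r1 = 0 \<and> z1 \<bullet> r2 = 0 \<and> \<Phi> (r1, vel K r1 z2) = \<Phi> (r2, vel K r2 z1)"
      by (rule bounce_invariant_oriented[where \<Phi> = \<Phi>, OF K cv inv arc s pS vd g(2) d(1) _ d(3) _ z(2,1,4,3) m])
        (use d in \<open>auto simp: w_def v_def\<close>)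
    then show ?thesis by metis
  qed
qed

section \<open>The integral as a form in the angular momentum\<close>

text \<open>Averaging over \<open>u\<close> and \<open>- u\<close> removes the terms of odd degree
  from an even \<open>f\<close>. The others become homogeneous of degree \<open>2 * n\<close> by
  integral powers of \<open>form K z z\<close>, without a square root.\<close>

lemma even_part_form:
  fixes K :: real and d :: "'i \<Rightarrow> nat" and n :: nat
  assumes I: "finite I" "\<And>i. i \<in> I \<Longrightarrow> form_fun (d i) (q i)" "\<And>i. i \<in> I \<Longrightarrow> d i \<le> 2 * n"
  defines "H \<equiv> \<lambda>z. \<Sum>i\<in>{i\<in>I. even (d i)}. of_real (form K z z) ^ (n - d i div 2) * q i z"
  shows "form_fun (2 * n) H"
    and "0 < form K z z \<Longrightarrow> u = (1 / sqrt (form K z z)) *\<^sub>R z \<Longrightarrow> f u = (\<Sum>i\<in>I. q i u) \<Longrightarrow>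
      f (- u) = (\<Sum>i\<in>I. q i (- u)) \<Longrightarrow> f (- u) = f u \<Longrightarrow> of_real (form K z z) ^ n * f u = H z"
proof -
  show "form_fun (2 * n) H"
    unfolding H_def
  proof (rule form_fun_sum)
    fix i assume i: "i \<in> {i\<in>I. even (d i)}"
    then have "(n - d i div 2) * 2 + d i = 2 * n" using I(3)[of i] by (auto elim!: evenE)
    with form_fun_mult[OF form_fun_power[OF form_fun_quadratic, of "n - d i div 2" K] I(2)[of i]] i
    show "form_fun (2 * n) (\<lambda>z. of_real (form K z z) ^ (n - d i div 2) * q i z)" by simp
  qed
  assume L: "0 < form K z z" and u: "u = (1 / sqrt (form K z z)) *\<^sub>R z"
    and f: "f u = (\<Sum>i\<in>I. q i u)" "f (- u) = (\<Sum>i\<in>I. q i (- u))" "f (- u) = f u"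
  define l where "l = sqrt (form K z z)"
  have l: "0 < l" "form K z z = l\<^sup>2" using L by (simp_all add: l_def)
  have z: "z = l *\<^sub>R u" using l by (simp add: u l_def[symmetric])
  have neg: "q i (- u) = (-1) ^ d i * q i u" if "i \<in> I" for i
    using form_fun_scaleR[OF I(2)[OF that], of "-1" u] by simp
  have "2 * f u = (\<Sum>i\<in>I. q i u + (-1) ^ d i * q i u)"
    using f neg by (simp add: sum.distrib)
  also have "\<dots> = (\<Sum>i\<in>I. if even (d i) then 2 * q i u else 0)"
    by (intro sum.cong) auto
  also have "\<dots> = (\<Sum>i\<in>{i\<in>I. even (d i)}. 2 * q i u)"
    using I(1) by (simp add: sum.inter_filter)
  finally have fu: "f u = (\<Sum>i\<in>{i\<in>I. even (d i)}. q i u)" by (simp flip: sum_distrib_left)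
  show "of_real (form K z z) ^ n * f u = H z"
    unfolding fu H_def sum_distrib_left
  proof (rule sum.cong[OF refl])
    fix i assume i: "i \<in> {i\<in>I. even (d i)}"
    then obtain e where e: "d i = 2 * e" by (auto elim: evenE)
    with i I(3)[of i] have "e \<le> n" by auto
    then have "(of_real l :: complex) ^ (2 * n) = of_real l ^ (2 * (n - e)) * of_real l ^ (2 * e)"
      using \<open>e \<le> n\<close> by (simp only: power_add[symmetric] diff_mult_distrib2 le_add_diff_inverse2 mult_le_mono2)
    moreover have "q i z = of_real l ^ (2 * e) * q i u"
      using form_fun_scaleR[OF I(2)[of i], of l u] i e z by auto
    ultimately show "of_real (form K z z) ^ n * q i u = of_real (form K z z) ^ (n - d i div 2) * q i z"
      by (simp add: l(2) e power_mult)
  qed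
qed

lemma form_fun_vel: "form_fun 1 (\<lambda>z. of_real (vel K r z $ i))"
proof -
  have "\<exists>m. \<forall>z. vel K r z $ i = m \<bullet> z"
  proof -
    consider "i = 1" | "i = 2" | "i = 3" using exhaust_3 by blast
    then show ?thesis
    proof cases
      case 1 then show ?thesis
        by (intro exI[of _ "vector [0, r$3, - K * r$2]"]) (simp add: coords algebra_simps)
    next
      case 2 then show ?thesis
        by (intro exI[of _ "vector [- r$3, 0, K * r$1]"]) (simp add: coords algebra_simps)
    next
      case 3 then show ?thesis
        by (intro exI[of _ "vector [K * r$2, - K * r$1, 0]"]) (simp add: coords algebra_simps)
    qed
  qed
  then obtain m where "\<And>z. vel K r z $ i = m \<bullet> z" by blast
  then show ?thesis using form_fun_linear[of m] by simp
qed

text \<open>\<open>vel K r\<close> is linear, so velocity monomials are forms in the angular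
  momentum; these forms still depend on \<open>r\<close>.\<close>

lemma velocity_polynomial_forms:
  assumes K: "K = 1 \<or> K = -1" and vp: "velocity_polynomial K \<Omega> n \<Phi>" and sub: "\<Omega> \<subseteq> surface K"
  obtains I :: "(nat \<times> nat \<times> nat) set" and d and q where "finite I" "\<And>i. i \<in> I \<Longrightarrow> d i \<le> n"
    "\<And>r i. i \<in> I \<Longrightarrow> form_fun (d i) (q r i)"
    "\<And>r z. r \<in> \<Omega> \<Longrightarrow> z \<bullet> r = 0 \<Longrightarrow> form K z z = 1 \<Longrightarrow> of_real (\<Phi> (r, vel K r z)) = (\<Sum>i\<in>I. q r i z)"
proof -
  obtain A where A: "\<And>r v. (r, v) \<in> unit_tangent_bundle K \<Omega> \<Longrightarrow>
     \<Phi> (r, v) = (\<Sum>(i, j, k) \<in> {(i, j, k). i + j + k \<le> n}. A (i, j, k) r * (v$1)^i * (v$2)^j * (v$3)^k)"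
    using vp unfolding velocity_polynomial_def by blast
  define I where "I = {(i::nat, j::nat, k::nat). i + j + k \<le> n}"
  define d where "d = (\<lambda>(i::nat, j::nat, k::nat). i + j + k)"
  define q where "q = (\<lambda>r (i, j, k) z. of_real (A (i, j, k) r) *
    (of_real (vel K r z $ 1) ^ i * (of_real (vel K r z $ 2) ^ j * of_real (vel K r z $ 3) ^ k)) :: complex)"
  show ?thesis
  proof (rule that[of I d q])
    have "I \<subseteq> {..n} \<times> {..n} \<times> {..n}" by (auto simp: I_def)
    then show "finite I" by (rule finite_subset) simp
    show "d i \<le> n" if "i \<in> I" for i using that by (auto simp: I_def d_def)
    show "form_fun (d i) (q r i)" for r i
    proof -
      obtain a b c where i: "i = (a, b, c)" by (metis prod_cases3)
      have "form_fun (a * 1 + (b * 1 + c * 1)) (\<lambda>z. of_real (A (a, b, c) r) *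
        (of_real (vel K r z $ 1) ^ a * (of_real (vel K r z $ 2) ^ b * of_real (vel K r z $ 3) ^ c)))"
        by (intro form_fun_cmult form_fun_mult form_fun_power form_fun_vel)
      then show ?thesis by (simp add: i d_def q_def add.assoc)
    qed
    fix r z assume r: "r \<in> \<Omega>" "z \<bullet> r = 0" "form K z z = 1"
    then have "form K r r = K" using sub surface_iff[OF K] by blast
    then have "(r, vel K r z) \<in> unit_tangent_bundle K \<Omega>"
      using r form_vel[OF K] form_vel_vel[OF K _ r(2), of z] by (simp add: unit_tangent_bundle_def tangent_plane_def)
    from A[OF this] show "of_real (\<Phi> (r, vel K r z)) = (\<Sum>i\<in>I. q r i z)"
      by (simp add: I_def q_def case_prod_unfold mult.assoc)
  qed
qed

text \<open>The difference \<open>f u - f (- u)\<close> changes sign along a path of unit vectors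
  from \<open>z\<close> to \<open>- z\<close> in the plane orthogonal to \<open>r\<close>.\<close>

lemma odd_function_zero_on_line_pencil:
  assumes K: "K = 1 \<or> K = -1" and r: "form K r r = K" and z: "z \<bullet> r = 0" "form K z z = 1"
    and q: "finite I" "\<And>i. i \<in> I \<Longrightarrow> form_fun (d i) (q i)"
    and f: "\<And>z. z \<bullet> r = 0 \<Longrightarrow> form K z z = 1 \<Longrightarrow> of_real (f z) = (\<Sum>i\<in>I. q i z)"
  obtains z' where "z' \<bullet> r = 0" "form K z' z' = 1" "f z' = f (- z')"
proof -
  define y where "y = cross3 r z"
  \<comment> \<open>A parabolic path from \<open>z\<close> to \<open>- z\<close> that never meets
    the origin, to be normalized afterwards; it serves for both values of \<open>K\<close>.\<close>
  define P where "P t = (1 - 2 * t) *\<^sub>R z + (t * (1 - t)) *\<^sub>R y" for t :: real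
  have zy: "cross3 z y = (z \<bullet> z) *\<^sub>R r" if "z \<bullet> r = 0" 
  proof -
    have "cross3 z y = (z \<bullet> z) *\<^sub>R r - (z \<bullet> r) *\<^sub>R z" by (simp add: y_def coords algebra_simps)
    with that show ?thesis by simp
  qed
  have z0: "z \<noteq> 0" and r0: "r \<noteq> 0" using z(2) r K by (auto simp: form_simps)
  have Pr: "P t \<bullet> r = 0" for t using z(1) by (simp add: P_def y_def inner_add_left dot_cross_self)
  have P0: "P t \<noteq> 0" for t
  proof
    assume P: "P t = 0"
    have "cross3 z (P t) = (t * (1 - t) * (z \<bullet> z)) *\<^sub>R r"
      using zy[OF z(1)] by (simp add: P_def cross_add_right cross_mult_right)
    with P z0 r0 have "t = 0 \<or> t = 1" by auto
    with P z0 show False by (auto simp: P_def)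
  qed
  have pos: "0 < form K (P t) (P t)" for t by (rule form_line_pos[OF K r Pr P0])
  define u where "u t = (1 / sqrt (form K (P t) (P t))) *\<^sub>R P t" for t
  have ur: "u t \<bullet> r = 0" for t by (simp add: u_def Pr)
  have uu: "form K (u t) (u t) = 1" for t
    using pos[of t] by (simp add: u_def form_simps flip: power2_eq_square) 
  have cP: "continuous_on {0..1} P" unfolding P_def by (intro continuous_intros)
  have "continuous_on {0..1} (\<lambda>t. form K (P t) (P t))"
    unfolding form_def by (intro continuous_intros cP)
  then have cu: "continuous_on {0..1} u"
    unfolding u_def using pos by (intro continuous_intros cP) (auto simp: less_imp_neq[symmetric])
  have cf: "continuous_on {0..1} (\<lambda>t. f (s *\<^sub>R u t))" if s: "s = 1 \<or> s = -1" for s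
  proof -
    have "f (s *\<^sub>R u t) = Re (\<Sum>i\<in>I. q i (s *\<^sub>R u t))" for t
    proof -
      have "of_real (f (s *\<^sub>R u t)) = (\<Sum>i\<in>I. q i (s *\<^sub>R u t))"
        by (rule f) (use s in \<open>auto simp: ur uu form_simps\<close>)
      then show ?thesis by (metis Re_complex_of_real)
    qed
    moreover have "continuous_on {0..1} (\<lambda>t. Re (\<Sum>i\<in>I. q i (s *\<^sub>R u t)))"
    proof (intro continuous_intros)
      fix i assume "i \<in> I"
      from form_fun_continuous[OF q(2)[OF this], of UNIV]
      show "continuous_on {0..1} (\<lambda>t. q i (s *\<^sub>R u t))"
        by (rule continuous_on_compose2) (auto intro!: continuous_intros cu)
    qed
    ultimately show ?thesis by simp
  qed
  define h where "h t = f (u t) - f (- u t)" for t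
  have co: "continuous_on {0..1} h"
    unfolding h_def[abs_def] using cf[of 1] cf[of "-1"] by (auto intro!: continuous_intros)
  have "u 0 = z" "u 1 = - z" by (simp_all add: u_def P_def z(2) form_simps)
  then have o01: "h 1 = - h 0" by (simp add: h_def)
  have "\<exists>t. 0 \<le> t \<and> t \<le> 1 \<and> h t = 0"
  proof (cases "h 0 \<le> 0")
    case True then show ?thesis using IVT'[of h 0 0 1] o01 co by auto
  next
    case False then show ?thesis using IVT2'[of h 1 0 0] o01 co by auto
  qed
  then obtain t where "h t = 0" by blast
  then show ?thesis using that[of "u t"] ur uu by (simp add: h_def)
qed

text \<open>On the plane orthogonal to \<open>r\<close> the homogeneous extension \<open>h\<close>
  of \<open>f\<close> is a form, but one that varies with \<open>r\<close>;
  \<open>forms_on_planes\<close> glues these into a single form.\<close>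

lemma even_line_function_form:
  fixes f :: "real^3 \<Rightarrow> complex"
  assumes K: "K = 1 \<or> K = -1" and op: "openin (top_of_set (surface K)) \<Omega>" and ne: "\<Omega> \<noteq> {}"
    and J: "finite J" "\<And>r i. i \<in> J \<Longrightarrow> form_fun (e i) (p r i)" "\<And>i. i \<in> J \<Longrightarrow> e i \<le> 2 * n"
    and f: "\<And>r z. r \<in> \<Omega> \<Longrightarrow> z \<bullet> r = 0 \<Longrightarrow> form K z z = 1 \<Longrightarrow> f z = (\<Sum>i\<in>J. p r i z)"
    and even: "\<And>z. f (- z) = f z"
  shows "\<exists>\<Psi>. homogeneous (2 * n) \<Psi> \<and>
    (\<forall>r\<in>\<Omega>. \<forall>z. z \<bullet> r = 0 \<longrightarrow> form K z z = 1 \<longrightarrow> eval3 \<Psi> (complexify z) = f z)"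
proof -
  have rr: "form K r r = K" if "r \<in> \<Omega>" for r
    using openin_subset[OF op] that surface_iff[OF K, of r] by auto
  define h where "h z = of_real (form K z z) ^ n * f ((1 / sqrt (form K z z)) *\<^sub>R z)" for z
  have "\<exists>\<Psi>. form_fun (2 * n) \<Psi> \<and> (\<forall>r\<in>cone_of \<Omega>. \<forall>z. z \<noteq> 0 \<longrightarrow> z \<bullet> r = 0 \<longrightarrow> h z = \<Psi> z)"
  proof (rule forms_on_planes[OF open_cone_of[OF K op]])
    show "cone_of \<Omega> \<noteq> {}" using ne subset_cone_of by blast
    fix r' assume "r' \<in> cone_of \<Omega>"
    then obtain t r where t: "0 < t" "r \<in> \<Omega>" "r' = t *\<^sub>R r" by (rule cone_ofE)
    let ?H = "\<lambda>z. \<Sum>i\<in>{i\<in>J. even (e i)}. of_real (form K z z) ^ (n - e i div 2) * p r i z"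
    show "\<exists>p. form_fun (2 * n) p \<and> (\<forall>z. z \<noteq> 0 \<longrightarrow> z \<bullet> r' = 0 \<longrightarrow> h z = p z)"
    proof (intro exI[of _ ?H] conjI allI impI)
      show "form_fun (2 * n) ?H" by (rule even_part_form(1)[OF J(1) J(2) J(3)])
      fix z assume z: "z \<noteq> 0" "z \<bullet> r' = 0"
      then have zr: "z \<bullet> r = 0" using t by simp
      have L: "0 < form K z z" by (rule form_line_pos[OF K rr[OF t(2)] zr z(1)])
      define u where "u = (1 / sqrt (form K z z)) *\<^sub>R z"
      have u: "u \<bullet> r = 0" "form K u u = 1" using zr L by (simp_all add: u_def form_simps flip: power2_eq_square)
      show "h z = ?H z"
        unfolding h_def u_def[symmetric]
        by (rule even_part_form(2)[OF J(1) J(2) J(3) L u_def])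
          (use f[OF t(2), of u] f[OF t(2), of "- u"] u even in \<open>auto simp: form_simps\<close>)
    qed
  qed
  then obtain \<Psi> where \<Psi>: "form_fun (2 * n) \<Psi>" "\<And>r z. r \<in> cone_of \<Omega> \<Longrightarrow> z \<noteq> 0 \<Longrightarrow> z \<bullet> r = 0 \<Longrightarrow> h z = \<Psi> z"
    by blast
  obtain P where P: "homogeneous (2 * n) P" "\<And>x. eval3 P (complexify x) = \<Psi> x"
    using form_fun_imp_poly3[OF \<Psi>(1)] by blast
  have "eval3 P (complexify z) = f z" if "r \<in> \<Omega>" "z \<bullet> r = 0" "form K z z = 1" for r z
  proof -
    have "z \<noteq> 0" using that(3) by (auto simp: form_simps)
    then have "h z = \<Psi> z" using \<Psi>(2)[of r z] that subset_cone_of by blast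
    then show ?thesis using P(2) that(3) by (simp add: h_def)
  qed
  with P(1) show ?thesis by blast
qed

text \<open>
  The integral, as a function of the unit angular momentum, splits into an even and an odd part;
  twice the even part and the square of twice the odd part both extend to forms of even degree,
  and at least one of them is not constant.
\<close>

lemma polynomial_integral_form:
  assumes K: "K = 1 \<or> K = -1" and cv: "convex_domain K \<Omega>" and int: "polynomial_integral K \<Omega> n \<Phi>"
    and q0: "q0 \<in> surface K" "q0 \<notin> \<Omega>"
  obtains \<Psi> where "homogeneous (2 * n) \<Psi>"
    "\<And>c. \<exists>x. eval3 \<Psi> (complexify x) \<noteq> c * of_real (form K x x) ^ n"
    "\<And>z1 z2 r1 r2. \<lbrakk>r1 \<in> \<Omega>; r2 \<in> \<Omega>; z1 \<bullet> r1 = 0; z2 \<bullet> r2 = 0; form K z1 z1 = 1; form K z2 z2 = 1;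
       \<And>s1 s2. s1 \<in> \<Omega> \<Longrightarrow> s2 \<in> \<Omega> \<Longrightarrow> z1 \<bullet> s1 = 0 \<Longrightarrow> z2 \<bullet> s2 = 0 \<Longrightarrow> \<Phi> (s1, vel K s1 z1) = \<Phi> (s2, vel K s2 z2);
       \<And>s1 s2. s1 \<in> \<Omega> \<Longrightarrow> s2 \<in> \<Omega> \<Longrightarrow> z1 \<bullet> s1 = 0 \<Longrightarrow> z2 \<bullet> s2 = 0 \<Longrightarrow> \<Phi> (s1, vel K s1 (- z1)) = \<Phi> (s2, vel K s2 (- z2))\<rbrakk>
     \<Longrightarrow> eval3 \<Psi> (complexify z1) = eval3 \<Psi> (complexify z2)"
proof -
  have vp: "velocity_polynomial K \<Omega> n \<Phi>" and nc: "\<not> \<Phi> constant_on unit_tangent_bundle K \<Omega>"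
    and inv: "\<And>s s'. billiard_orbit K \<Omega> s s' \<Longrightarrow> \<Phi> s = \<Phi> s'"
    using int by (auto simp: polynomial_integral_def)
  have sub: "\<Omega> \<subseteq> surface K" by (rule convex_domain_subset[OF cv])
  have op: "openin (top_of_set (surface K)) \<Omega>" and ne: "\<Omega> \<noteq> {}" using cv by (auto simp: convex_domain_def)
  have rr: "form K r r = K" if "r \<in> \<Omega>" for r using sub that surface_iff[OF K] by blast
  \<comment> \<open>For unit \<open>z\<close> the choice of \<open>r\<close> is immaterial, because
    any two points of the domain on the line \<open>z\<close> are joined by a flight.\<close>
  define \<phi> where "\<phi> z = (let r = (SOME r. r \<in> \<Omega> \<and> z \<bullet> r = 0) in \<Phi> (r, vel K r z))" for z
  have \<phi>: "\<phi> z = \<Phi> (r, vel K r z)" if "r \<in> \<Omega>" "z \<bullet> r = 0" "form K z z = 1" for r z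
  proof -
    define r' where "r' = (SOME r. r \<in> \<Omega> \<and> z \<bullet> r = 0)"
    have "r' \<in> \<Omega> \<and> z \<bullet> r' = 0" unfolding r'_def by (rule someI[of _ r]) (use that in simp)
    then have "\<Phi> (r', vel K r' z) = \<Phi> (r, vel K r z)"
      by (intro flight_invariant[where \<Phi> = \<Phi>, OF K cv q0]) (use that inv in auto)
    then show ?thesis by (simp add: \<phi>_def r'_def)
  qed
  obtain I :: "(nat \<times> nat \<times> nat) set" and d q where I: "finite I" "\<And>i. i \<in> I \<Longrightarrow> d i \<le> n"
    "\<And>r i. i \<in> I \<Longrightarrow> form_fun (d i) (q r i)"
    and q: "\<And>r z. r \<in> \<Omega> \<Longrightarrow> z \<bullet> r = 0 \<Longrightarrow> form K z z = 1 \<Longrightarrow> of_real (\<Phi> (r, vel K r z)) = (\<Sum>i\<in>I. q r i z)"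
    using velocity_polynomial_forms[OF K vp sub] by metis
  have \<phi>q: "of_real (\<phi> z) = (\<Sum>i\<in>I. q r i z)" if "r \<in> \<Omega>" "z \<bullet> r = 0" "form K z z = 1" for r z
    using \<phi>[OF that] q[OF that] by simp
  have neg: "q r i (- z) = (-1) ^ d i * q r i z" if "i \<in> I" for r i z
    using form_fun_scaleR[OF I(3)[OF that], of r "-1" z] by simp
  define f1 :: "real^3 \<Rightarrow> complex" where "f1 z = of_real (\<phi> z + \<phi> (- z))" for z
  define f2 :: "real^3 \<Rightarrow> complex" where "f2 z = of_real ((\<phi> z - \<phi> (- z))\<^sup>2)" for z
  have "\<exists>\<Psi>. homogeneous (2 * n) \<Psi> \<and> (\<forall>r\<in>\<Omega>. \<forall>z. z \<bullet> r = 0 \<longrightarrow> form K z z = 1 \<longrightarrow> eval3 \<Psi> (complexify z) = f1 z)"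
  proof (rule even_line_function_form[OF K op ne, where J = I and e = d and p = "\<lambda>r i z. (1 + (-1) ^ d i) * q r i z"])
    fix r z assume *: "r \<in> \<Omega>" "z \<bullet> r = 0" "form K z z = 1"
    then have "f1 z = (\<Sum>i\<in>I. q r i z) + (\<Sum>i\<in>I. q r i (- z))"
      using \<phi>q[of r z] \<phi>q[of r "- z"] by (simp add: f1_def form_simps)
    then show "f1 z = (\<Sum>i\<in>I. (1 + (-1) ^ d i) * q r i z)"
      using neg by (simp add: distrib_right sum.distrib)
  next
    show "d i \<le> 2 * n" if "i \<in> I" for i using I(2)[OF that] by simp
  qed (use I in \<open>auto simp: f1_def intro!: form_fun_cmult\<close>)
  then obtain \<Psi>1 where \<Psi>1: "homogeneous (2 * n) \<Psi>1"
    "\<And>r z. r \<in> \<Omega> \<Longrightarrow> z \<bullet> r = 0 \<Longrightarrow> form K z z = 1 \<Longrightarrow> eval3 \<Psi>1 (complexify z) = f1 z" by blast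
  \<comment> \<open>The square of a sum is indexed by pairs; the factors
    \<open>1 - (-1) ^ d i\<close> keep only odd \<open>d i\<close> and \<open>d j\<close>, so all
    surviving degrees \<open>d i + d j\<close> are even.\<close>
  have "\<exists>\<Psi>. homogeneous (2 * n) \<Psi> \<and> (\<forall>r\<in>\<Omega>. \<forall>z. z \<bullet> r = 0 \<longrightarrow> form K z z = 1 \<longrightarrow> eval3 \<Psi> (complexify z) = f2 z)"
  proof (rule even_line_function_form[OF K op ne, where J = "I \<times> I" and e = "\<lambda>(i, j). d i + d j"
        and p = "\<lambda>r (i, j) z. ((1 - (-1) ^ d i) * (1 - (-1) ^ d j)) * (q r i z * q r j z)"])
    fix r z assume *: "r \<in> \<Omega>" "z \<bullet> r = 0" "form K z z = 1"
    then have "f2 z = ((\<Sum>i\<in>I. q r i z) - (\<Sum>i\<in>I. q r i (- z)))\<^sup>2"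
      using \<phi>q[of r z] \<phi>q[of r "- z"] by (simp add: f2_def form_simps)
    also have "(\<Sum>i\<in>I. q r i z) - (\<Sum>i\<in>I. q r i (- z)) = (\<Sum>i\<in>I. (1 - (-1) ^ d i) * q r i z)"
      using neg by (simp add: left_diff_distrib sum_subtractf)
    also have "(\<dots>)\<^sup>2 = (\<Sum>(i, j)\<in>I \<times> I. ((1 - (-1) ^ d i) * (1 - (-1) ^ d j)) * (q r i z * q r j z))"
      unfolding power2_eq_square sum_product sum.cartesian_product by (intro sum.cong) (auto simp: mult_ac)
    finally show "f2 z = (\<Sum>i\<in>I \<times> I. (case i of (i, j) \<Rightarrow> \<lambda>z. ((1 - (-1) ^ d i) * (1 - (-1) ^ d j)) * (q r i z * q r j z)) z)"
      by (simp add: case_prod_unfold)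
  next
    show "form_fun (case i of (i, j) \<Rightarrow> d i + d j)
        (case i of (i, j) \<Rightarrow> \<lambda>z. ((1 - (-1) ^ d i) * (1 - (-1) ^ d j)) * (q r i z * q r j z))" if "i \<in> I \<times> I" for r i
      using that I(3) by (auto intro!: form_fun_cmult form_fun_mult)
    show "(case i of (i, j) \<Rightarrow> d i + d j) \<le> 2 * n" if "i \<in> I \<times> I" for i
      using that I(2) by (auto simp: mult_2 intro: add_mono)
    show "f2 (- z) = f2 z" for z by (simp add: f2_def power2_commute)
  qed (use I in auto)
  then obtain \<Psi>2 where \<Psi>2: "homogeneous (2 * n) \<Psi>2"
    "\<And>r z. r \<in> \<Omega> \<Longrightarrow> z \<bullet> r = 0 \<Longrightarrow> form K z z = 1 \<Longrightarrow> eval3 \<Psi>2 (complexify z) = f2 z" by blast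
  have mirror: "f1 z1 = f1 z2 \<and> f2 z1 = f2 z2"
    if r: "r1 \<in> \<Omega>" "r2 \<in> \<Omega>" "z1 \<bullet> r1 = 0" "z2 \<bullet> r2 = 0" "form K z1 z1 = 1" "form K z2 z2 = 1"
      and eq: "\<And>s1 s2. s1 \<in> \<Omega> \<Longrightarrow> s2 \<in> \<Omega> \<Longrightarrow> z1 \<bullet> s1 = 0 \<Longrightarrow> z2 \<bullet> s2 = 0 \<Longrightarrow> \<Phi> (s1, vel K s1 z1) = \<Phi> (s2, vel K s2 z2)"
       "\<And>s1 s2. s1 \<in> \<Omega> \<Longrightarrow> s2 \<in> \<Omega> \<Longrightarrow> z1 \<bullet> s1 = 0 \<Longrightarrow> z2 \<bullet> s2 = 0 \<Longrightarrow> \<Phi> (s1, vel K s1 (- z1)) = \<Phi> (s2, vel K s2 (- z2))"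
    for z1 z2 r1 r2
  proof -
    have "\<phi> z1 = \<phi> z2" using \<phi>[OF r(1,3,5)] \<phi>[OF r(2,4,6)] eq(1)[OF r(1-4)] by simp
    moreover have "\<phi> (- z1) = \<phi> (- z2)"
      using \<phi>[of r1 "- z1"] \<phi>[of r2 "- z2"] r eq(2)[OF r(1-4)] by (simp add: form_simps)
    ultimately show ?thesis by (simp add: f1_def f2_def)
  qed
  show ?thesis
  proof (cases "\<exists>c. \<forall>x. eval3 \<Psi>1 (complexify x) = c * of_real (form K x x) ^ n")
    case False
    show ?thesis
    proof (rule that[of \<Psi>1])
      show "homogeneous (2 * n) \<Psi>1" by (rule \<Psi>1)
      show "\<exists>x. eval3 \<Psi>1 (complexify x) \<noteq> c * of_real (form K x x) ^ n" for c using False by blast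
    qed (use mirror \<Psi>1(2) in metis)
  next
    case True
    then obtain c1 where c1: "\<And>x. eval3 \<Psi>1 (complexify x) = c1 * of_real (form K x x) ^ n" by blast
    show ?thesis
    proof (cases "\<exists>c. \<forall>x. eval3 \<Psi>2 (complexify x) = c * of_real (form K x x) ^ n")
      case False
      show ?thesis
      proof (rule that[of \<Psi>2])
        show "homogeneous (2 * n) \<Psi>2" by (rule \<Psi>2)
        show "\<exists>x. eval3 \<Psi>2 (complexify x) \<noteq> c * of_real (form K x x) ^ n" for c using False by blast
      qed (use mirror \<Psi>2(2) in metis)
    next
      case True
      then obtain c2 where c2: "\<And>x. eval3 \<Psi>2 (complexify x) = c2 * of_real (form K x x) ^ n" by blast
      have f1c: "f1 z = c1" and f2c: "f2 z = c2" if "r \<in> \<Omega>" "z \<bullet> r = 0" "form K z z = 1" for r z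
        using \<Psi>1(2)[OF that] \<Psi>2(2)[OF that] c1 c2 that(3) by simp_all
      have "\<Phi> (r, v) = Re c1 / 2" if rv: "(r, v) \<in> unit_tangent_bundle K \<Omega>" for r v
      proof -
        from rv have r: "r \<in> \<Omega>" "form K r v = 0" "form K v v = 1" by (auto simp: unit_tangent_bundle_def tangent_plane_def)
        define z where "z = cross3 r v"
        have vz: "vel K r z = v" using vel_cross3[OF K rr[OF r(1)] r(2)] by (simp add: z_def)
        have z: "z \<bullet> r = 0" by (simp add: z_def dot_cross_self)
        have zz: "form K z z = 1" using form_vel_vel[OF K rr[OF r(1)] z, of z] vz r(3) by simp
        obtain z' where z': "z' \<bullet> r = 0" "form K z' z' = 1" "\<phi> z' = \<phi> (- z')"
          using odd_function_zero_on_line_pencil[where f = \<phi> and q = "q r" and d = d and I = I, OF K rr[OF r(1)] z zz I(1) I(3)] \<phi>q[OF r(1)]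
          by metis
        \<comment> \<open>The constant is read off at \<open>z'\<close>, where the odd part
          vanishes. Hence the odd part vanishes on every line, and the integral is
          \<open>Re c1 / 2\<close> everywhere.\<close>
        have "c2 = 0" using f2c[OF r(1) z'(1,2)] z'(3) by (simp add: f2_def)
        then have "f2 z = 0" using f2c[OF r(1) z zz] by simp
        then have "\<phi> z = \<phi> (- z)" by (simp add: f2_def)
        moreover have "Re (f1 z) = Re c1" using f1c[OF r(1) z zz] by simp
        ultimately have "\<phi> z = Re c1 / 2" by (simp add: f1_def)
        then show ?thesis using \<phi>[OF r(1) z zz] vz by simp
      qed
      then have "\<Phi> constant_on unit_tangent_bundle K \<Omega>" unfolding constant_on_def by (intro exI[of _ "Re c1 / 2"]) auto
      with nc show ?thesis by simp
    qed
  qed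
qed

section \<open>The dual arc\<close>

lemma bounded_bilinear_cross3: "bounded_bilinear cross3"
  by (rule bilinear_conv_bounded_bilinear[THEN iffD1, OF bilinear_cross])

lemmas has_vector_derivative_cross3 = bounded_bilinear.has_vector_derivative[OF bounded_bilinear_cross3]

lemma has_vector_derivative_inner:
  assumes "(f has_vector_derivative f') (at t within S)" "(g has_vector_derivative g') (at t within S)"
  shows "((\<lambda>t. f t \<bullet> g t) has_vector_derivative f t \<bullet> g' + f' \<bullet> g t) (at t within S)"
  by (rule bounded_bilinear.has_vector_derivative[OF bounded_bilinear_inner assms])

lemma has_vector_derivative_zero_on_interval:
  assumes "(f has_vector_derivative f') (at s)" "s \<in> {a<..<b}" "\<And>t. t \<in> {a<..<b} \<Longrightarrow> f t = c"
  shows "f' = 0"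
proof -
  have "((\<lambda>_. c) has_vector_derivative f') (at s)"
    by (rule has_vector_derivative_transform_within_open[OF assms(1), of "{a<..<b}"]) (use assms in auto)
  then show ?thesis using vector_derivative_unique_at[of "\<lambda>_. c" f' s 0] by simp
qed

lemma constant_on_interval:
  fixes f :: "real \<Rightarrow> 'a::real_normed_vector"
  assumes "\<And>t. t \<in> {a<..<b} \<Longrightarrow> (f has_vector_derivative 0) (at t)"
  obtains c where "\<And>t. t \<in> {a<..<b} \<Longrightarrow> f t = c"
proof (rule has_vector_derivative_zero_constant[of "{a<..<b}" f])
  show "convex {a<..<b}" by simp
  show "(f has_vector_derivative 0) (at t within {a<..<b})" if "t \<in> {a<..<b}" for t
    using assms[OF that] by (rule has_vector_derivative_at_within)
qed (use that in auto)

locale surface_arc =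
  fixes K a b :: real and \<gamma> g h :: "real \<Rightarrow> real^3"
  assumes K: "K = 1 \<or> K = -1" and ab: "a < b"
    and \<gamma>: "\<And>s. s \<in> {a<..<b} \<Longrightarrow> (\<gamma> has_vector_derivative g s) (at s)"
    and g: "\<And>s. s \<in> {a<..<b} \<Longrightarrow> (g has_vector_derivative h s) (at s)"
    and h: "continuous_on {a<..<b} h"
    and surf: "\<And>s. s \<in> {a<..<b} \<Longrightarrow> \<gamma> s \<in> surface K"
    and regular: "\<And>s. s \<in> {a<..<b} \<Longrightarrow> g s \<noteq> 0"
begin

text \<open>
  The derivative of the normalized dual arc \<open>y\<close> is proportional to the angular momentum of a normal to \<open>\<gamma>\<close>,
  so that the reflection law changes the sign of \<open>y'\<close>.
\<close>

definition \<Gamma> where "\<Gamma> s = cross3 (\<gamma> s) (g s)"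
definition \<rho> where "\<rho> s = sqrt (form K (\<Gamma> s) (\<Gamma> s))"
definition y where "y s = (1 / \<rho> s) *\<^sub>R \<Gamma> s"
definition y' where "y' s = vector_derivative y (at s)"
text \<open>The determinant of the position and its first two derivatives, a nonzero multiple of the
  geodesic curvature.\<close>

definition w where "w s = \<Gamma> s \<bullet> h s"

lemma \<gamma>\<gamma>: "s \<in> {a<..<b} \<Longrightarrow> form K (\<gamma> s) (\<gamma> s) = K"
  using surf surface_iff[OF K] by blast

lemma \<gamma>_nz: "s \<in> {a<..<b} \<Longrightarrow> \<gamma> s \<noteq> 0"
  using \<gamma>\<gamma> K by (force simp: form_simps)

lemma \<gamma>g: "s \<in> {a<..<b} \<Longrightarrow> form K (\<gamma> s) (g s) = 0"
proof -
  assume s: "s \<in> {a<..<b}"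
  have "form K (g s) (\<gamma> s) + form K (\<gamma> s) (g s) = 0"
    by (rule has_vector_derivative_zero_on_interval[OF has_vector_derivative_form[OF \<gamma>[OF s] \<gamma>[OF s]] s \<gamma>\<gamma>])
  then show ?thesis by (simp add: form_commute[of K "g s"])
qed

lemma \<Gamma>_nz: "s \<in> {a<..<b} \<Longrightarrow> \<Gamma> s \<noteq> 0"
  using vel_cross3[OF K \<gamma>\<gamma> \<gamma>g, of s] regular[of s] by (auto simp: \<Gamma>_def vel_def)

lemma \<Gamma>\<gamma>: "\<Gamma> s \<bullet> \<gamma> s = 0" and \<Gamma>g: "\<Gamma> s \<bullet> g s = 0"
  by (simp_all add: \<Gamma>_def dot_cross_self)

lemma \<Gamma>\<Gamma>: "s \<in> {a<..<b} \<Longrightarrow> 0 < form K (\<Gamma> s) (\<Gamma> s)"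
  by (rule form_line_pos[OF K \<gamma>\<gamma> \<Gamma>\<gamma> \<Gamma>_nz])

lemma \<rho>: "s \<in> {a<..<b} \<Longrightarrow> 0 < \<rho> s"
  by (simp add: \<rho>_def \<Gamma>\<Gamma>)

lemma \<Gamma>_deriv: "s \<in> {a<..<b} \<Longrightarrow> (\<Gamma> has_vector_derivative cross3 (\<gamma> s) (h s)) (at s)"
  using has_vector_derivative_cross3[OF \<gamma> g, of s] by (simp add: \<Gamma>_def[abs_def])

text \<open>Differentiating the normalizing factor only adds a multiple of
  \<open>\<Gamma> s\<close>. Its coefficient stays implicit because it drops out of the products
  with \<open>\<gamma> s\<close>, \<open>g s\<close> and \<open>y s\<close>.\<close>

lemma y_deriv_exists:
  assumes s: "s \<in> {a<..<b}"
  obtains c where "(y has_vector_derivative (1 / \<rho> s) *\<^sub>R cross3 (\<gamma> s) (h s) + c *\<^sub>R \<Gamma> s) (at s)"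
proof -
  define f where "f s = form K (\<Gamma> s) (\<Gamma> s)" for s
  obtain f' where "(f has_vector_derivative f') (at s)"
    using has_vector_derivative_form[OF \<Gamma>_deriv[OF s] \<Gamma>_deriv[OF s], of K] unfolding f_def[abs_def] by blast
  then have f: "(f has_real_derivative f') (at s)" by (simp add: has_real_derivative_iff_has_vector_derivative)
  have pos: "0 < f s" using \<Gamma>\<Gamma>[OF s] by (simp add: f_def)
  then have "\<exists>c. ((\<lambda>s. 1 / sqrt (f s)) has_real_derivative c) (at s)"
    by (intro exI) (rule derivative_eq_intros f refl | simp)+
  then obtain c where "((\<lambda>s. 1 / \<rho> s) has_real_derivative c) (at s)" by (auto simp: \<rho>_def f_def)
  from has_vector_derivative_scaleR[OF this \<Gamma>_deriv[OF s]] that show ?thesis by (simp add: y_def[abs_def])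
qed

lemma y_deriv: "s \<in> {a<..<b} \<Longrightarrow> (y has_vector_derivative y' s) (at s)"
  and y'_eq: "s \<in> {a<..<b} \<Longrightarrow> \<exists>c. y' s = (1 / \<rho> s) *\<^sub>R cross3 (\<gamma> s) (h s) + c *\<^sub>R \<Gamma> s"
proof -
  assume s: "s \<in> {a<..<b}"
  obtain c where c: "(y has_vector_derivative (1 / \<rho> s) *\<^sub>R cross3 (\<gamma> s) (h s) + c *\<^sub>R \<Gamma> s) (at s)"
    using y_deriv_exists[OF s] by blast
  show "\<exists>c. y' s = (1 / \<rho> s) *\<^sub>R cross3 (\<gamma> s) (h s) + c *\<^sub>R \<Gamma> s"
    using vector_derivative_at[OF c] by (auto simp: y'_def)
  show "(y has_vector_derivative y' s) (at s)"
    using c vector_derivative_at[OF c] by (simp add: y'_def)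
qed

lemma yy: "s \<in> {a<..<b} \<Longrightarrow> form K (y s) (y s) = 1"
  using \<Gamma>\<Gamma>[of s] by (simp add: y_def \<rho>_def form_simps flip: power2_eq_square)

lemma yy': "s \<in> {a<..<b} \<Longrightarrow> form K (y s) (y' s) = 0"
proof -
  assume s: "s \<in> {a<..<b}"
  have "form K (y' s) (y s) + form K (y s) (y' s) = 0"
    by (rule has_vector_derivative_zero_on_interval[OF has_vector_derivative_form[OF y_deriv[OF s] y_deriv[OF s]] s yy])
  then show ?thesis by (simp add: form_commute[of K "y' s"])
qed

lemma y\<gamma>: "y s \<bullet> \<gamma> s = 0" by (simp add: y_def \<Gamma>\<gamma>)

lemma y'\<gamma>: "s \<in> {a<..<b} \<Longrightarrow> y' s \<bullet> \<gamma> s = 0"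
  using y'_eq[of s] \<Gamma>\<gamma>[of s] by (auto simp: inner_add_left dot_cross_self)

lemma y'g: "s \<in> {a<..<b} \<Longrightarrow> y' s \<bullet> g s = - w s / \<rho> s"
proof -
  assume s: "s \<in> {a<..<b}"
  have "cross3 (\<gamma> s) (h s) \<bullet> g s = - w s" by (simp add: w_def \<Gamma>_def coords algebra_simps)
  then show ?thesis using y'_eq[OF s] \<Gamma>g[of s] by (auto simp: inner_add_left)
qed

text \<open>Biduality: where the curvature is nonzero, the tangent line of the dual arc at
  \<open>y s\<close> is the point \<open>\<gamma> s\<close>.\<close>

lemma y_cross_y': "s \<in> {a<..<b} \<Longrightarrow> cross3 (y s) (y' s) = (w s / (\<rho> s)\<^sup>2) *\<^sub>R \<gamma> s"
proof -
  assume s: "s \<in> {a<..<b}"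
  have "cross3 (\<Gamma> s) (cross3 (\<gamma> s) (h s)) = w s *\<^sub>R \<gamma> s" by (simp add: w_def \<Gamma>_def coords algebra_simps)
  then show ?thesis using y'_eq[OF s]
    by (auto simp: y_def cross_add_right cross_mult_right cross_mult_left power2_eq_square)
qed

lemma continuous_\<gamma>: "continuous_on {a<..<b} \<gamma>" and continuous_g: "continuous_on {a<..<b} g"
  and continuous_y: "continuous_on {a<..<b} y"
  by (intro continuous_at_imp_continuous_on ballI has_vector_derivative_continuous, erule \<gamma> g y_deriv)+

lemma continuous_w: "continuous_on {a<..<b} w"
proof -
  have "continuous_on {a<..<b} \<Gamma>"
    by (intro continuous_at_imp_continuous_on ballI has_vector_derivative_continuous, erule \<Gamma>_deriv)
  then show ?thesis unfolding w_def[abs_def] by (intro continuous_on_inner h)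
qed

text \<open>A vector orthogonal to a subarc is orthogonal to \<open>\<gamma>\<close>,
  \<open>g\<close> and \<open>h\<close> there; the first two make it a multiple of
  \<open>\<Gamma>\<close>, and the third then contradicts \<open>w s \<noteq> 0\<close>.\<close>

lemma nonplanar_\<gamma>:
  assumes sub: "a \<le> a'" "a' < b'" "b' \<le> b" and w: "\<And>s. s \<in> {a'<..<b'} \<Longrightarrow> w s \<noteq> 0"
  shows "nonplanar_on a' b' \<gamma>"
  unfolding nonplanar_on_def
proof (intro conjI allI impI)
  show "continuous_on {a'<..<b'} \<gamma>" using sub by (intro continuous_on_subset[OF continuous_\<gamma>]) auto
  fix m :: "real^3" and c d assume m: "m \<noteq> 0" and cd: "a' \<le> c" "c < d" "d \<le> b'"
  show "\<exists>s\<in>{c<..<d}. m \<bullet> \<gamma> s \<noteq> 0"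
  proof (rule ccontr)
    assume "\<not> (\<exists>s\<in>{c<..<d}. m \<bullet> \<gamma> s \<noteq> 0)"
    then have 0: "m \<bullet> \<gamma> s = 0" if "s \<in> {c<..<d}" for s using that by blast
    have in': "s \<in> {a<..<b}" if "s \<in> {c<..<d}" for s using that cd sub by auto
    have const: "((\<lambda>_. m) has_vector_derivative 0) (at s)" for s :: real by simp
    have 1: "m \<bullet> g s = 0" if s: "s \<in> {c<..<d}" for s
      using has_vector_derivative_zero_on_interval[OF has_vector_derivative_inner[OF const \<gamma>[OF in'[OF s]]] s 0] by simp
    have 2: "m \<bullet> h s = 0" if s: "s \<in> {c<..<d}" for s
      using has_vector_derivative_zero_on_interval[OF has_vector_derivative_inner[OF const g[OF in'[OF s]]] s 1] by simp
    define s where "s = (c + d) / 2"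
    have s: "s \<in> {c<..<d}" using cd by (auto simp: s_def)
    have "cross3 (\<gamma> s) (g s) \<noteq> 0" using \<Gamma>_nz[OF in'[OF s]] by (simp add: \<Gamma>_def)
    then obtain \<mu> where \<mu>: "m = \<mu> *\<^sub>R cross3 (\<gamma> s) (g s)" using orthogonal_to_both 0[OF s] 1[OF s] by blast
    then have "\<mu> * w s = 0" using 2[OF s] by (simp add: w_def \<Gamma>_def)
    then have "\<mu> = 0" using w[of s] s cd by auto
    with \<mu> m show False by simp
  qed
qed (use sub in auto)

text \<open>A vector orthogonal to \<open>y\<close> and \<open>y'\<close> is parallel to
  \<open>\<gamma> s\<close> for all \<open>s\<close>, by biduality; differentiating this relation
  contradicts the regularity of \<open>\<gamma>\<close>.\<close>

lemma nonplanar_y: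
  assumes sub: "a \<le> a'" "a' < b'" "b' \<le> b" and w: "\<And>s. s \<in> {a'<..<b'} \<Longrightarrow> w s \<noteq> 0"
  shows "nonplanar_on a' b' y"
  unfolding nonplanar_on_def
proof (intro conjI allI impI)
  show "continuous_on {a'<..<b'} y" using sub by (intro continuous_on_subset[OF continuous_y]) auto
  fix m :: "real^3" and c d assume m: "m \<noteq> 0" and cd: "a' \<le> c" "c < d" "d \<le> b'"
  show "\<exists>s\<in>{c<..<d}. m \<bullet> y s \<noteq> 0"
  proof (rule ccontr)
    assume "\<not> (\<exists>s\<in>{c<..<d}. m \<bullet> y s \<noteq> 0)"
    then have 0: "m \<bullet> y s = 0" if "s \<in> {c<..<d}" for s using that by blast
    have in': "s \<in> {a<..<b}" if "s \<in> {c<..<d}" for s using that cd sub by auto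
    have const: "((\<lambda>_. m) has_vector_derivative 0) (at s)" for s :: real by simp
    have 1: "m \<bullet> y' s = 0" if s: "s \<in> {c<..<d}" for s
      using has_vector_derivative_zero_on_interval[OF has_vector_derivative_inner[OF const y_deriv[OF in'[OF s]]] s 0] by simp
    have par: "\<exists>l. m = l *\<^sub>R \<gamma> s" if s: "s \<in> {c<..<d}" for s
    proof -
      have "w s \<noteq> 0" "\<rho> s \<noteq> 0" using w[of s] \<rho>[OF in'[OF s]] s cd by auto
      then have "cross3 (y s) (y' s) \<noteq> 0" using y_cross_y'[OF in'[OF s]] \<gamma>_nz[OF in'[OF s]] by simp
      then obtain \<mu> where "m = \<mu> *\<^sub>R cross3 (y s) (y' s)" using orthogonal_to_both 0[OF s] 1[OF s] by blast
      then show ?thesis unfolding y_cross_y'[OF in'[OF s]] by auto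
    qed
    then have 2: "cross3 m (\<gamma> s) = 0" if "s \<in> {c<..<d}" for s using that by (metis cross_mult_left cross_refl scaleR_zero_right)
    define s where "s = (c + d) / 2"
    have s: "s \<in> {c<..<d}" using cd by (auto simp: s_def)
    have "cross3 m (g s) = 0"
      using has_vector_derivative_zero_on_interval[OF has_vector_derivative_cross3[OF const \<gamma>[OF in'[OF s]]] s 2] by simp
    moreover obtain l where l: "m = l *\<^sub>R \<gamma> s" using par[OF s] by blast
    ultimately have "l *\<^sub>R \<Gamma> s = 0" by (simp add: \<Gamma>_def cross_mult_left)
    then show False using \<Gamma>_nz[OF in'[OF s]] m l by simp
  qed
qed (use sub in auto)

text \<open>If \<open>w\<close> vanishes identically, then \<open>y'\<close> is both parallel and
  orthogonal to \<open>y\<close>, so \<open>y\<close> is a constant \<open>m\<close> and the arc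
  lies in the plane section orthogonal to \<open>m\<close>, which is a geodesic.\<close>

lemma curvature_nonzero:
  assumes "\<not> is_geodesic_arc K a b \<gamma>"
  obtains s where "s \<in> {a<..<b}" "w s \<noteq> 0"
proof (rule ccontr)
  assume "\<not> thesis"
  with that have w0: "w s = 0" if "s \<in> {a<..<b}" for s using that by blast
  have "y' s = 0" if s: "s \<in> {a<..<b}" for s
  proof -
    have "cross3 (y' s) (y s) = 0" using y_cross_y'[OF s] w0[OF s] cross_skew[of "y' s" "y s"] by simp
    moreover have "y s \<noteq> 0" using yy[OF s] by (auto simp: form_simps)
    ultimately obtain c where c: "y' s = c *\<^sub>R y s" using cross3_eq_0_imp_parallel by blast
    then have "c = 0" using yy'[OF s] yy[OF s] by (simp add: form_simps)
    with c show ?thesis by simp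
  qed
  then have "(y has_vector_derivative 0) (at s)" if "s \<in> {a<..<b}" for s using y_deriv[OF that] that by simp
  then obtain m where m: "\<And>s. s \<in> {a<..<b} \<Longrightarrow> y s = m" using constant_on_interval by blast
  define s where "s = (a + b) / 2"
  have s: "s \<in> {a<..<b}" using ab by (auto simp: s_def)
  define p where "p = \<gamma> s"
  define v where "v = vel K p m"
  have pS: "p \<in> surface K" and pp: "form K p p = K" using surf[OF s] \<gamma>\<gamma>[OF s] by (simp_all add: p_def)
  have mp: "m \<bullet> p = 0" and mm: "form K m m = 1" using y\<gamma>[of s] yy[OF s] m[OF s] by (simp_all add: p_def)
  have v: "form K p v = 0" "form K v v = 1" "cross3 p v = m"
    using form_vel[OF K] form_vel_vel[OF K pp mp, of m] mm cross3_vel[OF K pp mp] by (simp_all add: v_def)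
  have "\<gamma> t \<in> range (\<lambda>t. cosK K (t + 0) *\<^sub>R p + sinK K (t + 0) *\<^sub>R v)" if t: "t \<in> {a<..<b}" for t
  proof -
    have "\<gamma> t \<bullet> cross3 p v = 0" using y\<gamma>[of t] m[OF t] v(3) by (simp add: inner_commute)
    moreover have "cross3 p v \<noteq> 0" using v(3) mm by (auto simp: form_simps)
    ultimately obtain \<alpha> \<beta> where \<gamma>t: "\<gamma> t = \<alpha> *\<^sub>R p + \<beta> *\<^sub>R v" using cross3_decompose by metis
    have eq: "\<alpha>\<^sup>2 * K + \<beta>\<^sup>2 = K"
      using \<gamma>\<gamma>[OF t] by (simp add: \<gamma>t form_simps pp v form_commute[of K v p] power2_eq_square mult.assoc)
    have "\<exists>u. cosK K u = \<alpha> \<and> sinK K u = \<beta>"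
    proof (cases "K = 1")
      case True
      then obtain u where "\<alpha> = cos u" "\<beta> = sin u" using sincos_total_2pi[of \<alpha> \<beta>] eq by auto
      then show ?thesis using True by (auto simp: cosK_def sinK_def)
    next
      case False
      then have K1: "K = -1" using K by simp
      then have p3: "\<gamma> t $ 3 > 0" "p $ 3 > 0" using surf[OF t] pS surface_iff[OF K] by auto
      have vp: "\<bar>v $ 3\<bar> < p $ 3" using hyperbolic_tangent_bound pp v p3(2) K1 by blast
      have \<alpha>2: "\<alpha>\<^sup>2 = \<beta>\<^sup>2 + 1" using eq K1 by simp
      \<comment> \<open>The plane cuts both sheets of the hyperboloid, and \<open>cosh\<close>
        covers only the branch of \<open>p\<close>; the signs of the third coordinates select
        it.\<close>
      have "0 < \<alpha>"
      proof (rule ccontr)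
        assume "\<not> 0 < \<alpha>"
        have "\<beta>\<^sup>2 \<le> \<alpha>\<^sup>2" using \<alpha>2 by simp
        then have "\<bar>\<beta>\<bar> \<le> - \<alpha>" using \<open>\<not> 0 < \<alpha>\<close> by (simp add: abs_le_square_iff[symmetric])
        then have "\<bar>\<beta>\<bar> * \<bar>v $ 3\<bar> \<le> (- \<alpha>) * p $ 3" using vp by (intro mult_mono) auto
        then have "\<beta> * v $ 3 \<le> (- \<alpha>) * p $ 3" by (metis abs_ge_self abs_mult order_trans)
        then show False using p3(1) by (simp add: \<gamma>t)
      qed
      then have "\<alpha> = cosh (arsinh \<beta>)" using \<alpha>2 by (simp add: cosh_arsinh_real real_sqrt_unique)
      then show ?thesis using K1 by (auto simp: cosK_def sinK_def intro!: exI[of _ "arsinh \<beta>"])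
    qed
    then show ?thesis unfolding \<gamma>t by auto
  qed
  then have "\<gamma> ` {a<..<b} \<subseteq> range (\<lambda>t. cosK K (t + 0) *\<^sub>R p + sinK K (t + 0) *\<^sub>R v)" by blast
  with geodesic_line[OF K pS v(1,2), of UNIV 0] have "is_geodesic_arc K a b \<gamma>"
    unfolding is_geodesic_arc_def by blast
  with assms show False by simp
qed

end

section \<open>The integral along the dual arc\<close>

definition lam3 :: "real \<Rightarrow> poly3" where
  "lam3 K = lin3 (axis 1 1) * lin3 (axis 1 1) + lin3 (axis 2 1) * lin3 (axis 2 1) +
    const3 (of_real K) * (lin3 (axis 3 1) * lin3 (axis 3 1))"

lemma eval3_lam3: "eval3 (lam3 K) x = (x$1)^2 + (x$2)^2 + of_real K * (x$3)^2"
  by (simp add: lam3_def axis_def power2_eq_square)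

lemma eval3_lam3_real: "eval3 (lam3 K) (complexify x) = of_real (form K x x)"
  by (simp add: eval3_lam3 form_def power2_eq_square)

lemma homogeneous_const3_mult: "homogeneous n P \<Longrightarrow> homogeneous n (const3 c * P)"
  using homogeneous_mult[OF homogeneous_const3, of n P c] by simp

lemma homogeneous_lam3: "homogeneous 2 (lam3 K)"
proof -
  have "homogeneous (1 + 1) (lin3 (axis i 1) * lin3 (axis i 1))" for i
    by (intro homogeneous_mult homogeneous_lin3)
  then have "homogeneous 2 (lin3 (axis i 1) * lin3 (axis i 1))" for i by (simp only: one_add_one)
  then show ?thesis unfolding lam3_def by (intro homogeneous_add homogeneous_const3_mult)
qed

lemma eval3_real_line:
  "complexify x + of_real e *s complexify z = complexify (x + e *\<^sub>R z)"
  "complexify x - of_real e *s complexify z = complexify (x - e *\<^sub>R z)"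
  by (simp_all add: vec_eq_iff)

lemma eval3_dir_deriv_deriv:
  assumes "(y has_vector_derivative z) (at s)"
  shows "((\<lambda>s. eval3 P (complexify (y s))) has_vector_derivative
    eval3 (dir_deriv (complexify z) P) (complexify (y s))) (at s)"
  using has_vector_derivative_eval3_real[OF assms, of P] by (simp add: eval3_dir_deriv)

lemma continuous_on_eval3_real:
  assumes "continuous_on S y"
  shows "continuous_on S (\<lambda>s. eval3 P (complexify (y s)))"
proof -
  have 1: "continuous_on UNIV (\<lambda>x. eval2 p (complexify x $ 2) (complexify x $ 3))" for p
    by (induction p) (auto intro!: continuous_intros)
  have "continuous_on UNIV (\<lambda>x. eval3 P (complexify x))"
    by (induction P) (auto intro!: continuous_intros 1[unfolded complexify_simps])
  from continuous_on_compose2[OF this assms] show ?thesis by simp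
qed

lemma even_imp_dir_deriv_0:
  assumes even: "\<And>e::real. eval3 P (x + of_real e *s z) = eval3 P (x - of_real e *s z)"
  shows "eval3 (dir_deriv z P) x = 0"
proof -
  define p where "p = line_poly x z P"
  have "p = pcompose p [:0, -1:]"
    by (rule poly_eqI_real) (use even in \<open>simp add: p_def poly_pcompose\<close>)
  then have "coeff p 1 = (- 1) ^ 1 * coeff p 1" by (metis coeff_pcompose_linear)
  then have "coeff (pderiv p) 0 = 0" by (simp add: coeff_pderiv)
  then have "poly (pderiv p) 0 = 0" by (simp add: poly_0_coeff_0)
  then show ?thesis by (simp add: p_def pderiv_line_poly)
qed

text \<open>An irreducible form cannot divide all its partial derivatives, since these have lower degree.\<close>

lemma gradient_nonzero_on_subarc:
  assumes irr: "irreducible P" and P: "homogeneous d P" and y: "nonplanar_on a b y"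
    and Py: "\<And>s. s \<in> {a<..<b} \<Longrightarrow> eval3 P (complexify (y s)) = 0"
  obtains a' b' where "a \<le> a'" "a' < b'" "b' \<le> b"
    "\<And>s. s \<in> {a'<..<b'} \<Longrightarrow> gradient P (complexify (y s)) \<noteq> 0"
proof -
  have P0: "P \<noteq> 0" using irr by auto
  have ab: "a < b" and cy: "continuous_on {a<..<b} y" using y by (auto simp: nonplanar_on_def)
  have "\<exists>i. \<exists>s\<in>{a<..<b}. eval3 (partial i P) (complexify (y s)) \<noteq> 0"
  proof (rule ccontr)
    assume "\<not> ?thesis"
    then have 0: "P dvd partial i P" for i
      by (intro irreducible_dvd_if_vanishing_on_arc[OF irr P homogeneous_partial[OF P] y Py]) auto
    have d0: "d = 0"
    proof (rule ccontr)
      assume "d \<noteq> 0"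
      have z: "partial i P = 0" for i
      proof (rule ccontr)
        assume "partial i P \<noteq> 0"
        from homogeneous_dvd_degree_le[OF P homogeneous_partial[OF P] 0 this] \<open>d \<noteq> 0\<close> show False by simp
      qed
      have "of_nat d * eval3 P x = 0" for x using euler_homogeneous[OF P, of x] z by simp
      then have "P = 0" using \<open>d \<noteq> 0\<close> by (intro eval3_real_eq_0_imp_0) simp
      with P0 show False by simp
    qed
    have "eval3 P x = eval3 P 0" for x
      using eval3_homogeneous[OF P, of 0 x] d0 by simp
    moreover define s where "s = (a + b) / 2"
    then have "s \<in> {a<..<b}" using ab by auto
    then have "eval3 P (complexify (y s)) = 0" by (rule Py)
    ultimately have "P = 0" by (intro eval3_real_eq_0_imp_0) metis
    with P0 show False by simp
  qed
  then obtain i s where nz: "s \<in> {a<..<b}" "eval3 (partial i P) (complexify (y s)) \<noteq> 0" by blast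
  obtain a' b' where *: "a \<le> a'" "a' < b'" "b' \<le> b"
    "\<And>t. t \<in> {a'<..<b'} \<Longrightarrow> eval3 (partial i P) (complexify (y t)) \<noteq> 0"
    using subinterval_nonzero[OF continuous_on_eval3_real[OF cy] nz] by blast
  have "gradient P (complexify (y t)) \<noteq> 0" if "t \<in> {a'<..<b'}" for t
    using *(4)[OF that] by (auto simp: gradient_def vec_eq_iff)
  with * that show ?thesis by blast
qed

text \<open>Gradients are complex while the arcs are real, so the real statement is applied to the
  real and imaginary parts.\<close>

lemma complex_orthogonal_to_both:
  fixes n :: "complex^3"
  assumes ab: "cross3 a b \<noteq> 0" and n: "(\<Sum>i\<in>UNIV. n$i * complexify a $ i) = 0" "(\<Sum>i\<in>UNIV. n$i * complexify b $ i) = 0"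
  obtains l where "n = l *s complexify (cross3 a b)"
proof -
  define R where "R = (\<chi> i. Re (n$i))"
  define J where "J = (\<chi> i. Im (n$i))"
  have "R \<bullet> a = 0" "R \<bullet> b = 0" "J \<bullet> a = 0" "J \<bullet> b = 0"
    using arg_cong[OF n(1), of Re] arg_cong[OF n(1), of Im] arg_cong[OF n(2), of Re] arg_cong[OF n(2), of Im]
    by (simp_all add: R_def J_def inner_vec_def)
  then obtain l m where "R = l *\<^sub>R cross3 a b" "J = m *\<^sub>R cross3 a b"
    using orthogonal_to_both[OF ab] by metis
  then have "n $ i = (of_real l + \<i> * of_real m) * complexify (cross3 a b) $ i" for i
    by (simp add: complex_eq_iff R_def J_def vec_eq_iff)
  then have "n = (of_real l + \<i> * of_real m) *s complexify (cross3 a b)"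
    by (simp add: vec_eq_iff algebra_simps)
  then show ?thesis by (rule that)
qed

context surface_arc
begin

text \<open>The gradient of \<open>G\<close> is orthogonal to \<open>\<gamma> s\<close> by Euler's
  identity and to \<open>g s\<close> because \<open>G\<close> vanishes along the arc. Hence it is a
  multiple of \<open>\<Gamma> s\<close>, which is thus the tangent line at a smooth point, already
  before the closure.\<close>

lemma dual_curve_vanishes:
  assumes G: "irreducible G" "homogeneous e G" and FG: "curve F = dual_curve G" and F: "homogeneous d F"
    and sub: "{a'<..<b'} \<subseteq> {a<..<b}" and G\<gamma>: "\<And>s. s \<in> {a'<..<b'} \<Longrightarrow> eval3 G (complexify (\<gamma> s)) = 0"
    and s: "s \<in> {a'<..<b'}" and grad: "gradient G (complexify (\<gamma> s)) \<noteq> 0"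
  shows "eval3 F (complexify (y s)) = 0"
proof -
  have s': "s \<in> {a<..<b}" using s sub by blast
  have "eval3 (dir_deriv (complexify (g s)) G) (complexify (\<gamma> s)) = 0"
    by (rule has_vector_derivative_zero_on_interval[OF eval3_dir_deriv_deriv[OF \<gamma>[OF s']] s G\<gamma>])
  then have n2: "(\<Sum>i\<in>UNIV. gradient G (complexify (\<gamma> s)) $ i * complexify (g s) $ i) = 0"
    by (simp add: eval3_dir_deriv gradient_def)
  have n1: "(\<Sum>i\<in>UNIV. gradient G (complexify (\<gamma> s)) $ i * complexify (\<gamma> s) $ i) = 0"
    using euler_homogeneous[OF G(2), of "complexify (\<gamma> s)"] G\<gamma>[OF s] by (simp add: gradient_def)
  have \<Gamma>0: "cross3 (\<gamma> s) (g s) \<noteq> 0" using \<Gamma>_nz[OF s'] by (simp add: \<Gamma>_def)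
  obtain l where l: "gradient G (complexify (\<gamma> s)) = l *s complexify (\<Gamma> s)"
    using complex_orthogonal_to_both[OF \<Gamma>0 n1 n2] by (auto simp: \<Gamma>_def)
  with grad have l0: "l \<noteq> 0" by auto
  have "complexify (\<Gamma> s) = (1 / l) *s gradient G (complexify (\<gamma> s))"
    using l0 by (simp add: l vec_eq_iff)
  moreover have "complexify (\<gamma> s) \<in> curve G" using G\<gamma>[OF s] \<gamma>_nz[OF s'] by (simp add: curve_def)
  ultimately have "complexify (\<Gamma> s) \<in> {m. \<exists>x \<in> curve G. gradient G x \<noteq> 0 \<and> (\<exists>t. t \<noteq> 0 \<and> m = t *s gradient G x)}"
    using grad l0 by (intro CollectI bexI[of _ "complexify (\<gamma> s)"] conjI exI[of _ "1 / l"]) auto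
  from subsetD[OF closure_subset this] have "complexify (\<Gamma> s) \<in> dual_curve G"
    unfolding dual_curve_def using \<Gamma>_nz[OF s'] by simp
  then have "eval3 F (complexify (\<Gamma> s)) = 0" using FG by (auto simp: curve_def)
  then show ?thesis using eval3_homogeneous[OF F] by (simp add: y_def)
qed

text \<open>By biduality the gradient of \<open>F\<close> along \<open>y\<close> is a multiple of
  \<open>\<gamma>\<close>, with a factor \<open>l\<close>. Its change along the arc, paired with
  \<open>z = y' s\<close>, gives the second derivative as \<open>l\<close> times
  \<open>z \<bullet> g s = - w s / \<rho> s\<close>.\<close>

lemma second_derivative_nonzero:
  assumes F: "homogeneous d F" and sub: "{a'<..<b'} \<subseteq> {a<..<b}"
    and Fy: "\<And>s. s \<in> {a'<..<b'} \<Longrightarrow> eval3 F (complexify (y s)) = 0"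
    and w0: "\<And>s. s \<in> {a'<..<b'} \<Longrightarrow> w s \<noteq> 0"
    and s: "s \<in> {a'<..<b'}" and grad: "gradient F (complexify (y s)) \<noteq> 0"
  shows "eval3 (dir_deriv (complexify (y' s)) (dir_deriv (complexify (y' s)) F)) (complexify (y s)) \<noteq> 0"
proof -
  have in': "t \<in> {a<..<b}" if "t \<in> {a'<..<b'}" for t using sub that by blast
  have cr: "cross3 (y t) (y' t) \<noteq> 0" if t: "t \<in> {a'<..<b'}" for t
    using y_cross_y'[OF in'[OF t]] w0[OF t] \<rho>[OF in'[OF t]] \<gamma>_nz[OF in'[OF t]] by simp
  have tang: "eval3 (dir_deriv (complexify (y' t)) F) (complexify (y t)) = 0" if t: "t \<in> {a'<..<b'}" for t
    by (rule has_vector_derivative_zero_on_interval[OF eval3_dir_deriv_deriv[OF y_deriv[OF in'[OF t]]] t Fy])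
  have par: "\<exists>l. gradient F (complexify (y t)) = l *s complexify (\<gamma> t)" if t: "t \<in> {a'<..<b'}" for t
  proof -
    have "(\<Sum>i\<in>UNIV. gradient F (complexify (y t)) $ i * complexify (y t) $ i) = 0"
      using euler_homogeneous[OF F, of "complexify (y t)"] Fy[OF t] by (simp add: gradient_def)
    moreover have "(\<Sum>i\<in>UNIV. gradient F (complexify (y t)) $ i * complexify (y' t) $ i) = 0"
      using tang[OF t] by (simp add: gradient_def eval3_dir_deriv)
    ultimately obtain l where "gradient F (complexify (y t)) = l *s complexify (cross3 (y t) (y' t))"
      using complex_orthogonal_to_both[OF cr[OF t]] by blast
    then have "gradient F (complexify (y t)) = (l * of_real (w t / (\<rho> t)\<^sup>2)) *s complexify (\<gamma> t)"
      unfolding y_cross_y'[OF in'[OF t]] by (simp add: vec_eq_iff)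
    then show ?thesis by blast
  qed
  define z where "z = y' s"
  \<comment> \<open>The factor \<open>l\<close> is not known to be differentiable.
    \<open>R * P\<close> and \<open>S * Q\<close> agree without mentioning it, and their difference
    can be differentiated at \<open>s\<close>, with \<open>z\<close> frozen.\<close>
  define R :: "real \<Rightarrow> complex" where "R t = of_real (\<gamma> t \<bullet> \<gamma> t)" for t
  define P where "P t = eval3 (dir_deriv (complexify z) F) (complexify (y t))" for t
  define S where "S t = (\<Sum>i\<in>UNIV. eval3 (partial i F) (complexify (y t)) * of_real (\<gamma> t $ i))" for t
  define Q :: "real \<Rightarrow> complex" where "Q t = of_real (z \<bullet> \<gamma> t)" for t
  have zero: "R t * P t - S t * Q t = 0" if t: "t \<in> {a'<..<b'}" for t
  proof -
    obtain l where "gradient F (complexify (y t)) = l *s complexify (\<gamma> t)" using par[OF t] by blast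
    then have l: "eval3 (partial i F) (complexify (y t)) = l * of_real (\<gamma> t $ i)" for i
      by (simp add: gradient_def vec_eq_iff)
    have "P t = l * of_real (z \<bullet> \<gamma> t)" "S t = l * of_real (\<gamma> t \<bullet> \<gamma> t)"
      by (simp_all add: P_def S_def eval3_dir_deriv l inner_vec_def sum_3 algebra_simps)
    then show ?thesis by (simp add: R_def Q_def)
  qed
  have s': "s \<in> {a<..<b}" by (rule in'[OF s])
  define A where "A = eval3 (dir_deriv (complexify z) (dir_deriv (complexify z) F)) (complexify (y s))"
  have dP: "(P has_vector_derivative A) (at s)"
    unfolding P_def[abs_def] A_def using eval3_dir_deriv_deriv[OF y_deriv[OF s']] by (simp add: z_def)
  obtain R' where dR: "(R has_vector_derivative R') (at s)"
    unfolding R_def[abs_def]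
    using bounded_linear.has_vector_derivative[OF bounded_linear_of_real has_vector_derivative_inner[OF \<gamma>[OF s'] \<gamma>[OF s']]]
    by blast
  have const: "((\<lambda>_. z) has_vector_derivative 0) (at s)" by simp
  have dQ: "(Q has_vector_derivative of_real (z \<bullet> g s)) (at s)"
    unfolding Q_def[abs_def]
    using bounded_linear.has_vector_derivative[OF bounded_linear_of_real has_vector_derivative_inner[OF const \<gamma>[OF s']]]
    by simp
  have comp: "((\<lambda>t. complex_of_real (\<gamma> t $ i)) has_vector_derivative of_real (g s $ i)) (at s)" for i
    using bounded_linear.has_vector_derivative[OF bounded_linear_of_real 
        bounded_linear.has_vector_derivative[OF bounded_linear_vec_nth \<gamma>[OF s']]] .
  have "(S has_vector_derivative (\<Sum>i\<in>UNIV. eval3 (partial i F) (complexify (y s)) * of_real (g s $ i) +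
      eval3 (dir_deriv (complexify (y' s)) (partial i F)) (complexify (y s)) * of_real (\<gamma> s $ i))) (at s)"
    unfolding S_def[abs_def]
    by (intro has_vector_derivative_sum has_vector_derivative_mult eval3_dir_deriv_deriv y_deriv s' comp)
  then obtain S' where dS: "(S has_vector_derivative S') (at s)" by blast
  have "R s * A + R' * P s - (S s * of_real (z \<bullet> g s) + S' * Q s) = 0"
    by (rule has_vector_derivative_zero_on_interval[OF has_vector_derivative_diff[OF
          has_vector_derivative_mult[OF dR dP] has_vector_derivative_mult[OF dS dQ]] s zero])
  moreover have "P s = 0" using tang[OF s] by (simp add: P_def z_def)
  moreover have "Q s = 0" using y'\<gamma>[OF s'] by (simp add: Q_def z_def)
  ultimately have eq: "R s * A = S s * of_real (z \<bullet> g s)" by simp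
  obtain l where l: "gradient F (complexify (y s)) = l *s complexify (\<gamma> s)" using par[OF s] by blast
  with grad have "l \<noteq> 0" by auto
  have l': "eval3 (partial i F) (complexify (y s)) = l * of_real (\<gamma> s $ i)" for i
    using l by (simp add: gradient_def vec_eq_iff)
  have "S s = l * of_real (\<gamma> s \<bullet> \<gamma> s)"
    by (simp add: S_def l' inner_vec_def sum_3 algebra_simps)
  moreover have "\<gamma> s \<bullet> \<gamma> s \<noteq> 0" using \<gamma>_nz[OF s'] by simp
  moreover have "z \<bullet> g s \<noteq> 0" using y'g[OF s'] w0[OF s] \<rho>[OF s'] by (simp add: z_def)
  ultimately have "R s * A \<noteq> 0" using \<open>l \<noteq> 0\<close> unfolding eq by simp
  then show ?thesis by (auto simp: A_def z_def)
qed

text \<open>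
  The coefficient of \<open>\<epsilon>\<^bsup>2k+1\<^esup>\<close> in the even function \<open>F\<^sup>k g (y + \<epsilon> y')\<close> is the logarithmic derivative
  of \<open>g\<^sup>3 Hess(F)\<^sup>k\<close> along the arc.
\<close>

lemma constant_along_arc:
  assumes F: "homogeneous d F" and sub: "{a'<..<b'} \<subseteq> {a<..<b}"
    and Fy: "\<And>s. s \<in> {a'<..<b'} \<Longrightarrow> eval3 F (complexify (y s)) = 0"
    and w0: "\<And>s. s \<in> {a'<..<b'} \<Longrightarrow> w s \<noteq> 0"
    and grad: "\<And>s. s \<in> {a'<..<b'} \<Longrightarrow> gradient F (complexify (y s)) \<noteq> 0"
    and even: "\<And>s e. s \<in> {a'<..<b'} \<Longrightarrow>
      eval3 (F ^ k * G) (complexify (y s + e *\<^sub>R y' s)) = eval3 (F ^ k * G) (complexify (y s - e *\<^sub>R y' s))"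
    and k: "k \<ge> 1"
  obtains c where "\<And>s. s \<in> {a'<..<b'} \<Longrightarrow> eval3 (G ^ 3 * Hess F ^ k) (complexify (y s)) = c"
proof -
  have "((\<lambda>s. eval3 (G ^ 3 * Hess F ^ k) (complexify (y s))) has_vector_derivative 0) (at s)"
    if s: "s \<in> {a'<..<b'}" for s
  proof -
    have s': "s \<in> {a<..<b}" using s sub by blast
    define x where "x = complexify (y s)"
    define z where "z = complexify (y' s)"
    define A where "A = eval3 (dir_deriv z (dir_deriv z F)) x"
    define B where "B = eval3 (dir_deriv z (dir_deriv z (dir_deriv z F))) x"
    define G0 where "G0 = eval3 G x"
    define G1 where "G1 = eval3 (dir_deriv z G) x"
    define H0 where "H0 = eval3 (Hess F) x"
    define H1 where "H1 = eval3 (dir_deriv z (Hess F)) x"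
    have F1: "eval3 (dir_deriv z F) x = 0"
      unfolding x_def z_def
      by (rule has_vector_derivative_zero_on_interval[OF eval3_dir_deriv_deriv[OF y_deriv[OF s']] s Fy])
    have F0: "eval3 F x = 0" using Fy[OF s] by (simp add: x_def)
    have A: "A \<noteq> 0"
      unfolding A_def x_def z_def by (rule second_derivative_nonzero[OF F sub Fy w0 s grad[OF s]])
    have 1: "of_nat k * B * G0 + 3 * A * G1 = 0"
      unfolding A_def B_def G0_def G1_def
    proof (rule even_expansion[OF _ F0 F1 _ k])
      show "eval3 (F ^ k * G) (x + of_real e *s z) = eval3 (F ^ k * G) (x - of_real e *s z)" for e
        using even[OF s, of e] unfolding x_def z_def eval3_real_line .
    qed (use A A_def in simp)
    have cr: "cross3 (y s) (y' s) \<noteq> 0"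
      using y_cross_y'[OF s'] w0[OF s] \<rho>[OF s'] \<gamma>_nz[OF s'] by simp
    \<comment> \<open>The Hessian lemma needs a third basis vector; with the cross product the
      determinant is a squared length.\<close>
    have "det (vector [x, z, complexify (cross3 (y s) (y' s))] :: complex^3^3) =
        of_real (cross3 (y s) (y' s) \<bullet> cross3 (y s) (y' s))"
      by (simp add: det_3 x_def z_def cross3_def inner_vec_def sum_3 algebra_simps)
    then have D: "det (vector [x, z, complexify (cross3 (y s) (y' s))] :: complex^3^3) \<noteq> 0" using cr by simp
    have 2: "A * H1 = H0 * B"
      unfolding A_def B_def H0_def H1_def by (rule hessian_tangential_derivative[OF F F0 F1 D])
    note deriv = eval3_dir_deriv_deriv[OF y_deriv[OF s']]
    have dG: "((\<lambda>s. eval3 G (complexify (y s))) has_vector_derivative G1) (at s)"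
      using deriv[of G] by (simp add: G1_def x_def z_def)
    have dG2: "((\<lambda>s. eval3 G (complexify (y s)) * eval3 G (complexify (y s))) has_vector_derivative
        G0 * G1 + G1 * G0) (at s)"
      using has_vector_derivative_mult[OF dG dG] by (simp add: G0_def x_def)
    have dG3: "((\<lambda>s. eval3 G (complexify (y s)) ^ 3) has_vector_derivative 3 * G0\<^sup>2 * G1) (at s)"
      using has_vector_derivative_mult[OF dG2 dG] by (simp add: G0_def x_def power3_eq_cube power2_eq_square algebra_simps)
    have dHn: "((\<lambda>s. eval3 (Hess F) (complexify (y s)) ^ n) has_vector_derivative of_nat n * H0 ^ (n - 1) * H1) (at s)" for n
    proof (induction n)
      case (Suc n)
      have "((\<lambda>s. eval3 (Hess F) (complexify (y s)) * eval3 (Hess F) (complexify (y s)) ^ n) has_vector_derivative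
          H0 * (of_nat n * H0 ^ (n - 1) * H1) + H1 * H0 ^ n) (at s)"
        using has_vector_derivative_mult[OF deriv[of "Hess F"] Suc.IH] by (simp add: H0_def H1_def x_def z_def)
      moreover have "H0 * (of_nat n * H0 ^ (n - 1) * H1) + H1 * H0 ^ n = of_nat (Suc n) * H0 ^ n * H1"
        by (cases n) (simp_all add: algebra_simps)
      ultimately show ?case by simp
    qed simp
    have "((\<lambda>s. eval3 (G ^ 3 * Hess F ^ k) (complexify (y s))) has_vector_derivative
        G0 ^ 3 * (of_nat k * H0 ^ (k - 1) * H1) + 3 * G0\<^sup>2 * G1 * H0 ^ k) (at s)"
      using has_vector_derivative_mult[OF dG3 dHn[of k]] by (simp add: G0_def H0_def x_def)
    moreover have "G0 ^ 3 * (of_nat k * H0 ^ (k - 1) * H1) + 3 * G0\<^sup>2 * G1 * H0 ^ k = 0"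
    proof -
      \<comment> \<open>The derivative is multiplied by \<open>A\<close>; the Hessian relation
        rewrites \<open>A * H1\<close>, the evenness relation rewrites \<open>3 * A * G1\<close>,
        and the two terms cancel.\<close>
      obtain j where j: "k = Suc j" using k by (cases k) auto
      have "A * (G0 ^ 3 * (of_nat k * H0 ^ (k - 1) * H1) + 3 * G0\<^sup>2 * G1 * H0 ^ k) =
          G0 ^ 3 * of_nat k * H0 ^ j * (A * H1) + G0\<^sup>2 * H0 ^ k * (3 * A * G1)"
        by (simp add: j algebra_simps)
      also have "3 * A * G1 = - (of_nat k * B * G0)" using 1 by (simp add: eq_neg_iff_add_eq_0 add.commute)
      also have "G0 ^ 3 * of_nat k * H0 ^ j * (A * H1) + G0\<^sup>2 * H0 ^ k * - (of_nat k * B * G0) = 0"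
        unfolding 2 by (simp add: j power2_eq_square power3_eq_cube algebra_simps)
      finally show ?thesis using A by simp
    qed
    ultimately show ?thesis by simp
  qed
  then show ?thesis using constant_on_interval that by blast
qed

end

lemma smooth_boundary_arc_surface_arc:
  assumes K: "K = 1 \<or> K = -1" and arc: "smooth_boundary_arc K \<Omega> a b \<gamma>"
  obtains g h where "surface_arc K a b \<gamma> g h"
proof -
  from arc obtain D where D: "D 0 = \<gamma>" "\<And>m t. t \<in> {a<..<b} \<Longrightarrow> (D m has_vector_derivative D (Suc m) t) (at t)"
    unfolding smooth_boundary_arc_def smooth_curve_on_def by blast
  have ab: "a < b" and nz: "\<And>t. t \<in> {a<..<b} \<Longrightarrow> vector_derivative \<gamma> (at t) \<noteq> 0"
    and op: "openin (top_of_set (boundary K \<Omega>)) (\<gamma> ` {a<..<b})"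
    using arc unfolding smooth_boundary_arc_def by blast+
  have "boundary K \<Omega> \<subseteq> surface K"
    unfolding boundary_def using frontier_of_subset_topspace[of "top_of_set (surface K)" \<Omega>] by simp
  moreover have "\<gamma> ` {a<..<b} \<subseteq> boundary K \<Omega>" using openin_subset[OF op] by simp
  ultimately have surf: "\<gamma> t \<in> surface K" if "t \<in> {a<..<b}" for t using that by blast
  have "surface_arc K a b \<gamma> (D 1) (D 2)"
  proof
    show "K = 1 \<or> K = -1" "a < b" by fact+
    fix s assume s: "s \<in> {a<..<b}"
    show \<gamma>: "(\<gamma> has_vector_derivative D 1 s) (at s)" using D(2)[OF s, of 0] D(1) by simp
    show "(D 1 has_vector_derivative D 2 s) (at s)" using D(2)[OF s, of 1] by (simp add: numeral_2_eq_2)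
    show "\<gamma> s \<in> surface K" by (rule surf[OF s])
    show "D 1 s \<noteq> 0" using nz[OF s] vector_derivative_at[OF \<gamma>] by simp
  next
    show "continuous_on {a<..<b} (D 2)"
      by (intro continuous_at_imp_continuous_on ballI has_vector_derivative_continuous, erule D(2))
  qed
  then show ?thesis by (rule that)
qed

context surface_arc
begin

text \<open>The reflection law exchanges the angular momenta proportional to \<open>y + \<epsilon> y'\<close> and \<open>y - \<epsilon> y'\<close>.\<close>

lemma integral_even_along_arc:
  assumes cv: "convex_domain K \<Omega>" and arc: "smooth_boundary_arc K \<Omega> a b \<gamma>"
    and inv: "\<And>s s'. billiard_orbit K \<Omega> s s' \<Longrightarrow> \<Phi> s = \<Phi> s'"
    and \<Psi>: "homogeneous m \<Psi>"
    and \<Phi>\<Psi>: "\<And>z1 z2 r1 r2. \<lbrakk>r1 \<in> \<Omega>; r2 \<in> \<Omega>; z1 \<bullet> r1 = 0; z2 \<bullet> r2 = 0; form K z1 z1 = 1; form K z2 z2 = 1;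
       \<And>s1 s2. s1 \<in> \<Omega> \<Longrightarrow> s2 \<in> \<Omega> \<Longrightarrow> z1 \<bullet> s1 = 0 \<Longrightarrow> z2 \<bullet> s2 = 0 \<Longrightarrow> \<Phi> (s1, vel K s1 z1) = \<Phi> (s2, vel K s2 z2);
       \<And>s1 s2. s1 \<in> \<Omega> \<Longrightarrow> s2 \<in> \<Omega> \<Longrightarrow> z1 \<bullet> s1 = 0 \<Longrightarrow> z2 \<bullet> s2 = 0 \<Longrightarrow> \<Phi> (s1, vel K s1 (- z1)) = \<Phi> (s2, vel K s2 (- z2))\<rbrakk>
     \<Longrightarrow> eval3 \<Psi> (complexify z1) = eval3 \<Psi> (complexify z2)"
    and s: "s \<in> {a<..<b}"
  shows "eval3 \<Psi> (complexify (y s + e *\<^sub>R y' s)) = eval3 \<Psi> (complexify (y s - e *\<^sub>R y' s))"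
proof (cases "e *\<^sub>R y' s = 0")
  case False
  have op: "openin (top_of_set (surface K)) \<Omega>" using cv by (auto simp: convex_domain_def)
  have "\<gamma> ` {a<..<b} \<subseteq> boundary K \<Omega>"
    using arc openin_subset unfolding smooth_boundary_arc_def by fastforce
  then have "\<gamma> s \<in> boundary K \<Omega>" using s by blast
  note q0 = boundary_point(1,2)[OF op this]
  define v where "v = e *\<^sub>R y' s"
  have v0: "v \<noteq> 0" using False by (simp add: v_def)
  have v\<gamma>: "v \<bullet> \<gamma> s = 0" using y'\<gamma>[OF s] by (simp add: v_def)
  have yv: "form K (y s) v = 0" "form K v (y s) = 0"
    using yy'[OF s] by (simp_all add: v_def form_simps form_commute[of K "y' s" "y s"])
  have vv: "0 < form K v v" by (rule form_line_pos[OF K \<gamma>\<gamma>[OF s] v\<gamma> v0])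
  \<comment> \<open>\<open>v\<close> is orthogonal to \<open>y s\<close>, so \<open>y s + v\<close>
    and \<open>y s - v\<close> have the same length; one factor makes both of them unit
    momenta.\<close>
  define n where "n = sqrt (1 + form K v v)"
  have n: "0 < n" "n * n = 1 + form K v v" using vv by (simp_all add: n_def)
  define z1 where "z1 = (1 / n) *\<^sub>R (y s + v)"
  define z2 where "z2 = (1 / n) *\<^sub>R (y s - v)"
  have z\<gamma>: "z1 \<bullet> \<gamma> s = 0" "z2 \<bullet> \<gamma> s = 0"
    using y\<gamma>[of s] v\<gamma> by (simp_all add: z1_def z2_def inner_add_left inner_diff_left)
  have zz: "form K z1 z1 = 1" "form K z2 z2 = 1"
  proof -
    have "form K z1 z1 = (1 + form K v v) / (n * n)" "form K z2 z2 = (1 + form K v v) / (n * n)"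
      by (simp_all add: z1_def z2_def form_simps yy[OF s] yv add_divide_distrib)
    then show "form K z1 z1 = 1" "form K z2 z2 = 1" unfolding n(2) using vv by simp_all
  qed
  have ne: "z1 \<noteq> z2"
  proof
    assume "z1 = z2"
    then have "n *\<^sub>R z1 = n *\<^sub>R z2" by simp
    then have "y s + v = y s - v" using n by (simp add: z1_def z2_def)
    then have "2 *\<^sub>R v = 0" by (simp add: scaleR_2 algebra_simps)
    with v0 show False by simp
  qed
  have "z1 + z2 = (2 / n) *\<^sub>R y s"
    by (simp add: z1_def z2_def algebra_simps scaleR_2[symmetric])
  then have m1: "z1 + z2 = (2 / (n * \<rho> s)) *\<^sub>R cross3 (\<gamma> s) (g s)" by (simp add: y_def \<Gamma>_def)
  have \<Gamma>y: "\<Gamma> s = \<rho> s *\<^sub>R y s" using \<rho>[OF s] by (simp add: y_def)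
  have m2: "form K (z1 - z2) (cross3 (\<gamma> s) (g s)) = 0"
    unfolding \<Gamma>_def[symmetric] \<Gamma>y by (simp add: z1_def z2_def form_simps yv)
  \<comment> \<open>The sign \<open>t = -1\<close> reverses both momenta. It is needed because
    \<open>\<Psi>\<close> is built from the integral at \<open>z\<close> and at
    \<open>- z\<close>.\<close>
  have bounce: "\<exists>r1\<in>\<Omega>. \<exists>r2\<in>\<Omega>. t *\<^sub>R z1 \<bullet> r1 = 0 \<and> t *\<^sub>R z2 \<bullet> r2 = 0 \<and>
      \<Phi> (r1, vel K r1 (t *\<^sub>R z1)) = \<Phi> (r2, vel K r2 (t *\<^sub>R z2))" if t: "t = 1 \<or> t = -1" for t
  proof (rule bounce_invariant[where \<Phi> = \<Phi> and \<gamma> = \<gamma>, OF K cv _ arc s \<gamma>[OF s] \<gamma>g[OF s] regular[OF s]])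
    show "t *\<^sub>R z1 + t *\<^sub>R z2 = (t * (2 / (n * \<rho> s))) *\<^sub>R cross3 (\<gamma> s) (g s)"
      using m1 by (simp flip: scaleR_add_right)
    have "form K (t *\<^sub>R z1 - t *\<^sub>R z2) (cross3 (\<gamma> s) (g s)) = t * form K (z1 - z2) (cross3 (\<gamma> s) (g s))"
      by (simp add: form_simps algebra_simps)
    then show "form K (t *\<^sub>R z1 - t *\<^sub>R z2) (cross3 (\<gamma> s) (g s)) = 0" using m2 by simp
    show "\<And>p p'. billiard_orbit K \<Omega> p p' \<Longrightarrow> \<Phi> p = \<Phi> p'" by (rule inv)
    show "t *\<^sub>R z1 \<bullet> \<gamma> s = 0" "t *\<^sub>R z2 \<bullet> \<gamma> s = 0" using z\<gamma> by simp_all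
    show "form K (t *\<^sub>R z1) (t *\<^sub>R z1) = 1" "form K (t *\<^sub>R z2) (t *\<^sub>R z2) = 1"
      using zz t by (auto simp: form_simps)
    show "t *\<^sub>R z1 \<noteq> t *\<^sub>R z2" using ne t by auto
  qed
  have flight: "\<Phi> (p, vel K p z) = \<Phi> (p', vel K p' z)"
    if "p \<in> \<Omega>" "p' \<in> \<Omega>" "z \<bullet> p = 0" "z \<bullet> p' = 0" "form K z z = 1" for p p' z
    by (rule flight_invariant[where \<Phi> = \<Phi>, OF K cv q0 _ that]) (rule inv)
  have trans: "\<Phi> (s1, vel K s1 (t *\<^sub>R z1)) = \<Phi> (s2, vel K s2 (t *\<^sub>R z2))"
    if t: "t = 1 \<or> t = -1" and s12: "s1 \<in> \<Omega>" "s2 \<in> \<Omega>" "z1 \<bullet> s1 = 0" "z2 \<bullet> s2 = 0" for t s1 s2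
  proof -
    obtain r1 r2 where r: "r1 \<in> \<Omega>" "r2 \<in> \<Omega>" "t *\<^sub>R z1 \<bullet> r1 = 0" "t *\<^sub>R z2 \<bullet> r2 = 0"
      "\<Phi> (r1, vel K r1 (t *\<^sub>R z1)) = \<Phi> (r2, vel K r2 (t *\<^sub>R z2))" using bounce[OF t] by blast
    have unit: "form K (t *\<^sub>R z1) (t *\<^sub>R z1) = 1" "form K (t *\<^sub>R z2) (t *\<^sub>R z2) = 1"
      using zz t by (auto simp: form_simps)
    have "\<Phi> (s1, vel K s1 (t *\<^sub>R z1)) = \<Phi> (r1, vel K r1 (t *\<^sub>R z1))"
      using s12(3) by (intro flight s12(1) r(1,3) unit) simp
    moreover have "\<Phi> (s2, vel K s2 (t *\<^sub>R z2)) = \<Phi> (r2, vel K r2 (t *\<^sub>R z2))"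
      using s12(4) by (intro flight s12(2) r(2,4) unit) simp
    ultimately show ?thesis using r(5) by simp
  qed
  obtain r1 r2 where r: "r1 \<in> \<Omega>" "r2 \<in> \<Omega>" "z1 \<bullet> r1 = 0" "z2 \<bullet> r2 = 0" using bounce[of 1] by auto
  have "eval3 \<Psi> (complexify z1) = eval3 \<Psi> (complexify z2)"
  proof (rule \<Phi>\<Psi>[OF r zz])
    fix s1 s2 assume s12: "s1 \<in> \<Omega>" "s2 \<in> \<Omega>" "z1 \<bullet> s1 = 0" "z2 \<bullet> s2 = 0"
    show "\<Phi> (s1, vel K s1 z1) = \<Phi> (s2, vel K s2 z2)" using trans[OF _ s12, of 1] by simp
    show "\<Phi> (s1, vel K s1 (- z1)) = \<Phi> (s2, vel K s2 (- z2))" using trans[OF _ s12, of "-1"] by simp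
  qed
  then have "eval3 \<Psi> (complexify (n *\<^sub>R z1)) = eval3 \<Psi> (complexify (n *\<^sub>R z2))"
    using eval3_homogeneous[OF \<Psi>] by simp
  moreover have "n *\<^sub>R z1 = y s + v" "n *\<^sub>R z2 = y s - v" using n by (simp_all add: z1_def z2_def)
  ultimately show ?thesis by (simp add: v_def)
next
  case True
  then show ?thesis by (simp only: add_0_right diff_zero)
qed

end

theorem theorem1p4:
  fixes K :: real and \<Omega> :: "(real^3) set"
    and \<gamma> :: "real \<Rightarrow> real^3" and a b :: real
    and \<Phi> :: "(real^3) \<times> (real^3) \<Rightarrow> real" and n :: nat
    and G F :: poly3 and d :: nat
  assumes "K = 1 \<or> K = -1"
    and "convex_domain K \<Omega>"
    and "smooth_boundary_arc K \<Omega> a b \<gamma>"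
    and "\<not> is_geodesic_arc K a b \<gamma>"
    and "polynomial_integral K \<Omega> n \<Phi>" and "even n"
    and "irreducible G" and "\<exists>e. homogeneous e G"
    and "complexify ` \<gamma> ` {a<..<b} \<subseteq> curve G"
    and "irreducible F" and "homogeneous d F" and "curve F = dual_curve G"
    and "d \<ge> 2"
  shows "\<exists>(k::nat) (\<alpha>::nat) (c::complex) (Q::poly3) (R::poly3).
           k \<ge> 1 \<and>
           (\<exists>q. homogeneous q Q) \<and> (\<exists>r. homogeneous r R) \<and>
           (\<exists>m \<in> dual_curve G. eval3 Q m \<noteq> 0) \<and>
           (\<forall>x :: complex^3.
              eval3 Q x ^ 3 * eval3 (Hess F) x ^ k
                - c * ((x$1)^2 + (x$2)^2 + complex_of_real K * (x$3)^2) ^ \<alpha>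
              = eval3 F x * eval3 R x) \<and>
           (d > 2 \<longrightarrow> \<alpha> > 0)"
proof -
  note K = assms(1) and cv = assms(2) and arc = assms(3) and int = assms(5) and irrG = assms(7)
    and irrF = assms(10) and F = assms(11) and FG = assms(12) and d2 = assms(13)
  obtain e where G: "homogeneous e G" using assms(8) by blast
  obtain g h where sa: "surface_arc K a b \<gamma> g h" using smooth_boundary_arc_surface_arc[OF K arc] by blast
  interpret surface_arc K a b \<gamma> g h by (rule sa)
  obtain s0 where s0: "s0 \<in> {a<..<b}" "w s0 \<noteq> 0" using curvature_nonzero[OF assms(4)] by blast
  \<comment> \<open>The arc is shrunk three times: to nonzero curvature, to smooth points of
    \<open>curve G\<close> and to smooth points of \<open>curve F\<close>. Each shrinking relies on
    the previous one.\<close>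
  obtain a1 b1 where ab1: "a \<le> a1" "a1 < b1" "b1 \<le> b" and w1: "\<And>s. s \<in> {a1<..<b1} \<Longrightarrow> w s \<noteq> 0"
    using subinterval_nonzero[OF continuous_w s0] by blast
  have G\<gamma>: "eval3 G (complexify (\<gamma> s)) = 0" if "s \<in> {a<..<b}" for s
  proof -
    have "complexify (\<gamma> s) \<in> curve G" using assms(9) that by blast
    then show ?thesis by (simp add: curve_def)
  qed
  have G\<gamma>1: "eval3 G (complexify (\<gamma> s)) = 0" if "s \<in> {a1<..<b1}" for s using G\<gamma> that ab1 by auto
  obtain a2 b2 where ab2: "a1 \<le> a2" "a2 < b2" "b2 \<le> b1"
    and grG: "\<And>s. s \<in> {a2<..<b2} \<Longrightarrow> gradient G (complexify (\<gamma> s)) \<noteq> 0"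
    using gradient_nonzero_on_subarc[OF irrG G nonplanar_\<gamma>[OF ab1 w1] G\<gamma>1] by blast
  have in2: "{a2<..<b2} \<subseteq> {a<..<b}" using ab1 ab2 by auto
  have Fy2: "eval3 F (complexify (y s)) = 0" if s: "s \<in> {a2<..<b2}" for s
    by (rule dual_curve_vanishes[OF irrG G FG F in2 _ s grG[OF s]]) (use G\<gamma> in2 in blast)
  have w2: "w s \<noteq> 0" if "s \<in> {a2<..<b2}" for s using w1 that ab2 by auto
  have ab2': "a \<le> a2" "a2 < b2" "b2 \<le> b" using ab1 ab2 by auto
  obtain a3 b3 where ab3: "a2 \<le> a3" "a3 < b3" "b3 \<le> b2"
    and grF: "\<And>s. s \<in> {a3<..<b3} \<Longrightarrow> gradient F (complexify (y s)) \<noteq> 0"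
    using gradient_nonzero_on_subarc[OF irrF F nonplanar_y[OF ab2' w2] Fy2] by blast
  have in3: "{a3<..<b3} \<subseteq> {a<..<b}" using ab3 ab2' by auto
  have Fy: "eval3 F (complexify (y s)) = 0" and w3: "w s \<noteq> 0" if "s \<in> {a3<..<b3}" for s
    using Fy2 w2 that ab3 by auto
  have ab3': "a \<le> a3" "a3 < b3" "b3 \<le> b" using ab2' ab3 by auto
  have np: "nonplanar_on a3 b3 y" by (rule nonplanar_y[OF ab3' w3])
  have dvd: "F dvd X" if X: "homogeneous r X" and Xy: "\<And>s. s \<in> {a3<..<b3} \<Longrightarrow> eval3 X (complexify (y s)) = 0" for r X
    by (rule irreducible_dvd_if_vanishing_on_arc[OF irrF F X np Fy Xy])
  \<comment> \<open>Any point of the arc serves here: it supplies a point \<open>\<gamma> s\<close>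
    of the surface outside the domain.\<close>
  define s where "s = (a3 + b3) / 2"
  have s3: "s \<in> {a3<..<b3}" using ab3 by (auto simp: s_def)
  then have sab: "s \<in> {a<..<b}" using in3 by blast
  have op: "openin (top_of_set (surface K)) \<Omega>" using cv by (auto simp: convex_domain_def)
  have "\<gamma> ` {a<..<b} \<subseteq> boundary K \<Omega>"
    using arc openin_subset unfolding smooth_boundary_arc_def by fastforce
  then have "\<gamma> s \<in> boundary K \<Omega>" using sab by blast
  note q0 = boundary_point(1,2)[OF op this]
  have inv: "\<Phi> p = \<Phi> p'" if "billiard_orbit K \<Omega> p p'" for p p'
    using int that unfolding polynomial_integral_def by blast
  obtain \<Psi> where \<Psi>: "homogeneous (2 * n) \<Psi>"
    and nonconst: "\<And>c. \<exists>x. eval3 \<Psi> (complexify x) \<noteq> c * of_real (form K x x) ^ n"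
    and even\<Psi>: "\<And>s e. s \<in> {a<..<b} \<Longrightarrow> eval3 \<Psi> (complexify (y s + e *\<^sub>R y' s)) = eval3 \<Psi> (complexify (y s - e *\<^sub>R y' s))"
  proof (rule polynomial_integral_form[OF K cv int q0], goal_cases)
    case (1 \<Psi>)
    show ?case
      by (rule 1(1)[OF 1(2,3)], rule integral_even_along_arc[OF cv arc inv 1(2)], assumption, rule 1(4))
  qed
  have "((\<lambda>s. eval3 \<Psi> (complexify (y s))) has_vector_derivative 0) (at s)" if s: "s \<in> {a3<..<b3}" for s
  proof -
    have s': "s \<in> {a<..<b}" using s in3 by blast
    have "eval3 (dir_deriv (complexify (y' s)) \<Psi>) (complexify (y s)) = 0"
      by (rule even_imp_dir_deriv_0) (simp only: eval3_real_line even\<Psi>[OF s'])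
    then show ?thesis using eval3_dir_deriv_deriv[OF y_deriv[OF s'], of \<Psi>] by simp
  qed
  then obtain c0 where c0: "\<And>s. s \<in> {a3<..<b3} \<Longrightarrow> eval3 \<Psi> (complexify (y s)) = c0"
    using constant_on_interval by blast
  \<comment> \<open>\<open>lam3 K\<close> is 1 along \<open>y\<close>, so this removes the constant
    \<open>c0\<close> without changing the degree; the nontriviality of \<open>\<Psi>\<close> keeps
    \<open>P\<close> nonzero.\<close>
  define P where "P = \<Psi> - const3 c0 * lam3 K ^ n"
  have P: "homogeneous (2 * n) P"
    unfolding P_def using homogeneous_power[OF homogeneous_lam3, of n K]
    by (intro homogeneous_diff \<Psi> homogeneous_const3_mult) (simp add: mult.commute)
  have P0: "P \<noteq> 0"
  proof
    assume "P = 0"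
    then have "eval3 \<Psi> (complexify x) = c0 * of_real (form K x x) ^ n" for x
      using arg_cong[of P 0 "\<lambda>P. eval3 P (complexify x)"] by (simp add: P_def eval3_lam3_real)
    with nonconst[of c0] show False by blast
  qed
  have "F dvd P"
    by (rule dvd[OF P]) (use c0 yy in3 in \<open>auto simp: P_def eval3_lam3_real\<close>)
  have nonunit: "\<not> is_unit F" using irrF by (simp add: irreducible_def)
  define k where "k = multiplicity F P"
  obtain Q where Q: "P = F ^ k * Q" "\<not> F dvd Q"
    using multiplicity_decompose'[OF P0 nonunit] unfolding k_def by blast
  have k: "k \<ge> 1" using \<open>F dvd P\<close> Q by (cases k) auto
  have FkQ: "homogeneous (2 * n) (F ^ k * Q)" "F ^ k * Q \<noteq> 0" using P P0 Q(1) by simp_all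
  have kd: "k * d \<le> 2 * n" and Qh: "homogeneous (2 * n - k * d) Q"
    using homogeneous_cofactor[OF homogeneous_power[OF F] FkQ] by simp_all
  have evenP: "eval3 (F ^ k * Q) (complexify (y s + e *\<^sub>R y' s)) = eval3 (F ^ k * Q) (complexify (y s - e *\<^sub>R y' s))"
    if s: "s \<in> {a3<..<b3}" for s e
  proof -
    have s': "s \<in> {a<..<b}" using s in3 by blast
    \<comment> \<open>The subtracted power of \<open>lam3 K\<close> is even in \<open>e\<close> too,
      as \<open>y'\<close> is orthogonal to \<open>y\<close>, so evenness passes from
      \<open>\<Psi>\<close> to \<open>P\<close>.\<close>
    have "form K (y s + e *\<^sub>R y' s) (y s + e *\<^sub>R y' s) = form K (y s - e *\<^sub>R y' s) (y s - e *\<^sub>R y' s)"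
      using yy'[OF s'] by (simp add: form_simps form_commute[of K "y' s" "y s"])
    then have "eval3 P (complexify (y s + e *\<^sub>R y' s)) = eval3 P (complexify (y s - e *\<^sub>R y' s))"
      unfolding P_def eval3_simps eval3_lam3_real eval3_const3 using even\<Psi>[OF s', of e] by simp
    then show ?thesis by (simp only: Q(1))
  qed
  obtain c where c: "\<And>s. s \<in> {a3<..<b3} \<Longrightarrow> eval3 (Q ^ 3 * Hess F ^ k) (complexify (y s)) = c"
    using constant_along_arc[OF F in3 Fy w3 grF evenP k] by blast
  \<comment> \<open>\<open>Q\<close> has degree \<open>2 * n - k * d\<close> and the Hessian
    \<open>3 * (d - 2)\<close>, so \<open>Q ^ 3 * Hess F ^ k\<close> has degree
    \<open>6 * (n - k)\<close>, twice this exponent. The subtraction does not truncate, since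
    \<open>2 * k \<le> k * d \<le> 2 * n\<close>.\<close>
  define \<alpha> where "\<alpha> = 3 * (n - k)"
  have "k * 2 \<le> k * d" using d2 by simp
  then have kn: "k \<le> n" using kd by linarith
  have deg: "3 * (2 * n - k * d) + k * (3 * (d - 2)) = \<alpha> * 2"
  proof -
    have "k * (d - 2) = k * d - k * 2" by (simp add: diff_mult_distrib2)
    then have "k * (3 * (d - 2)) = 3 * (k * d - k * 2)" by (simp only: mult.left_commute)
    then show ?thesis using kd kn \<open>k * 2 \<le> k * d\<close> unfolding \<alpha>_def by linarith
  qed
  define N where "N = Q ^ 3 * Hess F ^ k - const3 c * lam3 K ^ \<alpha>"
  have N: "homogeneous (\<alpha> * 2) N"
    unfolding N_def
  proof (intro homogeneous_diff homogeneous_const3_mult homogeneous_power homogeneous_lam3)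
    show "homogeneous (\<alpha> * 2) (Q ^ 3 * Hess F ^ k)"
      unfolding deg[symmetric] by (intro homogeneous_mult homogeneous_power Qh homogeneous_Hess F)
  qed
  have "F dvd N"
    by (rule dvd[OF N]) (use c yy in3 in \<open>auto simp: N_def eval3_lam3_real\<close>)
  then obtain R where R: "N = F * R" by auto
  have Rh: "\<exists>r. homogeneous r R"
  proof (cases "N = 0")
    case True
    then have "R = 0" using R irrF by auto
    then show ?thesis by auto
  next
    case False
    then show ?thesis using homogeneous_cofactor(2)[OF F, of "\<alpha> * 2" R] N R by auto
  qed
  \<comment> \<open>The arc \<open>y\<close> consists of points of the dual curve. If
    \<open>Q\<close> vanished at all of them, \<open>F\<close> would divide \<open>Q\<close>,
    against the choice of \<open>k\<close> as the full multiplicity.\<close>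
  have Qnz: "\<exists>m\<in>dual_curve G. eval3 Q m \<noteq> 0"
  proof (rule ccontr)
    assume none: "\<not> ?thesis"
    have "eval3 Q (complexify (y s)) = 0" if s: "s \<in> {a3<..<b3}" for s
    proof -
      have "y s \<noteq> 0" using yy[of s] s in3 by (auto simp: form_simps)
      then have "complexify (y s) \<in> dual_curve G" using Fy[OF s] by (simp add: curve_def flip: FG)
      with none show ?thesis by blast
    qed
    from dvd[OF Qh this] have "F dvd Q" .
    with Q(2) show False by simp
  qed
  have eq: "eval3 Q x ^ 3 * eval3 (Hess F) x ^ k - c * ((x$1)^2 + (x$2)^2 + complex_of_real K * (x$3)^2) ^ \<alpha>
      = eval3 F x * eval3 R x" for x
    using arg_cong[OF R, of "\<lambda>P. eval3 P x"] by (simp add: N_def eval3_lam3)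
  \<comment> \<open>Now \<open>3 * k \<le> k * d \<le> 2 * n\<close> with \<open>k \<ge> 1\<close>,
    so \<open>k < n\<close>.\<close>
  have "\<alpha> > 0" if "d > 2"
  proof -
    have "k * 3 \<le> k * d" using that by (intro mult_le_mono2) simp
    then have "k < n" using kd k by linarith
    then show ?thesis by (simp add: \<alpha>_def)
  qed
  with k Qh Rh Qnz eq show ?thesis by blast
qed

end
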